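(* Let $M$ be a complete Riemannian manifold (separable or non-separable, finite- or infinite-dimensional) and let $f:M\to\mathbb{R}\cup\{\infty\}$ be a lower semicontinuous function which is bounded below and proper. Then for each $\varepsilon>0$ there is a bounded, $C^1$-smooth and Lipschitz function $\varphi:M\to\mathbb{R}$ such that (1) $f-\varphi$ attains its strong minimum on $M$, and (2) $\|\varphi\|_\infty<\varepsilon$ and $\|d\varphi\|_\infty<\varepsilon$.
   Context: A Riemannian manifold is a paracompact smooth manifold $M$ modeled on a real Hilbert space (not necessarily separable, possibly infinite-dimensional) with a Riemannian metric $\langle\cdot,\cdot\rangle_p$ on each $T_pM$ whose norm $\|v\|_p=\langle v,v\rangle_p^{1/2}$ corresponds in charts to a norm equivalent to the Hilbert norm. The distance $d_M(p,q)$ is the infimum of the lengths of piecewise $C^1$ paths joining $p$ to $q$ (with value $+\infty$ if $p,q$ lie in different connected components); Lipschitz and complete are understood with respect to $d_M$. $\|\varphi\|_\infty=\sup_{p\in M}|\varphi(p)|$ and $\|d\varphi\|_\infty=\sup_{p\in M}\|d\varphi(p)\|_p$, where $\|d\varphi(p)\|_p=\sup\{|d\varphi(p)(v)|: v\in T_pM,\|v\|_p\le1\}$. A function $g:M\to\mathbb{R}\cup\{\infty\}$ attains its strong minimum on $M$ at $x\in M$ if $g(x)=\inf\{g(z):z\in M\}$ and $d_M(x_n,x)\to0$ whenever $\{x_n\}_{n=1}^\infty$ is a sequence of points of $M$ such that $g(x_n)\to g(x)$. A function $f:M\to\mathbb{R}\cup\{\infty\}$ is proper if it is not identically $\infty$.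 *)

theory Defs
  imports "HOL-Analysis.Analysis"
begin

section \<open>Smooth maps on open subsets of normed spaces\<close>

text \<open>A \<open>k\<close>-linear map is encoded as a function on lists of length \<open>k\<close>.\<close>

definition bounded_multilinear :: "nat \<Rightarrow> ('a::real_normed_vector list \<Rightarrow> 'b::real_normed_vector) \<Rightarrow> bool" where
  "bounded_multilinear k T \<longleftrightarrow>
     (\<forall>vs i. length vs = k \<and> i < k \<longrightarrow> linear (\<lambda>v. T (vs[i := v]))) \<and>
     (\<exists>K. \<forall>vs. length vs = k \<longrightarrow> norm (T vs) \<le> K * prod_list (map norm vs))"

text \<open>
  \<open>f\<close> is \<open>C\<^sup>\<infinity>\<close> on the open set \<open>S\<close> if it has Frechet derivatives of all orders there. Here
  \<open>D k x\<close> is the \<open>k\<close>-th derivative, a bounded \<open>k\<close>-linear map, and the last conjunct says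
  that \<open>D (Suc k)\<close> is the Frechet derivative of \<open>D k\<close> with respect to the operator norm
  on \<open>k\<close>-linear maps. (The spaces of \<open>k\<close>-linear maps for varying \<open>k\<close> do not share one type
  of the form \<open>'a \<Rightarrow>\<^sub>L \<dots>\<close>, hence the encoding by lists.)
\<close>

definition smooth_map_on :: "'a::real_normed_vector set \<Rightarrow> ('a \<Rightarrow> 'b::real_normed_vector) \<Rightarrow> bool" where
  "smooth_map_on S f \<longleftrightarrow>
     (\<exists>D :: nat \<Rightarrow> 'a \<Rightarrow> 'a list \<Rightarrow> 'b.
        (\<forall>x\<in>S. D 0 x [] = f x) \<and>
        (\<forall>k. \<forall>x\<in>S. bounded_multilinear k (D k x)) \<and>
        (\<forall>k. \<forall>x\<in>S. \<forall>e>0. \<exists>d>0. \<forall>y\<in>S. norm (y - x) < d \<longrightarrow>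
           (\<forall>vs. length vs = k \<longrightarrow>
              norm (D k y vs - D k x vs - D (Suc k) x ((y - x) # vs))
                \<le> e * norm (y - x) * prod_list (map norm vs))))"


section \<open>Hilbert manifolds\<close>

text \<open>
  The manifold is the whole type \<open>'m\<close> with its Hausdorff topology. A chart \<open>(U, x)\<close> consists
  of its domain and a map of which only the restriction to \<open>U\<close> matters.
\<close>

type_synonym ('m, 'h) chart = "'m set \<times> ('m \<Rightarrow> 'h)"

definition chart_inv :: "('m, 'h) chart \<Rightarrow> 'h \<Rightarrow> 'm" where
  "chart_inv c = inv_into (fst c) (snd c)"

definition charts_at :: "('m, 'h) chart set \<Rightarrow> 'm \<Rightarrow> ('m, 'h) chart set" where
  "charts_at A p = {c \<in> A. p \<in> fst c}"

text \<open>The atlas is not required to be maximal; none of the notions below depends on that.\<close>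

definition smooth_atlas :: "('m::t2_space, 'h::{real_inner, complete_space}) chart set \<Rightarrow> bool" where
  "smooth_atlas A \<longleftrightarrow>
     (\<Union>c\<in>A. fst c) = UNIV \<and>
     (\<forall>c\<in>A. open (fst c) \<and> open (snd c ` fst c) \<and>
            homeomorphism (fst c) (snd c ` fst c) (snd c) (chart_inv c)) \<and>
     (\<forall>c\<in>A. \<forall>c'\<in>A. smooth_map_on (snd c ` (fst c \<inter> fst c')) (snd c' \<circ> chart_inv c))"

definition paracompact_space :: "'a topology \<Rightarrow> bool" where
  "paracompact_space X \<longleftrightarrow>
     (\<forall>\<U>. (\<forall>U\<in>\<U>. openin X U) \<and> \<Union>\<U> = topspace X \<longrightarrow>
        (\<exists>\<V>. (\<forall>V\<in>\<V>. openin X V) \<and> \<Union>\<V> = topspace X \<and>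
              (\<forall>V\<in>\<V>. \<exists>U\<in>\<U>. V \<subseteq> U) \<and> locally_finite_in X \<V>))"

text \<open>
  A tangent vector at \<open>p\<close> is the family of its representatives in the charts around \<open>p\<close>,
  which correspond under the derivatives of the transition maps (and is \<open>0\<close> at the other
  charts); the vector space operations are pointwise.
\<close>

type_synonym ('m, 'h) tangent = "('m, 'h) chart \<Rightarrow> 'h"

definition tangent_space ::
  "('m::t2_space, 'h::{real_inner, complete_space}) chart set \<Rightarrow> 'm \<Rightarrow> ('m, 'h) tangent set" where
  "tangent_space A p =
     {v. (\<forall>c\<in>charts_at A p. \<forall>c'\<in>charts_at A p.
            v c' = frechet_derivative (snd c' \<circ> chart_inv c) (at (snd c p)) (v c)) \<and>
         (\<forall>c. c \<notin> charts_at A p \<longrightarrow> v c = 0)}"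


section \<open>Riemannian metrics and the Riemannian distance\<close>

type_synonym ('m, 'h) metric = "'m \<Rightarrow> ('m, 'h) tangent \<Rightarrow> ('m, 'h) tangent \<Rightarrow> real"

definition tangent_norm :: "('m, 'h) metric \<Rightarrow> 'm \<Rightarrow> ('m, 'h) tangent \<Rightarrow> real" where
  "tangent_norm g p v = sqrt (g p v v)"

text \<open>
  The last conjunct is smoothness of the metric: in each chart it is a \<open>C\<^sup>\<infinity>\<close> map into the
  Banach space of bounded bilinear forms.
\<close>

definition riemannian_metric ::
  "('m::t2_space, 'h::{real_inner, complete_space}) chart set \<Rightarrow> ('m, 'h) metric \<Rightarrow> bool" where
  "riemannian_metric A g \<longleftrightarrow>
     (\<forall>p. \<forall>u\<in>tangent_space A p. \<forall>v\<in>tangent_space A p.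
        g p u v = g p v u \<and>
        (\<forall>w\<in>tangent_space A p. g p (\<lambda>c. u c + v c) w = g p u w + g p v w) \<and>
        (\<forall>r. g p (\<lambda>c. r *\<^sub>R u c) v = r * g p u v) \<and>
        (u \<noteq> (\<lambda>c. 0) \<longrightarrow> g p u u > 0)) \<and>
     (\<forall>p. \<forall>c\<in>charts_at A p. \<exists>a>0. \<exists>b>0. \<forall>v\<in>tangent_space A p.
        a * norm (v c) \<le> tangent_norm g p v \<and> tangent_norm g p v \<le> b * norm (v c)) \<and>
     (\<forall>c\<in>A. \<exists>G :: 'h \<Rightarrow> ('h \<Rightarrow>\<^sub>L 'h \<Rightarrow>\<^sub>L real).
        smooth_map_on (snd c ` fst c) G \<and>
        (\<forall>p\<in>fst c. \<forall>u\<in>tangent_space A p. \<forall>v\<in>tangent_space A p.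
           g p u v = blinfun_apply (blinfun_apply (G (snd c p)) (u c)) (v c)))"

definition riemannian_manifold ::
  "('m::t2_space, 'h::{real_inner, complete_space}) chart set \<Rightarrow> ('m, 'h) metric \<Rightarrow> bool" where
  "riemannian_manifold A g \<longleftrightarrow>
     paracompact_space (euclidean :: 'm topology) \<and> smooth_atlas A \<and> riemannian_metric A g"

text \<open>Derivatives are one-sided at the endpoints \<open>a\<close>, \<open>b\<close>.\<close>

definition C1_path_on ::
  "('m::t2_space, 'h::{real_inner, complete_space}) chart set \<Rightarrow> real \<Rightarrow> real \<Rightarrow> (real \<Rightarrow> 'm) \<Rightarrow> bool" where
  "C1_path_on A a b \<gamma> \<longleftrightarrow>
     continuous_on {a..b} \<gamma> \<and>
     (\<forall>c\<in>A. \<exists>D.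
        (\<forall>t\<in>{a..b} \<inter> \<gamma> -` fst c. ((snd c \<circ> \<gamma>) has_vector_derivative D t) (at t within {a..b})) \<and>
        continuous_on ({a..b} \<inter> \<gamma> -` fst c) D)"

text \<open>
  The library predicate \<open>piecewise_C1_differentiable_on\<close> is not used, since it does not
  require the derivative to have one-sided limits at the break points.
\<close>

definition piecewise_C1_path ::
  "('m::t2_space, 'h::{real_inner, complete_space}) chart set \<Rightarrow> (real \<Rightarrow> 'm) \<Rightarrow> bool" where
  "piecewise_C1_path A \<gamma> \<longleftrightarrow>
     (\<exists>(n::nat) ts. ts 0 = 0 \<and> ts n = 1 \<and>
        (\<forall>i<n. ts i < ts (Suc i) \<and> C1_path_on A (ts i) (ts (Suc i)) \<gamma>))"

text \<open>
  At the finitely many break points of a piecewise \<open>C\<^sup>1\<close> path the velocity is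
  unspecified; this does not affect the length.
\<close>

definition velocity ::
  "('m::t2_space, 'h::{real_inner, complete_space}) chart set \<Rightarrow> (real \<Rightarrow> 'm) \<Rightarrow> real \<Rightarrow> ('m, 'h) tangent" where
  "velocity A \<gamma> t =
     (\<lambda>c. if c \<in> charts_at A (\<gamma> t) then vector_derivative (snd c \<circ> \<gamma>) (at t within {0..1}) else 0)"

definition path_len ::
  "('m::t2_space, 'h::{real_inner, complete_space}) chart set \<Rightarrow> ('m, 'h) metric \<Rightarrow> (real \<Rightarrow> 'm) \<Rightarrow> real" where
  "path_len A g \<gamma> = integral {0..1} (\<lambda>t. tangent_norm g (\<gamma> t) (velocity A \<gamma> t))"

text \<open>The infimum of the empty set is \<open>\<infinity>\<close> in \<open>ereal\<close>.\<close>

definition riem_dist ::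
  "('m::t2_space, 'h::{real_inner, complete_space}) chart set \<Rightarrow> ('m, 'h) metric \<Rightarrow> 'm \<Rightarrow> 'm \<Rightarrow> ereal" where
  "riem_dist A g p q =
     Inf {ereal (path_len A g \<gamma>) | \<gamma>. piecewise_C1_path A \<gamma> \<and> \<gamma> 0 = p \<and> \<gamma> 1 = q}"

definition riem_complete ::
  "('m::t2_space, 'h::{real_inner, complete_space}) chart set \<Rightarrow> ('m, 'h) metric \<Rightarrow> bool" where
  "riem_complete A g \<longleftrightarrow>
     (\<forall>s :: nat \<Rightarrow> 'm.
        (\<forall>e>0. \<exists>N. \<forall>m\<ge>N. \<forall>n\<ge>N. riem_dist A g (s m) (s n) < ereal e) \<longrightarrow>
        (\<exists>p. (\<lambda>n. riem_dist A g (s n) p) \<longlonglongrightarrow> 0))"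


section \<open>Functions on the manifold\<close>

text \<open>The constant is taken positive because \<open>0 * \<infinity> = 0\<close> in \<open>ereal\<close>.\<close>

definition riem_lipschitz ::
  "('m::t2_space, 'h::{real_inner, complete_space}) chart set \<Rightarrow> ('m, 'h) metric \<Rightarrow> ('m \<Rightarrow> real) \<Rightarrow> bool" where
  "riem_lipschitz A g \<phi> \<longleftrightarrow>
     (\<exists>L>0. \<forall>p q. ereal \<bar>\<phi> p - \<phi> q\<bar> \<le> ereal L * riem_dist A g p q)"

definition C1_function ::
  "('m::t2_space, 'h::{real_inner, complete_space}) chart set \<Rightarrow> ('m \<Rightarrow> real) \<Rightarrow> bool" where
  "C1_function A \<phi> \<longleftrightarrow>
     (\<forall>c\<in>A. \<exists>D :: 'h \<Rightarrow> ('h \<Rightarrow>\<^sub>L real).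
        (\<forall>x\<in>snd c ` fst c. ((\<phi> \<circ> chart_inv c) has_derivative blinfun_apply (D x)) (at x)) \<and>
        continuous_on (snd c ` fst c) D)"

text \<open>For differentiable \<open>\<phi>\<close> and \<open>v\<close> tangent at \<open>p\<close> the choice of the chart is immaterial.\<close>

definition differential ::
  "('m::t2_space, 'h::{real_inner, complete_space}) chart set \<Rightarrow> ('m \<Rightarrow> real) \<Rightarrow> 'm \<Rightarrow> ('m, 'h) tangent \<Rightarrow> real" where
  "differential A \<phi> p v =
     (let c = (SOME c. c \<in> charts_at A p)
      in frechet_derivative (\<phi> \<circ> chart_inv c) (at (snd c p)) (v c))"

text \<open>Suprema are taken in \<open>ereal\<close>, so that they are \<open>\<infinity>\<close> for unbounded sets.\<close>

definition sup_norm :: "('m \<Rightarrow> real) \<Rightarrow> ereal" where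
  "sup_norm \<phi> = (SUP p. ereal \<bar>\<phi> p\<bar>)"

definition cotangent_norm ::
  "('m::t2_space, 'h::{real_inner, complete_space}) chart set \<Rightarrow> ('m, 'h) metric \<Rightarrow> 'm \<Rightarrow>
     (('m, 'h) tangent \<Rightarrow> real) \<Rightarrow> ereal" where
  "cotangent_norm A g p \<omega> = (SUP v\<in>{v \<in> tangent_space A p. tangent_norm g p v \<le> 1}. ereal \<bar>\<omega> v\<bar>)"

definition differential_sup_norm ::
  "('m::t2_space, 'h::{real_inner, complete_space}) chart set \<Rightarrow> ('m, 'h) metric \<Rightarrow> ('m \<Rightarrow> real) \<Rightarrow> ereal" where
  "differential_sup_norm A g \<phi> = (SUP p. cotangent_norm A g p (differential A \<phi> p))"

definition lower_semicontinuous :: "('m::topological_space \<Rightarrow> ereal) \<Rightarrow> bool" where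
  "lower_semicontinuous f \<longleftrightarrow> (\<forall>p. \<forall>a. a < f p \<longrightarrow> (\<forall>\<^sub>F q in nhds p. a < f q))"

definition attains_strong_minimum_at ::
  "('m::t2_space, 'h::{real_inner, complete_space}) chart set \<Rightarrow> ('m, 'h) metric \<Rightarrow> ('m \<Rightarrow> ereal) \<Rightarrow> 'm \<Rightarrow> bool" where
  "attains_strong_minimum_at A g h x \<longleftrightarrow>
     h x = (INF z. h z) \<and>
     (\<forall>s :: nat \<Rightarrow> 'm. (\<lambda>n. h (s n)) \<longlonglongrightarrow> h x \<longrightarrow> (\<lambda>n. riem_dist A g (s n) x) \<longlonglongrightarrow> 0)"

end

theory Submission
  imports Defs
begin

text \<open>
  The heart of the matter is that the manifold is uniformly bumpable: at every scale \<open>\<delta>\<close> and every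
  point \<open>p\<close> there is a \<open>C\<^sup>1\<close> function with value \<open>1\<close> at \<open>p\<close>, support in the \<open>\<delta>\<close>-ball around \<open>p\<close>
  and differential at most \<open>36 / \<delta>\<close>. It arises from a \<open>C\<^sup>1\<close> approximation of the distance function to
  \<open>p\<close> with differential at most \<open>9\<close>. In a chart where the metric varies by a factor at most \<open>4\<close> such an
  approximation is given by the sup-inf convolution of Lasry and Lions with respect to the metric at
  the centre; the local approximations are glued by a partition of unity subordinate to a
  \<open>\<sigma>\<close>-discrete refinement, where the \<open>n\<close>-th approximation is taken so fine that it outweighs the
  differential of the \<open>n\<close>-th weight.

  Given uniform bumps, one subtracts from \<open>f\<close> successively bumps of rapidly decreasing heights \<open>\<eta> n\<close>
  and radii \<open>\<delta> n\<close> at points where the current function is within \<open>\<eta> n / 2\<close> of its infimum. From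
  then on all almost minimizers lie in the \<open>n\<close>-th ball, so that the centres converge by completeness
  to a strong minimum of the limit.
\<close>

text \<open>Bumps taken from single charts do not suffice: their slopes depend on the chart and may
  degenerate along the manifold, whereas the heights \<open>\<eta> n\<close> and radii
  \<open>\<delta> n\<close> are fixed before any centre is known. Hence what is smoothed are
  1-Lipschitz functions of the Riemannian distance itself, and all slopes are measured by the
  metric. In infinite dimension there is neither a Lebesgue measure to mollify with nor compactness
  to provide maximizers; uniform concavity and completeness take their place. The slopes of the
  partition weights have no common bound. This does no harm because each of them is known before the
  approximation multiplied by that weight is chosen, and because refining an approximation does not
  worsen its slope. The quotients \<open>\<eta> n / \<delta> n\<close> are summable, so that the sum
  of the bumps is again \<open>C\<^sup>1\<close>, while each \<open>\<eta> n\<close> dominates the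
  sum of all later ones, so that later bumps cannot undo the localization achieved at stage
  \<open>n\<close>.\<close>

lemma form_cauchy_schwarz:
  fixes B :: "'a::real_normed_vector \<Rightarrow>\<^sub>L 'a \<Rightarrow>\<^sub>L real"
  assumes sym: "\<And>u v. B u v = B v u" and nonneg: "\<And>u. B u u \<ge> 0"
    and definite: "\<And>u. B u u = 0 \<Longrightarrow> u = 0"
  shows "\<bar>B u v\<bar> \<le> sqrt (B u u) * sqrt (B v v)"
proof (cases "B v v = 0")
  case True
  then have "v = 0" by (rule definite)
  then show ?thesis by simp
next
  case False
  then have pos: "B v v > 0" using nonneg[of v] by simp
  define t where "t = B u v / B v v"
  have "0 \<le> B (u - t *\<^sub>R v) (u - t *\<^sub>R v)" by (rule nonneg)
  also have "\<dots> = B u u - t * B u v - t * (B u v - t * B v v)"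
    by (simp add: blinfun.diff_left blinfun.diff_right blinfun.scaleR_left blinfun.scaleR_right sym[of v u] algebra_simps)
  also have "\<dots> = B u u - (B u v)\<^sup>2 / B v v"
    using pos unfolding t_def by (simp add: field_simps power2_eq_square)
  finally have "(B u v)\<^sup>2 \<le> B u u * B v v" using pos by (simp add: field_simps)
  then have "sqrt ((B u v)\<^sup>2) \<le> sqrt (B u u * B v v)" by (rule real_sqrt_le_mono)
  then show ?thesis by (simp only: real_sqrt_abs real_sqrt_mult)
qed

section \<open>Lasry--Lions regularization\<close>

text \<open>
  The penalty in the supremum has twice the weight of that in the infimum, so that it outweighs the
  lack of concavity of \<open>inf_conv\<close> and \<open>penalized x\<close> is uniformly concave: hence maximizing sequences
  are Cauchy and their limits depend Lipschitz continuously on \<open>x\<close>, which makes the supremum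
  differentiable. A general form \<open>B\<close> in place
  of the inner product is needed to get constants that do not depend on the chart.
\<close>

locale sup_inf_convolution =
  fixes B :: "'a::{real_normed_vector, complete_space} \<Rightarrow>\<^sub>L 'a \<Rightarrow>\<^sub>L real"
    and a :: real and S :: "'a set" and f :: "'a \<Rightarrow> real" and L \<kappa> :: real
  assumes sym: "\<And>u v. B u v = B v u"
    and a_pos: "a > 0" and coercive: "\<And>v. a * (norm v)\<^sup>2 \<le> B v v"
    and nonempty: "S \<noteq> {}" and bdd: "bdd_below (f ` S)"
    and L_nonneg: "L \<ge> 0"
    and lipschitz: "\<And>x z. x \<in> S \<Longrightarrow> z \<in> S \<Longrightarrow> f x - f z \<le> L * sqrt (B (x - z) (x - z))"
    and \<kappa>_pos: "\<kappa> > 0"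
begin

abbreviation Q :: "'a \<Rightarrow> real" where "Q v \<equiv> B v v"

definition inf_conv :: "'a \<Rightarrow> real" where
  "inf_conv y = (INF z\<in>S. f z + \<kappa> / 2 * Q (y - z))"

definition penalized :: "'a \<Rightarrow> 'a \<Rightarrow> real" where
  "penalized x y = inf_conv y - \<kappa> * Q (x - y)"

definition sup_inf_conv :: "'a \<Rightarrow> real" where
  "sup_inf_conv x = (SUP y. penalized x y)"

lemma Q_nonneg [simp]: "Q v \<ge> 0"
  using coercive[of v] a_pos by (smt (verit) mult_nonneg_nonneg zero_le_power2)

lemma Q_eq_0: "Q v = 0 \<Longrightarrow> v = 0"
  using coercive[of v] a_pos by (smt (verit) mult_pos_pos zero_less_norm_iff zero_less_power2 norm_eq_zero)

lemma Q_minus: "Q (- v) = Q v"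
  by (simp add: blinfun.minus_left blinfun.minus_right)

lemma Q_diff_swap: "Q (x - y) = Q (y - x)"
  using Q_minus[of "x - y"] by simp

lemma Q_diff: "Q (x - y) = Q x - 2 * B x y + Q y"
  by (simp add: blinfun.diff_left blinfun.diff_right sym[of y x])

lemma Q_add: "Q (x + y) = Q x + 2 * B x y + Q y"
  by (simp add: blinfun.add_left blinfun.add_right sym[of y x])

lemma Q_midpoint: "Q (x - (1/2) *\<^sub>R (y + y')) = (Q (x - y) + Q (x - y')) / 2 - Q (y - y') / 4"
  by (simp add: blinfun.diff_left blinfun.diff_right blinfun.add_left blinfun.add_right
      blinfun.scaleR_left blinfun.scaleR_right sym[of y x] sym[of y' x] sym[of y' y] field_simps)

lemma bdd_inf_conv: "bdd_below ((\<lambda>z. f z + \<kappa> / 2 * Q (y - z)) ` S)"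
proof -
  obtain m where m: "\<And>z. z \<in> S \<Longrightarrow> m \<le> f z" using bdd by (auto simp: bdd_below_def)
  show ?thesis
  proof (rule bdd_belowI2)
    fix z assume "z \<in> S"
    have "0 \<le> \<kappa> / 2 * Q (y - z)" using \<kappa>_pos by (simp add: mult_nonneg_nonneg)
    then show "m \<le> f z + \<kappa> / 2 * Q (y - z)" using m[OF \<open>z \<in> S\<close>] by linarith
  qed
qed

lemma inf_conv_le: "z \<in> S \<Longrightarrow> inf_conv y \<le> f z + \<kappa> / 2 * Q (y - z)"
  unfolding inf_conv_def by (rule cINF_lower[OF bdd_inf_conv])

lemma inf_conv_ge:
  assumes x: "x \<in> S"
  shows "f x - L\<^sup>2 / (2 * \<kappa>) \<le> inf_conv x"
  unfolding inf_conv_def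
proof (rule cINF_greatest[OF nonempty])
  fix z assume z: "z \<in> S"
  define n where "n = sqrt (Q (x - z))"
  have n2: "Q (x - z) = n\<^sup>2" unfolding n_def by simp
  \<comment> \<open>Completing the square: \<open>\<kappa> / 2 * n\<^sup>2 - L * n\<close> is least
    at \<open>n = L / \<kappa>\<close>, which is the origin of the error
    \<open>L\<^sup>2 / (2 * \<kappa>)\<close>.\<close>
  have "0 \<le> (L - \<kappa> * n)\<^sup>2 / (2 * \<kappa>)" using \<kappa>_pos by simp
  also have "\<dots> = L\<^sup>2 / (2 * \<kappa>) - L * n + \<kappa> / 2 * n\<^sup>2"
    using \<kappa>_pos by (simp add: field_simps power2_eq_square)
  finally show "f x - L\<^sup>2 / (2 * \<kappa>) \<le> f z + \<kappa> / 2 * Q (x - z)"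
    using lipschitz[OF x z] n2 unfolding n_def[symmetric] by simp
qed

text \<open>Each competitor \<open>f z + \<kappa> / 2 * Q (y - z)\<close> satisfies this with
  equality by the parallelogram identity, and the inequality survives the infimum. An infimum of
  such paraboloids is semiconcave whatever \<open>f\<close> is.\<close>

lemma inf_conv_midpoint:
  "inf_conv ((1/2) *\<^sub>R (y + y')) \<ge> (inf_conv y + inf_conv y') / 2 - \<kappa> / 8 * Q (y - y')"
proof -
  have "(inf_conv y + inf_conv y') / 2 - \<kappa> / 8 * Q (y - y') \<le> f z + \<kappa> / 2 * Q ((1/2) *\<^sub>R (y + y') - z)"
    if "z \<in> S" for z
    using inf_conv_le[OF that, of y] inf_conv_le[OF that, of y']
    unfolding Q_diff_swap[of _ z] Q_midpoint by (simp add: field_simps)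
  then show ?thesis
    unfolding inf_conv_def[of "(1/2) *\<^sub>R (y + y')"] by (intro cINF_greatest[OF nonempty])
qed

text \<open>At a midpoint the penalty gains \<open>\<kappa> / 4 * Q (y - y')\<close>, twice what
  \<open>inf_conv\<close> may lose.\<close>

lemma penalized_midpoint:
  "penalized x ((1/2) *\<^sub>R (y + y')) \<ge> (penalized x y + penalized x y') / 2 + \<kappa> / 8 * Q (y - y')"
  using inf_conv_midpoint[of y y'] unfolding penalized_def Q_midpoint by (simp add: field_simps)

text \<open>The ratio 2 of the two weights matches the 2 in
  \<open>Q (y - z) \<le> 2 * Q (y - x) + 2 * Q (x - z)\<close>, so that the growth of
  \<open>inf_conv\<close> is absorbed exactly.\<close>

lemma bdd_penalized: "bdd_above (range (penalized x))"
proof -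
  obtain z where z: "z \<in> S" using nonempty by blast
  show ?thesis
  proof (rule bdd_aboveI2)
    fix y
    have "2 * Q (y - x) + 2 * Q (x - z) - Q (y - z) = Q ((y - x) - (x - z))"
    proof -
      have "y - z = (y - x) + (x - z)" by simp
      then have "Q (y - z) = Q (y - x) + 2 * B (y - x) (x - z) + Q (x - z)" by (metis Q_add)
      then show ?thesis unfolding Q_diff[of "y - x" "x - z"] by simp
    qed
    then have "Q (y - z) \<le> 2 * Q (y - x) + 2 * Q (x - z)" using Q_nonneg by (smt (verit))
    then have "\<kappa> / 2 * Q (y - z) \<le> \<kappa> / 2 * (2 * Q (y - x) + 2 * Q (x - z))"
      using \<kappa>_pos by (intro mult_left_mono) auto
    then show "penalized x y \<le> f z + \<kappa> * Q (x - z)"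
      using inf_conv_le[OF z, of y] unfolding penalized_def Q_diff_swap[of x y]
      by (simp add: algebra_simps)
  qed
qed

lemma penalized_le: "penalized x y \<le> sup_inf_conv x"
  unfolding sup_inf_conv_def by (rule cSUP_upper[OF UNIV_I bdd_penalized])

lemma sup_inf_conv_le: "x \<in> S \<Longrightarrow> sup_inf_conv x \<le> f x"
  unfolding sup_inf_conv_def
proof (rule cSUP_least)
  fix y assume "x \<in> S"
  have "0 \<le> \<kappa> / 2 * Q (x - y)" using \<kappa>_pos by simp
  then show "penalized x y \<le> f x"
    using inf_conv_le[OF \<open>x \<in> S\<close>, of y] unfolding penalized_def Q_diff_swap[of y x] by linarith
qed simp

lemma sup_inf_conv_ge: "x \<in> S \<Longrightarrow> f x - L\<^sup>2 / (2 * \<kappa>) \<le> sup_inf_conv x"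
  using inf_conv_ge[of x] penalized_le[of x x] unfolding penalized_def by simp

text \<open>The midpoint of two almost maximizers cannot exceed the supremum, so
  \<open>penalized_midpoint\<close> forces them together, and completeness provides the limit.
  Limits and sequences are chosen for all points at once.\<close>

lemma almost_maximizers:
  "\<exists>Y y. \<forall>x. (\<forall>n. penalized x (y x n) \<ge> sup_inf_conv x - inverse (real (Suc n))) \<and> y x \<longlonglongrightarrow> Y x"
proof -
  have "\<exists>y. penalized x y \<ge> sup_inf_conv x - inverse (real (Suc n))" for x and n :: nat
  proof (rule ccontr)
    assume "\<not> ?thesis"
    then have "sup_inf_conv x \<le> sup_inf_conv x - inverse (real (Suc n))"
      by (subst sup_inf_conv_def, intro cSUP_least) (auto simp: not_le less_imp_le)
    then show False by simp
  qed
  then obtain y where y: "\<And>x n. penalized x (y x n) \<ge> sup_inf_conv x - inverse (real (Suc n))"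
    by metis
  have "Cauchy (y x)" for x
  proof (rule metric_CauchyI)
    fix e :: real assume e: "e > 0"
    define d where "d = \<kappa> / 8 * (a * e\<^sup>2)"
    have "d > 0" using e a_pos \<kappa>_pos by (simp add: d_def)
    then obtain N where N: "inverse (real (Suc N)) < d" using reals_Archimedean by blast
    show "\<exists>M. \<forall>m\<ge>M. \<forall>n\<ge>M. dist (y x m) (y x n) < e"
    proof (intro exI[of _ N] allI impI)
      fix m n assume mn: "N \<le> m" "N \<le> n"
      have "inverse (real (Suc m)) < d" "inverse (real (Suc n)) < d"
        using mn N by (smt (verit) inverse_of_nat_le of_nat_mono Suc_le_mono nat.distinct(1) le_imp_inverse_le of_nat_0_less_iff zero_less_Suc)+
      then have "\<kappa> / 8 * Q (y x m - y x n) < d"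
        using y[of x m] y[of x n] penalized_midpoint[of x "y x m" "y x n"]
          penalized_le[of x "(1/2) *\<^sub>R (y x m + y x n)"] by argo
      then have "Q (y x m - y x n) < a * e\<^sup>2" using \<kappa>_pos unfolding d_def by simp
      then have "a * (norm (y x m - y x n))\<^sup>2 < a * e\<^sup>2" using coercive[of "y x m - y x n"] by linarith
      then have "norm (y x m - y x n) < e" using a_pos e by (simp add: power2_less_imp_less)
      then show "dist (y x m) (y x n) < e" by (simp add: dist_norm)
    qed
  qed
  then have "\<forall>x. \<exists>l. y x \<longlonglongrightarrow> l" using Cauchy_convergent convergent_def by blast
  then show ?thesis using y by metis
qed

text \<open>The function \<open>penalized x\<close> is controlled along \<open>max_seq x\<close>,
  not at the limit. Below, its values are therefore eliminated first, and only inequalities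
  continuous in the almost maximizers are passed to the limit.\<close>

definition maximizer :: "'a \<Rightarrow> 'a" where
  "maximizer = (SOME Y. \<exists>y. \<forall>x. (\<forall>n. penalized x (y x n) \<ge> sup_inf_conv x - inverse (real (Suc n)))
     \<and> y x \<longlonglongrightarrow> Y x)"

definition max_seq :: "'a \<Rightarrow> nat \<Rightarrow> 'a" where
  "max_seq = (SOME y. \<forall>x. (\<forall>n. penalized x (y x n) \<ge> sup_inf_conv x - inverse (real (Suc n)))
     \<and> y x \<longlonglongrightarrow> maximizer x)"

lemma max_seq:
  shows "penalized x (max_seq x n) \<ge> sup_inf_conv x - inverse (real (Suc n))"
    and max_seq_tendsto: "max_seq x \<longlonglongrightarrow> maximizer x"
proof -
  have "\<exists>y. \<forall>x. (\<forall>n. penalized x (y x n) \<ge> sup_inf_conv x - inverse (real (Suc n)))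
     \<and> y x \<longlonglongrightarrow> maximizer x"
    unfolding maximizer_def by (rule someI_ex[OF almost_maximizers])
  from someI_ex[OF this] show "penalized x (max_seq x n) \<ge> sup_inf_conv x - inverse (real (Suc n))"
    "max_seq x \<longlonglongrightarrow> maximizer x"
    unfolding max_seq_def[symmetric] by blast+
qed

lemmas tendsto_form = bounded_bilinear.tendsto[OF bounded_bilinear_blinfun_apply]

lemma tendsto_minus_inverse_Suc: "(\<lambda>n. c - k * inverse (real (Suc n))) \<longlonglongrightarrow> c" for c k :: real
  using tendsto_diff[OF tendsto_const tendsto_mult[OF tendsto_const LIMSEQ_inverse_real_of_nat], of c k]
  by simp

lemma maximizer_lipschitz: "norm (maximizer x - maximizer x') \<le> 4 * norm B / a * norm (x - x')"
proof -
  define y where "y = max_seq x"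
  define y' where "y' = max_seq x'"
  have *: "- 4 / \<kappa> * 2 * inverse (real (Suc n)) \<le> 4 * B (x' - x) (y' n - y n) - Q (y' n - y n)" for n
  proof -
    define m where "m = (1/2) *\<^sub>R (y n + y' n)"
    \<comment> \<open>Exchanging the two almost maximizers changes the total penalty by a bilinear
      term only, and leaves the contribution of \<open>inf_conv\<close> unchanged. Compared with the
      midpoint gain at \<open>x\<close> and at \<open>x'\<close>, this bounds
      \<open>Q (y' n - y n)\<close> by the bilinear term.\<close>
    have "Q (x' - y' n) - Q (x - y' n) + Q (x - y n) - Q (x' - y n) = - 2 * B (x' - x) (y' n - y n)"
      unfolding Q_diff by (simp add: blinfun.diff_left blinfun.diff_right)
    then have "\<kappa> * (Q (x' - y' n) - Q (x - y' n) + Q (x - y n) - Q (x' - y n))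
        = - 2 * \<kappa> * B (x' - x) (y' n - y n)" by simp
    moreover have "penalized x (y' n) + penalized x' (y n) = penalized x' (y' n) + penalized x (y n)
      + \<kappa> * (Q (x' - y' n) - Q (x - y' n) + Q (x - y n) - Q (x' - y n))"
      unfolding penalized_def by (simp add: algebra_simps)
    ultimately have "\<kappa> / 4 * Q (y' n - y n) - \<kappa> * B (x' - x) (y' n - y n)
        \<le> 2 * inverse (real (Suc n))"
      using penalized_midpoint[of x "y n" "y' n"] penalized_midpoint[of x' "y n" "y' n"]
        penalized_le[of x m] penalized_le[of x' m] max_seq(1)[of x n] max_seq(1)[of x' n]
      unfolding m_def[symmetric] y_def[symmetric] y'_def[symmetric] Q_diff_swap[of "y n" "y' n"]
      by argo
    then have "4 / \<kappa> * (\<kappa> / 4 * Q (y' n - y n) - \<kappa> * B (x' - x) (y' n - y n))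
       \<le> 4 / \<kappa> * (2 * inverse (real (Suc n)))"
      using \<kappa>_pos by (intro mult_left_mono) auto
    then show ?thesis using \<kappa>_pos by (simp add: right_diff_distrib)
  qed
  define \<Delta> where "\<Delta> = maximizer x' - maximizer x"
  have lim: "(\<lambda>n. y' n - y n) \<longlonglongrightarrow> \<Delta>"
    unfolding y_def y'_def \<Delta>_def by (intro tendsto_diff max_seq_tendsto)
  have "0 \<le> 4 * B (x' - x) \<Delta> - Q \<Delta>"
  proof (rule LIMSEQ_le)
    show "(\<lambda>n. 4 * B (x' - x) (y' n - y n) - Q (y' n - y n)) \<longlonglongrightarrow> 4 * B (x' - x) \<Delta> - Q \<Delta>"
      by (intro tendsto_intros tendsto_form lim)
    show "(\<lambda>n. 0 - 4 / \<kappa> * 2 * inverse (real (Suc n))) \<longlonglongrightarrow> 0"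
      by (rule tendsto_minus_inverse_Suc)
    show "\<exists>N. \<forall>n\<ge>N. 0 - 4 / \<kappa> * 2 * inverse (real (Suc n)) \<le> 4 * B (x' - x) (y' n - y n) - Q (y' n - y n)"
      using * by (intro exI allI impI) (simp add: algebra_simps)
  qed
  then have "a * (norm \<Delta>)\<^sup>2 \<le> 4 * B (x' - x) \<Delta>" using coercive[of \<Delta>] by linarith
  also have "B (x' - x) \<Delta> \<le> norm B * norm (x' - x) * norm \<Delta>"
  proof -
    have "B (x' - x) \<Delta> \<le> norm (B (x' - x)) * norm \<Delta>"
      using norm_blinfun[of "B (x' - x)" \<Delta>] by simp
    also have "\<dots> \<le> norm B * norm (x' - x) * norm \<Delta>"
      by (intro mult_right_mono norm_blinfun) simp
    finally show ?thesis .
  qed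
  finally have "a * norm \<Delta> * norm \<Delta> \<le> 4 * norm B * norm (x' - x) * norm \<Delta>"
    by (simp add: power2_eq_square algebra_simps)
  then have "a * norm \<Delta> \<le> 4 * norm B * norm (x' - x)"
    by (cases "\<Delta> = 0") auto
  then show ?thesis using a_pos unfolding \<Delta>_def
    by (simp add: field_simps norm_minus_commute)
qed

text \<open>Envelope formula: the derivative of \<open>penalized x y\<close> in \<open>x\<close> for
  fixed \<open>y\<close>, taken at \<open>y = maximizer x\<close>.\<close>

definition gradient :: "'a \<Rightarrow> 'a \<Rightarrow>\<^sub>L real" where
  "gradient x = (2 * \<kappa>) *\<^sub>R B (maximizer x - x)"

text \<open>An almost maximizer for \<open>x\<close> is a competitor at \<open>x + h\<close>, where
  its value differs by an explicit quadratic; the motion of the maximizer does not enter.\<close>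

lemma gradient_lower: "sup_inf_conv (x + h) - sup_inf_conv x - gradient x h \<ge> - \<kappa> * Q h"
proof -
  define y where "y = max_seq x"
  have "sup_inf_conv x - 1 * inverse (real (Suc n)) \<le> sup_inf_conv (x + h) + \<kappa> * (2 * B h (x - y n) + Q h)" for n
  proof -
    have "x + h - y n = h + (x - y n)" by simp
    then have "Q (x + h - y n) = Q h + 2 * B h (x - y n) + Q (x - y n)" by (metis Q_add)
    then have "penalized (x + h) (y n) = penalized x (y n) - \<kappa> * (2 * B h (x - y n) + Q h)"
      unfolding penalized_def by (simp add: algebra_simps)
    then show ?thesis using max_seq(1)[of x n] penalized_le[of "x + h" "y n"]
      unfolding y_def[symmetric] by simp
  qed
  then have "sup_inf_conv x \<le> sup_inf_conv (x + h) + \<kappa> * (2 * B h (x - maximizer x) + Q h)"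
    by (intro LIMSEQ_le[OF tendsto_minus_inverse_Suc[of _ 1],
          where Y = "\<lambda>n. sup_inf_conv (x + h) + \<kappa> * (2 * B h (x - y n) + Q h)"])
      (auto intro!: tendsto_intros tendsto_form max_seq_tendsto simp: y_def)
  then show ?thesis
    by (simp add: gradient_def blinfun.scaleR_left blinfun.diff_left blinfun.diff_right
        blinfun.add_left sym[of "maximizer x" h] sym[of x h] algebra_simps)
qed

text \<open>The upper estimate is \<open>gradient_lower\<close> read from \<open>x + h\<close> with
  increment \<open>- h\<close>, which brings in the gradient at \<open>x + h\<close> in place of
  that at \<open>x\<close>. By \<open>maximizer_lipschitz\<close> the difference is quadratic in
  \<open>h\<close>.\<close>

lemma has_derivative_sup_inf_conv: "(sup_inf_conv has_derivative gradient x) (at x)"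
proof -
  define C where "C = \<kappa> * norm B + 2 * \<kappa> * norm B * (4 * norm B / a)"
  have Qle: "Q h \<le> norm B * (norm h)\<^sup>2" for h
  proof -
    have "Q h \<le> norm (B h) * norm h" using norm_blinfun[of "B h" h] by simp
    also have "\<dots> \<le> (norm B * norm h) * norm h" by (intro mult_right_mono norm_blinfun) simp
    finally show ?thesis by (simp add: power2_eq_square algebra_simps)
  qed
  have bound: "\<bar>sup_inf_conv (x + h) - sup_inf_conv x - gradient x h\<bar> \<le> C * (norm h)\<^sup>2" for h
  proof -
    have 1: "\<kappa> * Q h \<le> \<kappa> * (norm B * (norm h)\<^sup>2)" using \<kappa>_pos Qle by simp
    have 3: "0 \<le> \<kappa> * Q h" using \<kappa>_pos by simp
    have "B h (maximizer (x + h) - maximizer x) \<le> norm (B h) * norm (maximizer (x + h) - maximizer x)"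
      using norm_blinfun[of "B h"] by (smt (verit) real_norm_def)
    also have "\<dots> \<le> (norm B * norm h) * (4 * norm B / a * norm h)"
      using maximizer_lipschitz[of "x + h" x] by (intro mult_mono norm_blinfun) simp_all
    finally have "2 * \<kappa> * B h (maximizer (x + h) - maximizer x)
        \<le> 2 * \<kappa> * (norm B * norm h * (4 * norm B / a * norm h))"
      using \<kappa>_pos by (intro mult_left_mono) simp_all
    also have "\<dots> = 2 * \<kappa> * norm B * (4 * norm B / a) * (norm h)\<^sup>2"
      by (simp add: power2_eq_square)
    finally have 2: "2 * \<kappa> * B h (maximizer (x + h) - maximizer x)
        \<le> 2 * \<kappa> * norm B * (4 * norm B / a) * (norm h)\<^sup>2" .
    have "sup_inf_conv x - sup_inf_conv (x + h) - gradient (x + h) (- h) \<ge> - \<kappa> * Q h"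
      using gradient_lower[where x = "x + h" and h = "- h"] by (simp add: Q_minus)
    moreover have "- gradient (x + h) (- h) - gradient x h = 2 * \<kappa> * B h (maximizer (x + h) - maximizer x) - 2 * \<kappa> * Q h"
    proof -
      have "B (maximizer (x + h) - (x + h)) h = B h (maximizer (x + h)) - (B h x + Q h)"
        "B (maximizer x - x) h = B h (maximizer x) - B h x"
        by (simp_all only: blinfun.diff_left blinfun.diff_right blinfun.add_left blinfun.add_right sym[of "maximizer (x + h)" h]
            sym[of "maximizer x" h] sym[of x h])
      then show ?thesis
        by (simp add: gradient_def blinfun.scaleR_left blinfun.diff_right blinfun.minus_right right_diff_distrib distrib_left)
    qed
    ultimately have "sup_inf_conv (x + h) - sup_inf_conv x - gradient x h
       \<le> 2 * \<kappa> * B h (maximizer (x + h) - maximizer x)" using 3 by linarith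
    moreover have "0 \<le> \<kappa> * norm B * (norm h)\<^sup>2" "0 \<le> 2 * \<kappa> * norm B * (4 * norm B / a) * (norm h)\<^sup>2"
      using \<kappa>_pos a_pos by simp_all
    moreover have "C * (norm h)\<^sup>2 = \<kappa> * norm B * (norm h)\<^sup>2 + 2 * \<kappa> * norm B * (4 * norm B / a) * (norm h)\<^sup>2"
      unfolding C_def by (simp add: algebra_simps)
    ultimately show ?thesis using gradient_lower[where x = x and h = h] 1 2 by linarith
  qed
  show ?thesis
  proof (rule has_derivativeI)
    show "((\<lambda>y. (sup_inf_conv y - sup_inf_conv x - gradient x (y - x)) /\<^sub>R norm (y - x)) \<longlongrightarrow> 0) (at x)"
    proof (rule Lim_null_comparison[where g = "\<lambda>y. C * norm (y - x)"])
      show "\<forall>\<^sub>F y in at x. norm ((sup_inf_conv y - sup_inf_conv x - gradient x (y - x)) /\<^sub>R norm (y - x)) \<le> C * norm (y - x)"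
        unfolding eventually_at
      proof (intro exI[of _ 1] conjI ballI impI)
        fix y assume "y \<noteq> x \<and> dist y x < 1"
        then have "norm (y - x) > 0" by simp
        then show "norm ((sup_inf_conv y - sup_inf_conv x - gradient x (y - x)) /\<^sub>R norm (y - x)) \<le> C * norm (y - x)"
          using bound[of "y - x"] by (simp add: field_simps power2_eq_square)
      qed simp
      show "((\<lambda>y. C * norm (y - x)) \<longlongrightarrow> 0) (at x)"
        by (auto intro!: tendsto_eq_intros)
    qed
  qed (rule blinfun.bounded_linear_right)
qed

lemma continuous_on_gradient: "continuous_on UNIV gradient"
proof -
  have "(4 * norm B / a)-lipschitz_on UNIV maximizer"
    using maximizer_lipschitz a_pos by (intro lipschitz_onI) (auto simp: dist_norm)
  then have "continuous_on UNIV maximizer" by (rule lipschitz_on_continuous_on)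
  then show ?thesis unfolding gradient_def[abs_def] by (intro continuous_intros)
qed

text \<open>The part of the penalty that \<open>inf_conv\<close> cannot recover is at most the error
  \<open>L\<^sup>2 / (2 * \<kappa>)\<close>, so the maximizer is within \<open>L / \<kappa>\<close>
  of \<open>x\<close>. The factor \<open>2 * \<kappa>\<close> of the gradient then cancels
  \<open>\<kappa>\<close>.\<close>

lemma gradient_le:
  assumes x: "x \<in> S"
  shows "\<bar>gradient x h\<bar> \<le> 2 * L * sqrt (Q h)"
proof -
  define y where "y = max_seq x"
  have "\<kappa> / 2 * Q (x - y n) \<le> L\<^sup>2 / (2 * \<kappa>) + inverse (real (Suc n))" for n
    using max_seq(1)[of x n] inf_conv_le[OF x, of "y n"] sup_inf_conv_ge[OF x]
    unfolding y_def penalized_def Q_diff_swap[of "max_seq x n" x] by linarith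
  then have *: "\<kappa> / 2 * Q (x - y n) \<le> L\<^sup>2 / (2 * \<kappa>) - (-1) * inverse (real (Suc n))" for n by simp
  have "\<kappa> / 2 * Q (x - maximizer x) \<le> L\<^sup>2 / (2 * \<kappa>)"
    by (rule LIMSEQ_le[OF _ tendsto_minus_inverse_Suc[of _ "-1"],
          where X = "\<lambda>n. \<kappa> / 2 * Q (x - y n)"])
      (use * in \<open>auto intro!: tendsto_intros tendsto_form max_seq_tendsto simp: y_def\<close>)
  then have "Q (maximizer x - x) \<le> (L / \<kappa>)\<^sup>2"
    using \<kappa>_pos unfolding Q_diff_swap[of x] by (simp add: field_simps power2_eq_square)
  then have "sqrt (Q (maximizer x - x)) \<le> L / \<kappa>"
    using L_nonneg \<kappa>_pos by (simp add: real_le_lsqrt)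
  then have "\<bar>B (maximizer x - x) h\<bar> \<le> L / \<kappa> * sqrt (Q h)"
    using form_cauchy_schwarz[of B "maximizer x - x" h] sym Q_nonneg Q_eq_0
    by (meson order_trans mult_right_mono real_sqrt_ge_zero)
  then have "2 * \<kappa> * \<bar>B (maximizer x - x) h\<bar> \<le> 2 * \<kappa> * (L / \<kappa> * sqrt (Q h))"
    using \<kappa>_pos by (intro mult_left_mono) auto
  then show ?thesis using \<kappa>_pos by (simp add: gradient_def blinfun.scaleR_left abs_mult)
qed

end

text \<open>A large \<open>\<kappa>\<close> costs nothing in the derivative: approximations of every
  accuracy \<open>e\<close> share the bound \<open>2 * L\<close>, and the later gluing rests on
  this.\<close>

lemma lipschitz_C1_approximation:
  fixes B :: "'a::{real_normed_vector, complete_space} \<Rightarrow>\<^sub>L 'a \<Rightarrow>\<^sub>L real"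
  assumes "\<And>u v. B u v = B v u" "a > 0" "\<And>v. a * (norm v)\<^sup>2 \<le> B v v"
    and "bdd_below (f ` S)" "L > 0" "e > 0"
    and "\<And>x z. x \<in> S \<Longrightarrow> z \<in> S \<Longrightarrow> f x - f z \<le> L * sqrt (B (x - z) (x - z))"
  shows "\<exists>u D. (\<forall>x. (u has_derivative blinfun_apply (D x)) (at x)) \<and> continuous_on UNIV D \<and>
           (\<forall>x\<in>S. \<bar>u x - f x\<bar> \<le> e \<and> (\<forall>h. \<bar>blinfun_apply (D x) h\<bar> \<le> 2 * L * sqrt (B h h)))"
proof (cases "S = {}")
  case True
  then show ?thesis
    by (intro exI[of _ "\<lambda>_. 0"] exI[of _ "\<lambda>_. 0"]) (auto intro!: derivative_eq_intros)
next
  case False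
  define \<kappa> where "\<kappa> = L\<^sup>2 / (2 * e)"
  have \<kappa>: "\<kappa> > 0" using assms by (simp add: \<kappa>_def)
  have e: "L\<^sup>2 / (2 * \<kappa>) = e" using assms by (simp add: \<kappa>_def)
  interpret sup_inf_convolution B a S f L \<kappa>
    using assms False \<kappa> by unfold_locales auto
  show ?thesis
    using has_derivative_sup_inf_conv continuous_on_gradient gradient_le sup_inf_conv_le
      sup_inf_conv_ge unfolding e
    by (intro exI[of _ sup_inf_conv] exI[of _ gradient]) (force simp: abs_le_iff)
qed

section \<open>Calculus in charts\<close>

text \<open>The first derivative is continuous because it is itself differentiable in the operator
  norm, with derivative \<open>D 2\<close>.\<close>

lemma smooth_map_on_imp_C1:
  fixes f :: "'a::real_normed_vector \<Rightarrow> 'b::real_normed_vector"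
  assumes "smooth_map_on S f" "open S"
  obtains D where "\<And>x. x \<in> S \<Longrightarrow> (f has_derivative blinfun_apply (D x)) (at x)" "continuous_on S D"
proof -
  obtain D where D0: "\<And>x. x \<in> S \<Longrightarrow> D 0 x [] = f x"
    and ml: "\<And>k x. x \<in> S \<Longrightarrow> bounded_multilinear k (D k x)"
    and der: "\<And>k x e. x \<in> S \<Longrightarrow> e > 0 \<Longrightarrow> \<exists>d>0. \<forall>y\<in>S. norm (y - x) < d \<longrightarrow>
           (\<forall>vs. length vs = k \<longrightarrow>
              norm (D k y vs - D k x vs - D (Suc k) x ((y - x) # vs))
                \<le> e * norm (y - x) * prod_list (map norm vs))"
  proof -
    from assms(1) obtain D where *: "\<forall>x\<in>S. D 0 x [] = f x"
      "\<forall>k. \<forall>x\<in>S. bounded_multilinear k (D k x)"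
      "\<forall>k. \<forall>x\<in>S. \<forall>e>0. \<exists>d>0. \<forall>y\<in>S. norm (y - x) < d \<longrightarrow>
           (\<forall>vs. length vs = k \<longrightarrow>
              norm (D k y vs - D k x vs - D (Suc k) x ((y - x) # vs))
                \<le> e * norm (y - x) * prod_list (map norm vs))"
      unfolding smooth_map_on_def by (elim exE conjE) (rule that)
    show ?thesis by (rule that[of D]) (use * in simp_all)
  qed
  have bl: "bounded_linear (\<lambda>v. D 1 x [v])" if "x \<in> S" for x
  proof -
    note x = that
    have lin: "linear (\<lambda>v. D 1 x [v])"
      using ml[OF that, of 1] unfolding bounded_multilinear_def
      by (metis (no_types, lifting) ext One_nat_def length_Cons list.size(3) list_update_code(2) zero_less_one)
    obtain K where "\<And>vs. length vs = 1 \<Longrightarrow> norm (D 1 x vs) \<le> K * prod_list (map norm vs)"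
      using ml[OF x, of 1] unfolding bounded_multilinear_def by blast
    from this[of "[_]"] have "norm (D 1 x [v]) \<le> norm v * K" for v by (simp add: mult.commute)
    with lin show ?thesis unfolding bounded_linear_def bounded_linear_axioms_def by blast
  qed
  define D1 where "D1 x = Blinfun (\<lambda>v. D 1 x [v])" for x
  have D1: "D1 x v = D 1 x [v]" if "x \<in> S" for x v
    using bl[OF that] by (simp add: D1_def bounded_linear_Blinfun_apply)
  show ?thesis
  proof (rule that[of D1])
    fix x assume x: "x \<in> S"
    have "(f has_derivative D1 x) (at x within S)"
      unfolding has_derivative_within_alt
    proof (intro conjI allI impI)
      fix e :: real assume "e > 0"
      from der[OF x this, of 0] show "\<exists>d>0. \<forall>y\<in>S. norm (y - x) < d \<longrightarrow> norm (f y - f x - D1 x (y - x)) \<le> e * norm (y - x)"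
        using x by (simp add: D0 D1)
    qed (rule blinfun.bounded_linear_right)
    then show "(f has_derivative D1 x) (at x)"
      using at_within_open[OF x assms(2)] by simp
  next
    show "continuous_on S D1"
      unfolding continuous_on_iff
    proof (intro ballI allI impI)
      fix x and e :: real assume x: "x \<in> S" and e: "e > 0"
      obtain K where K: "\<And>vs. length vs = 2 \<Longrightarrow> norm (D 2 x vs) \<le> K * prod_list (map norm vs)"
        using ml[OF x, of 2] unfolding bounded_multilinear_def by blast
      obtain d where "d > 0" and d: "\<forall>y\<in>S. norm (y - x) < d \<longrightarrow> (\<forall>vs. length vs = 1 \<longrightarrow>
              norm (D 1 y vs - D 1 x vs - D (Suc 1) x ((y - x) # vs))
                \<le> 1 * norm (y - x) * prod_list (map norm vs))"
        using der[OF x zero_less_one, of 1] by blast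
      have d: "d > 0" "\<And>y v. y \<in> S \<Longrightarrow> norm (y - x) < d \<Longrightarrow>
          norm (D 1 y [v] - D 1 x [v] - D 2 x [y - x, v]) \<le> 1 * norm (y - x) * norm v"
        using \<open>d > 0\<close> d[rule_format, of _ "[_]"] by (simp_all add: numeral_2_eq_2)
      \<comment> \<open>With accuracy 1 the derivative varies at rate at most
        \<open>\<bar>K\<bar> + 1\<close>. The denominator exceeds this by 1 to make the final
        estimate strict; the absolute value covers a negative \<open>K\<close>.\<close>
      define d' where "d' = min d (e / (\<bar>K\<bar> + 2))"
      have "d' > 0" using d e by (simp add: d'_def)
      moreover have "dist (D1 y) (D1 x) < e" if y: "y \<in> S" "dist y x < d'" for y
      proof -
        have yx: "norm (y - x) < d" "norm (y - x) < e / (\<bar>K\<bar> + 2)" using y by (auto simp: d'_def dist_norm)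
        have "norm (D1 y - D1 x) \<le> (\<bar>K\<bar> + 1) * norm (y - x)"
        proof (rule norm_blinfun_bound)
          fix v
          have "norm (D 2 x [y - x, v]) \<le> K * (norm (y - x) * norm v)" using K[of "[y - x, v]"] by simp
          also have "\<dots> \<le> \<bar>K\<bar> * (norm (y - x) * norm v)" by (intro mult_right_mono) auto
          finally have "norm (D 2 x [y - x, v]) \<le> \<bar>K\<bar> * (norm (y - x) * norm v)" .
          moreover have "norm (D 1 y [v] - D 1 x [v]) \<le> norm (D 2 x [y - x, v]) + norm (y - x) * norm v"
            using d(2)[OF y(1) yx(1), of v] norm_triangle_ineq2[of "D 1 y [v] - D 1 x [v]" "D 2 x [y - x, v]"] by simp
          ultimately show "norm ((D1 y - D1 x) v) \<le> (\<bar>K\<bar> + 1) * norm (y - x) * norm v"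
            by (simp add: blinfun.diff_left D1 x y algebra_simps)
        qed simp
        also have "\<dots> \<le> (\<bar>K\<bar> + 1) * (e / (\<bar>K\<bar> + 2))" using yx by (intro mult_left_mono) auto
        also have "\<dots> < e" using e by (simp add: field_simps)
        finally show ?thesis by (simp add: dist_norm)
      qed
      ultimately show "\<exists>d>0. \<forall>x'\<in>S. dist x' x < d \<longrightarrow> dist (D1 x') (D1 x) < e" by blast
    qed
  qed
qed

locale riemannian =
  fixes A :: "('m::t2_space, 'h::{real_inner, complete_space}) chart set"
    and g :: "('m, 'h) metric"
  assumes manifold: "riemannian_manifold A g"
begin

abbreviation charts :: "'m \<Rightarrow> ('m, 'h) chart set" where "charts \<equiv> charts_at A"
abbreviation T :: "'m \<Rightarrow> ('m, 'h) tangent set" where "T \<equiv> tangent_space A"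
abbreviation tnorm :: "'m \<Rightarrow> ('m, 'h) tangent \<Rightarrow> real" where "tnorm \<equiv> tangent_norm g"
abbreviation image_of :: "('m, 'h) chart \<Rightarrow> 'h set" where "image_of c \<equiv> snd c ` fst c"

lemma atlas: "smooth_atlas A" and metric: "riemannian_metric A g"
  using manifold by (auto simp: riemannian_manifold_def)

lemma charts_iff: "c \<in> charts p \<longleftrightarrow> c \<in> A \<and> p \<in> fst c"
  by (simp add: charts_at_def)

lemma ex_chart: "\<exists>c. c \<in> charts p"
  using atlas unfolding smooth_atlas_def charts_at_def by blast

lemma open_chart: "c \<in> A \<Longrightarrow> open (fst c)" "c \<in> A \<Longrightarrow> open (image_of c)"
  and homeo: "c \<in> A \<Longrightarrow> homeomorphism (fst c) (image_of c) (snd c) (chart_inv c)"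
  using atlas unfolding smooth_atlas_def by blast+

lemma chart_inv_chart [simp]: "c \<in> A \<Longrightarrow> p \<in> fst c \<Longrightarrow> chart_inv c (snd c p) = p"
  using homeo by (rule homeomorphism_apply1)

lemma chart_chart_inv [simp]: "c \<in> A \<Longrightarrow> y \<in> image_of c \<Longrightarrow> snd c (chart_inv c y) = y"
  using homeo by (rule homeomorphism_apply2)

lemma chart_inv_in: "c \<in> A \<Longrightarrow> y \<in> image_of c \<Longrightarrow> chart_inv c y \<in> fst c"
  using homeo[of c] by (auto simp: homeomorphism_def)

lemma continuous_on_chart: "c \<in> A \<Longrightarrow> continuous_on (fst c) (snd c)"
  and continuous_on_chart_inv: "c \<in> A \<Longrightarrow> continuous_on (image_of c) (chart_inv c)"
  using homeo by (auto simp: homeomorphism_def)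

lemma open_chart_image:
  assumes "c \<in> A" "open W" "W \<subseteq> fst c" shows "open (snd c ` W)"
proof -
  have "snd c ` W = image_of c \<inter> chart_inv c -` W"
    using assms by (force simp: image_iff)
  then show ?thesis
    using continuous_open_preimage[OF continuous_on_chart_inv[OF assms(1)] open_chart(2)[OF assms(1)] assms(2)]
    by simp
qed

lemma open_chart_vimage:
  assumes "c \<in> A" "open V" shows "open (fst c \<inter> snd c -` V)"
  using continuous_open_preimage[OF continuous_on_chart open_chart(1)] assms by blast

lemma transition_C1:
  assumes "c \<in> A" "c' \<in> A"
  obtains D where "\<And>x. x \<in> snd c ` (fst c \<inter> fst c') \<Longrightarrow>
      ((snd c' \<circ> chart_inv c) has_derivative blinfun_apply (D x)) (at x)"
    "continuous_on (snd c ` (fst c \<inter> fst c')) D"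
proof (rule smooth_map_on_imp_C1)
  show "smooth_map_on (snd c ` (fst c \<inter> fst c')) (snd c' \<circ> chart_inv c)"
    using atlas assms unfolding smooth_atlas_def by blast
  show "open (snd c ` (fst c \<inter> fst c'))"
    using assms by (intro open_chart_image open_Int open_chart) auto
qed blast

lemma transition_has_derivative:
  assumes "c \<in> charts p" "c' \<in> charts p"
  shows "((snd c' \<circ> chart_inv c) has_derivative
      frechet_derivative (snd c' \<circ> chart_inv c) (at (snd c p))) (at (snd c p))"
proof -
  have A: "c \<in> A" "p \<in> fst c" "c' \<in> A" "p \<in> fst c'" using assms by (auto simp: charts_iff)
  obtain D where D: "\<And>x. x \<in> snd c ` (fst c \<inter> fst c') \<Longrightarrow>
      ((snd c' \<circ> chart_inv c) has_derivative blinfun_apply (D x)) (at x)"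
    by (rule transition_C1[OF A(1,3)]) blast
  have "((snd c' \<circ> chart_inv c) has_derivative blinfun_apply (D (snd c p))) (at (snd c p))"
    by (rule D) (use A in blast)
  then show ?thesis using frechet_derivative_works differentiable_def by blast
qed

lemma tangent_transition:
  "v \<in> T p \<Longrightarrow> c \<in> charts p \<Longrightarrow> c' \<in> charts p \<Longrightarrow>
    v c' = frechet_derivative (snd c' \<circ> chart_inv c) (at (snd c p)) (v c)"
  unfolding tangent_space_def by blast

text \<open>Transporting \<open>h\<close> to the other charts by the derivatives of the transition
  maps is consistent by the chain rule. That every \<open>h\<close> is a coordinate of a tangent
  vector lets properties of the metric on tangent vectors pass to its coordinate form.\<close>

lemma ex_tangent:
  assumes c: "c \<in> charts p"
  obtains v where "v \<in> T p" "v c = h"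
proof -
  define v where "v c' = (if c' \<in> charts p
    then frechet_derivative (snd c' \<circ> chart_inv c) (at (snd c p)) h else 0)" for c'
  have cA: "c \<in> A" "p \<in> fst c" using c by (auto simp: charts_iff)
  have "v \<in> T p"
    unfolding tangent_space_def
  proof (safe, goal_cases)
    case (1 c1 c1' c2 c2')
    define d e where "d = (c1, c1')" and "e = (c2, c2')"
    have de: "d \<in> charts p" "e \<in> charts p" using 1 by (auto simp: d_def e_def)
    have dA: "d \<in> A" "p \<in> fst d" using de by (auto simp: charts_iff)
    have "((snd e \<circ> chart_inv d) \<circ> (snd d \<circ> chart_inv c) has_derivative
        frechet_derivative (snd e \<circ> chart_inv d) (at (snd d p)) \<circ>
        frechet_derivative (snd d \<circ> chart_inv c) (at (snd c p))) (at (snd c p))"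
      using transition_has_derivative[OF c de(1)] transition_has_derivative[OF de] cA
      by (intro diff_chain_at) simp_all
    then have "((snd e \<circ> chart_inv c) has_derivative
        frechet_derivative (snd e \<circ> chart_inv d) (at (snd d p)) \<circ>
        frechet_derivative (snd d \<circ> chart_inv c) (at (snd c p))) (at (snd c p))"
    proof (rule has_derivative_transform_within_open)
      show "open (snd c ` (fst c \<inter> fst d))"
        using cA dA by (intro open_chart_image open_Int open_chart) auto
      show "snd c p \<in> snd c ` (fst c \<inter> fst d)" using cA dA by blast
    qed (use cA dA in auto)
    then have "frechet_derivative (snd e \<circ> chart_inv c) (at (snd c p)) =
        frechet_derivative (snd e \<circ> chart_inv d) (at (snd d p)) \<circ>
        frechet_derivative (snd d \<circ> chart_inv c) (at (snd c p))"
      by (rule frechet_derivative_at[symmetric])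
    then have "v e = frechet_derivative (snd e \<circ> chart_inv d) (at (snd d p)) (v d)"
      using de by (simp add: v_def)
    then show ?case by (simp add: d_def e_def)
  qed (auto simp: v_def)
  moreover have "v c = h"
  proof -
    have "((\<lambda>x. x) has_derivative (\<lambda>x. x)) (at (snd c p))" by (rule has_derivative_ident)
    then have "((snd c \<circ> chart_inv c) has_derivative (\<lambda>x. x)) (at (snd c p))"
      by (rule has_derivative_transform_within_open[OF _ open_chart(2)[OF cA(1)]]) (use cA in auto)
    then have "frechet_derivative (snd c \<circ> chart_inv c) (at (snd c p)) = (\<lambda>x. x)"
      by (rule frechet_derivative_at[symmetric])
    then show ?thesis using c by (simp add: v_def)
  qed
  ultimately show ?thesis by (rule that)
qed

text \<open>By \<open>ex_tangent\<close> the chosen form is determined on the image of a chart and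
  inherits symmetry and coercivity there; elsewhere it is arbitrary.\<close>

definition metric_form :: "('m, 'h) chart \<Rightarrow> 'h \<Rightarrow> 'h \<Rightarrow>\<^sub>L 'h \<Rightarrow>\<^sub>L real" where
  "metric_form c = (SOME G. smooth_map_on (image_of c) G \<and>
     (\<forall>p\<in>fst c. \<forall>u\<in>T p. \<forall>v\<in>T p. g p u v = blinfun_apply (blinfun_apply (G (snd c p)) (u c)) (v c)))"

lemma metric_form_props:
  assumes "c \<in> A"
  shows "smooth_map_on (image_of c) (metric_form c)"
    and "p \<in> fst c \<Longrightarrow> u \<in> T p \<Longrightarrow> v \<in> T p \<Longrightarrow> g p u v = metric_form c (snd c p) (u c) (v c)"
proof -
  have "\<exists>G :: 'h \<Rightarrow> ('h \<Rightarrow>\<^sub>L 'h \<Rightarrow>\<^sub>L real). smooth_map_on (image_of c) G \<and>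
     (\<forall>p\<in>fst c. \<forall>u\<in>T p. \<forall>v\<in>T p. g p u v = blinfun_apply (blinfun_apply (G (snd c p)) (u c)) (v c))"
    using metric assms unfolding riemannian_metric_def by (elim conjE) (rule bspec)
  from someI_ex[OF this] show "smooth_map_on (image_of c) (metric_form c)"
    "p \<in> fst c \<Longrightarrow> u \<in> T p \<Longrightarrow> v \<in> T p \<Longrightarrow> g p u v = metric_form c (snd c p) (u c) (v c)"
    unfolding metric_form_def[symmetric] by blast+
qed

lemma continuous_on_metric_form:
  assumes "c \<in> A" shows "continuous_on (image_of c) (metric_form c)"
proof -
  have "metric_form c differentiable (at x)" if "x \<in> image_of c" for x
    using smooth_map_on_imp_C1[OF metric_form_props(1)[OF assms] open_chart(2)[OF assms]]
    by (metis differentiable_def that)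
  then show ?thesis
    by (intro differentiable_imp_continuous_on differentiable_at_imp_differentiable_on)
qed

lemma tnorm_eq: "c \<in> charts p \<Longrightarrow> v \<in> T p \<Longrightarrow> tnorm p v = sqrt (metric_form c (snd c p) (v c) (v c))"
  by (simp add: tangent_norm_def metric_form_props(2) charts_iff)

lemma metric_form_sym:
  assumes "c \<in> charts p"
  shows "metric_form c (snd c p) u v = metric_form c (snd c p) v u"
proof -
  obtain u' v' where "u' \<in> T p" "u' c = u" "v' \<in> T p" "v' c = v"
    using ex_tangent[OF assms] by metis
  moreover from this have "g p u' v' = g p v' u'" using metric unfolding riemannian_metric_def by blast
  ultimately show ?thesis using metric_form_props(2)[of c] assms by (metis charts_iff)
qed

lemma metric_form_coercive:
  assumes "c \<in> charts p"
  obtains a where "a > 0" "\<And>h. a * (norm h)\<^sup>2 \<le> metric_form c (snd c p) h h"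
proof -
  obtain a where a: "a > 0" "\<And>v. v \<in> T p \<Longrightarrow> a * norm (v c) \<le> tnorm p v"
    using metric assms unfolding riemannian_metric_def by metis
  have "a\<^sup>2 * (norm h)\<^sup>2 \<le> metric_form c (snd c p) h h" for h
  proof -
    obtain v where v: "v \<in> T p" "v c = h" using ex_tangent[OF assms] .
    have *: "a * norm h \<le> sqrt (metric_form c (snd c p) h h)"
      using a(2)[OF v(1)] tnorm_eq[OF assms v(1)] v(2) by simp
    \<comment> \<open>Since \<open>sqrt\<close> of a negative number is negative, the radicand must
      be seen to be nonnegative before squaring; for \<open>h \<noteq> 0\<close> this follows from
      the positive lower bound.\<close>
    show ?thesis
    proof (cases "h = 0")
      case False
      then have "0 < a * norm h" using a by simp
      then have "0 < sqrt (metric_form c (snd c p) h h)" using * by linarith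
      then have "0 \<le> metric_form c (snd c p) h h" by simp
      moreover have "(a * norm h)\<^sup>2 \<le> (sqrt (metric_form c (snd c p) h h))\<^sup>2"
        using * a by (intro power_mono) auto
      ultimately show ?thesis by (simp add: power_mult_distrib)
    qed simp
  qed
  then show ?thesis using that[of "a\<^sup>2"] a(1) by simp
qed

lemma metric_form_nonneg: "c \<in> charts p \<Longrightarrow> 0 \<le> metric_form c (snd c p) h h"
  by (metis metric_form_coercive less_imp_le mult_nonneg_nonneg order_trans zero_le_power2)

lemma tnorm_nonneg: "v \<in> T p \<Longrightarrow> 0 \<le> tnorm p v"
  using ex_chart[of p] tnorm_eq metric_form_nonneg by fastforce

text \<open>The derivative is continuous on a neighbourhood but bounded at \<open>p\<close> alone,
  in the norm of the metric. So \<open>K\<close> may vary with the point and may involve values of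
  functions at \<open>p\<close>.\<close>

definition C1_in_chart :: "('m, 'h) chart \<Rightarrow> ('m \<Rightarrow> real) \<Rightarrow> 'm \<Rightarrow> real \<Rightarrow> bool" where
  "C1_in_chart c \<phi> p K \<longleftrightarrow> (\<exists>W D. open W \<and> snd c p \<in> W \<and> W \<subseteq> image_of c \<and>
     (\<forall>x\<in>W. ((\<phi> \<circ> chart_inv c) has_derivative blinfun_apply (D x)) (at x)) \<and>
     continuous_on W D \<and> (\<forall>v\<in>T p. \<bar>blinfun_apply (D (snd c p)) (v c)\<bar> \<le> K * tnorm p v))"

definition C1_bound :: "('m \<Rightarrow> real) \<Rightarrow> 'm \<Rightarrow> real \<Rightarrow> bool" where
  "C1_bound \<phi> p K \<longleftrightarrow> (\<exists>c\<in>charts p. C1_in_chart c \<phi> p K)"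

lemma C1_in_chartE:
  assumes "C1_in_chart c \<phi> p K"
  obtains W D where "open W" "snd c p \<in> W" "W \<subseteq> image_of c"
    "\<And>x. x \<in> W \<Longrightarrow> ((\<phi> \<circ> chart_inv c) has_derivative blinfun_apply (D x)) (at x)"
    "continuous_on W D" "\<And>v. v \<in> T p \<Longrightarrow> \<bar>blinfun_apply (D (snd c p)) (v c)\<bar> \<le> K * tnorm p v"
  using assms unfolding C1_in_chart_def by blast

text \<open>The bound is intrinsic because \<open>v c\<close> and \<open>v c'\<close> correspond
  under the derivative of the transition map; continuity survives because that derivative is itself
  continuous.\<close>

lemma C1_in_chart_any:
  assumes "C1_bound \<phi> p K" and c': "c' \<in> charts p"
  shows "C1_in_chart c' \<phi> p K"
proof -
  obtain c where c: "c \<in> charts p" and "C1_in_chart c \<phi> p K"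
    using assms(1) unfolding C1_bound_def by blast
  from this(2) obtain W D where W: "open W" "snd c p \<in> W" "W \<subseteq> image_of c"
    and D: "\<And>x. x \<in> W \<Longrightarrow> ((\<phi> \<circ> chart_inv c) has_derivative blinfun_apply (D x)) (at x)"
    and contD: "continuous_on W D"
    and bound: "\<And>v. v \<in> T p \<Longrightarrow> \<bar>blinfun_apply (D (snd c p)) (v c)\<bar> \<le> K * tnorm p v"
    by (rule C1_in_chartE) blast
  have A: "c \<in> A" "p \<in> fst c" "c' \<in> A" "p \<in> fst c'" using c c' by (auto simp: charts_iff)
  define \<tau> where "\<tau> = snd c \<circ> chart_inv c'"
  define V where "V = snd c' ` (fst c' \<inter> fst c)"
  have "open V" unfolding V_def using A by (intro open_chart_image open_Int open_chart) auto
  obtain E where E: "\<And>x. x \<in> V \<Longrightarrow> (\<tau> has_derivative blinfun_apply (E x)) (at x)"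
    and contE: "continuous_on V E"
    by (rule transition_C1[OF A(3) A(1), folded \<tau>_def V_def]) blast
  have cont\<tau>: "continuous_on V \<tau>"
    by (intro has_derivative_continuous_on) (blast intro: has_derivative_at_withinI E)
  define V' where "V' = V \<inter> \<tau> -` W"
  have "open V'" unfolding V'_def by (rule continuous_open_preimage[OF cont\<tau> \<open>open V\<close> W(1)])
  have \<tau>p: "\<tau> (snd c' p) = snd c p" using A by (simp add: \<tau>_def)
  have pV: "snd c' p \<in> V" using A by (auto simp: V_def)
  show ?thesis
    unfolding C1_in_chart_def
  proof (intro exI[of _ V'] exI[of _ "\<lambda>x. D (\<tau> x) o\<^sub>L E x"] conjI ballI)
    show "open V'" by fact
    show "snd c' p \<in> V'" using pV \<tau>p W by (simp add: V'_def)
    show "V' \<subseteq> image_of c'" by (auto simp: V'_def V_def)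
    show "continuous_on V' (\<lambda>x. D (\<tau> x) o\<^sub>L E x)"
    proof (rule bounded_bilinear.continuous_on[OF bounded_bilinear_blinfun_compose])
      show "continuous_on V' (\<lambda>x. D (\<tau> x))"
        using continuous_on_compose2[OF contD, of V' \<tau>] continuous_on_subset[OF cont\<tau>]
        by (auto simp: V'_def)
      show "continuous_on V' E" using contE by (rule continuous_on_subset) (simp add: V'_def)
    qed
  next
    fix x assume x: "x \<in> V'"
    have "((\<phi> \<circ> chart_inv c) \<circ> \<tau> has_derivative blinfun_apply (D (\<tau> x)) \<circ> blinfun_apply (E x)) (at x)"
      using x by (intro diff_chain_at E D) (auto simp: V'_def)
    then have "((\<phi> \<circ> chart_inv c) \<circ> \<tau> has_derivative blinfun_apply (D (\<tau> x) o\<^sub>L E x)) (at x)"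
      by (simp add: blinfun_compose.rep_eq)
    then show "((\<phi> \<circ> chart_inv c') has_derivative blinfun_apply (D (\<tau> x) o\<^sub>L E x)) (at x)"
      by (rule has_derivative_transform_within_open[OF _ \<open>open V'\<close> x])
        (use A in \<open>auto simp: V'_def V_def \<tau>_def\<close>)
  next
    fix v assume v: "v \<in> T p"
    have "frechet_derivative \<tau> (at (snd c' p)) = blinfun_apply (E (snd c' p))"
      by (rule frechet_derivative_at[symmetric, OF E[OF pV]])
    then have "v c = E (snd c' p) (v c')"
      using tangent_transition[OF v c' c] by (simp add: \<tau>_def)
    then show "\<bar>blinfun_apply (D (\<tau> (snd c' p)) o\<^sub>L E (snd c' p)) (v c')\<bar> \<le> K * tnorm p v"
      using bound[OF v] by (simp add: \<tau>p)
  qed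
qed

lemma C1_boundI_chart:
  assumes "c \<in> charts p" "open W" "snd c p \<in> W"
    and "\<And>x. x \<in> W \<Longrightarrow> (u has_derivative blinfun_apply (D x)) (at x)" "continuous_on W D"
    and "\<And>h. \<bar>D (snd c p) h\<bar> \<le> K * sqrt (metric_form c (snd c p) h h)"
    and "\<And>q. q \<in> fst c \<Longrightarrow> snd c q \<in> W \<Longrightarrow> \<phi> q = u (snd c q)"
  shows "C1_bound \<phi> p K"
proof -
  have cA: "c \<in> A" "p \<in> fst c" using assms(1) by (auto simp: charts_iff)
  have "C1_in_chart c \<phi> p K"
    unfolding C1_in_chart_def
  proof (intro exI[of _ "W \<inter> image_of c"] exI[of _ D] conjI ballI)
    show o: "open (W \<inter> image_of c)" using assms(2) open_chart(2)[OF cA(1)] by blast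
    fix x assume x: "x \<in> W \<inter> image_of c"
    show "((\<phi> \<circ> chart_inv c) has_derivative blinfun_apply (D x)) (at x)"
      by (rule has_derivative_transform_within_open[OF assms(4) o x])
        (use x cA assms(7) chart_inv_in in auto)
  qed (use assms cA tnorm_eq[OF assms(1)] in \<open>auto intro: continuous_on_subset\<close>)
  then show ?thesis using assms(1) C1_bound_def by blast
qed

lemma C1_bound_cong:
  assumes "C1_bound \<phi> p K" "open W" "p \<in> W" "\<And>x. x \<in> W \<Longrightarrow> \<psi> x = \<phi> x"
  shows "C1_bound \<psi> p K"
proof -
  obtain c where c: "c \<in> charts p" and "C1_in_chart c \<phi> p K"
    using assms(1) unfolding C1_bound_def by blast
  from this(2) obtain V D where V: "open V" "snd c p \<in> V" "V \<subseteq> image_of c"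
    and D: "\<And>x. x \<in> V \<Longrightarrow> ((\<phi> \<circ> chart_inv c) has_derivative blinfun_apply (D x)) (at x)"
    and contD: "continuous_on V D"
    and bound: "\<And>v. v \<in> T p \<Longrightarrow> \<bar>blinfun_apply (D (snd c p)) (v c)\<bar> \<le> K * tnorm p v"
    by (rule C1_in_chartE) blast
  have A: "c \<in> A" "p \<in> fst c" using c by (auto simp: charts_iff)
  define V' where "V' = V \<inter> snd c ` (fst c \<inter> W)"
  have "open V'" unfolding V'_def using A V assms by (intro open_Int open_chart_image open_chart) auto
  have "C1_in_chart c \<psi> p K"
    unfolding C1_in_chart_def
  proof (intro exI[of _ V'] exI[of _ D] conjI ballI)
    fix x assume x: "x \<in> V'"
    show "((\<psi> \<circ> chart_inv c) has_derivative blinfun_apply (D x)) (at x)"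
      by (rule has_derivative_transform_within_open[OF D \<open>open V'\<close> x])
        (use x A assms(4) in \<open>auto simp: V'_def\<close>)
  qed (use \<open>open V'\<close> A V assms contD bound in \<open>auto simp: V'_def intro: continuous_on_subset\<close>)
  then show ?thesis using c C1_bound_def by blast
qed

lemma C1_bound_mono: "C1_bound \<phi> p K \<Longrightarrow> K \<le> K' \<Longrightarrow> C1_bound \<phi> p K'"
  unfolding C1_bound_def C1_in_chart_def
proof (elim bexE exE conjE, intro bexI exI conjI ballI)
  fix c W and D :: "'h \<Rightarrow> 'h \<Rightarrow>\<^sub>L real" and v
  assume "\<forall>v\<in>T p. \<bar>blinfun_apply (D (snd c p)) (v c)\<bar> \<le> K * tnorm p v" "v \<in> T p" "K \<le> K'"
  then show "\<bar>blinfun_apply (D (snd c p)) (v c)\<bar> \<le> K' * tnorm p v"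
    using mult_right_mono[OF \<open>K \<le> K'\<close> tnorm_nonneg[of v p]] by (meson order_trans)
qed auto

lemma C1_bound_const: "C1_bound (\<lambda>_. k) p 0"
proof -
  obtain c where c: "c \<in> charts p" using ex_chart by blast
  show ?thesis
    by (rule C1_boundI_chart[OF c open_UNIV, of "\<lambda>_. k" "\<lambda>_. 0"]) (auto simp: zero_blinfun.rep_eq)
qed

lemma C1_bound_compose:
  assumes "C1_bound \<phi> p K" and \<theta>: "\<And>t. (\<theta> has_real_derivative \<theta>' t) (at t)"
    and cont: "continuous_on UNIV \<theta>'" and C: "\<bar>\<theta>' (\<phi> p)\<bar> \<le> C"
  shows "C1_bound (\<lambda>x. \<theta> (\<phi> x)) p (C * K)"
proof -
  obtain c where c: "c \<in> charts p" and "C1_in_chart c \<phi> p K"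
    using assms(1) unfolding C1_bound_def by blast
  from this(2) obtain V D where V: "open V" "snd c p \<in> V" "V \<subseteq> image_of c"
    and D: "\<And>x. x \<in> V \<Longrightarrow> ((\<phi> \<circ> chart_inv c) has_derivative blinfun_apply (D x)) (at x)"
    and contD: "continuous_on V D"
    and bound: "\<And>v. v \<in> T p \<Longrightarrow> \<bar>blinfun_apply (D (snd c p)) (v c)\<bar> \<le> K * tnorm p v"
    by (rule C1_in_chartE) blast
  have A: "c \<in> A" "p \<in> fst c" using c by (auto simp: charts_iff)
  have "C1_in_chart c (\<lambda>x. \<theta> (\<phi> x)) p (C * K)"
    unfolding C1_in_chart_def
  proof (intro exI[of _ V] exI[of _ "\<lambda>x. \<theta>' (\<phi> (chart_inv c x)) *\<^sub>R D x"] conjI ballI)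
    fix x assume x: "x \<in> V"
    have "(\<theta> has_derivative (\<lambda>h. \<theta>' ((\<phi> \<circ> chart_inv c) x) * h)) (at ((\<phi> \<circ> chart_inv c) x))"
      using \<theta> by (simp add: has_field_derivative_def)
    from diff_chain_at[OF D[OF x] this]
    show "((\<lambda>x. \<theta> (\<phi> x)) \<circ> chart_inv c has_derivative
        blinfun_apply (\<theta>' (\<phi> (chart_inv c x)) *\<^sub>R D x)) (at x)"
      by (simp add: o_def scaleR_blinfun.rep_eq)
  next
    have "continuous_on V (\<phi> \<circ> chart_inv c)"
      by (intro has_derivative_continuous_on) (blast intro: has_derivative_at_withinI D)
    then have "continuous_on V (\<lambda>x. \<theta>' (\<phi> (chart_inv c x)))"
      using continuous_on_compose2[OF cont] by (force simp: o_def)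
    then show "continuous_on V (\<lambda>x. \<theta>' (\<phi> (chart_inv c x)) *\<^sub>R D x)"
      using contD by (intro continuous_intros)
  next
    fix v assume v: "v \<in> T p"
    have "\<bar>\<theta>' (\<phi> p)\<bar> * \<bar>D (snd c p) (v c)\<bar> \<le> C * (K * tnorm p v)"
      using C bound[OF v] by (intro mult_mono) auto
    then show "\<bar>blinfun_apply (\<theta>' (\<phi> (chart_inv c (snd c p))) *\<^sub>R D (snd c p)) (v c)\<bar> \<le> C * K * tnorm p v"
      using A by (simp add: blinfun.scaleR_left abs_mult mult.assoc)
  qed (use V in auto)
  then show ?thesis using c C1_bound_def by blast
qed

text \<open>The bound for the product contains the values of the factors at \<open>p\<close>, not
  their suprema. A weight with a large differential is therefore harmless next to a factor that is
  small at \<open>p\<close>.\<close>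

lemma
  assumes "C1_bound \<phi> p K" "C1_bound \<psi> p L"
  shows C1_bound_add: "C1_bound (\<lambda>x. \<phi> x + \<psi> x) p (K + L)"
    and C1_bound_mult: "C1_bound (\<lambda>x. \<phi> x * \<psi> x) p (\<bar>\<phi> p\<bar> * L + \<bar>\<psi> p\<bar> * K)"
proof -
  obtain c where c: "c \<in> charts p" using ex_chart by blast
  obtain V D where V: "open V" "snd c p \<in> V" "V \<subseteq> image_of c"
    and D: "\<And>x. x \<in> V \<Longrightarrow> ((\<phi> \<circ> chart_inv c) has_derivative blinfun_apply (D x)) (at x)"
    and contD: "continuous_on V D"
    and bound: "\<And>v. v \<in> T p \<Longrightarrow> \<bar>blinfun_apply (D (snd c p)) (v c)\<bar> \<le> K * tnorm p v"
    using C1_in_chart_any[OF assms(1) c] by (rule C1_in_chartE) blast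
  obtain W E where W: "open W" "snd c p \<in> W" "W \<subseteq> image_of c"
    and E: "\<And>x. x \<in> W \<Longrightarrow> ((\<psi> \<circ> chart_inv c) has_derivative blinfun_apply (E x)) (at x)"
    and contE: "continuous_on W E"
    and bound': "\<And>v. v \<in> T p \<Longrightarrow> \<bar>blinfun_apply (E (snd c p)) (v c)\<bar> \<le> L * tnorm p v"
    using C1_in_chart_any[OF assms(2) c] by (rule C1_in_chartE) blast
  have A: "c \<in> A" "p \<in> fst c" using c by (auto simp: charts_iff)
  have cont: "continuous_on (V \<inter> W) D" "continuous_on (V \<inter> W) E"
    using contD contE by (auto intro: continuous_on_subset)
  have cont\<phi>: "continuous_on (V \<inter> W) (\<phi> \<circ> chart_inv c)" "continuous_on (V \<inter> W) (\<psi> \<circ> chart_inv c)"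
    by (intro has_derivative_continuous_on; blast intro: has_derivative_at_withinI D E)+
  have "C1_in_chart c (\<lambda>x. \<phi> x + \<psi> x) p (K + L)"
    unfolding C1_in_chart_def
  proof (intro exI[of _ "V \<inter> W"] exI[of _ "\<lambda>x. D x + E x"] conjI ballI)
    fix x assume x: "x \<in> V \<inter> W"
    show "((\<lambda>x. \<phi> x + \<psi> x) \<circ> chart_inv c has_derivative blinfun_apply (D x + E x)) (at x)"
      using has_derivative_add[OF D E] x by (simp add: o_def blinfun.add_left[abs_def])
  next
    fix v assume v: "v \<in> T p"
    then show "\<bar>blinfun_apply (D (snd c p) + E (snd c p)) (v c)\<bar> \<le> (K + L) * tnorm p v"
      using bound[OF v] bound'[OF v] by (simp add: blinfun.add_left algebra_simps)
  qed (use V W cont in \<open>auto intro!: continuous_intros\<close>)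
  then show "C1_bound (\<lambda>x. \<phi> x + \<psi> x) p (K + L)" using c C1_bound_def by blast
  have "C1_in_chart c (\<lambda>x. \<phi> x * \<psi> x) p (\<bar>\<phi> p\<bar> * L + \<bar>\<psi> p\<bar> * K)"
    unfolding C1_in_chart_def
  proof (intro exI[of _ "V \<inter> W"] exI[of _ "\<lambda>x. \<phi> (chart_inv c x) *\<^sub>R E x + \<psi> (chart_inv c x) *\<^sub>R D x"] conjI ballI)
    fix x assume x: "x \<in> V \<inter> W"
    show "((\<lambda>x. \<phi> x * \<psi> x) \<circ> chart_inv c has_derivative
        blinfun_apply (\<phi> (chart_inv c x) *\<^sub>R E x + \<psi> (chart_inv c x) *\<^sub>R D x)) (at x)"
      using has_derivative_mult[OF D E] x
      by (simp add: o_def blinfun.add_left[abs_def] blinfun.scaleR_left mult.commute)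
  next
    fix v assume v: "v \<in> T p"
    have "\<bar>\<phi> p * E (snd c p) (v c) + \<psi> p * D (snd c p) (v c)\<bar>
        \<le> \<bar>\<phi> p\<bar> * \<bar>E (snd c p) (v c)\<bar> + \<bar>\<psi> p\<bar> * \<bar>D (snd c p) (v c)\<bar>"
      by (metis abs_mult abs_triangle_ineq)
    also have "\<dots> \<le> \<bar>\<phi> p\<bar> * (L * tnorm p v) + \<bar>\<psi> p\<bar> * (K * tnorm p v)"
      using bound[OF v] bound'[OF v] by (intro add_mono mult_left_mono) auto
    finally show "\<bar>blinfun_apply (\<phi> (chart_inv c (snd c p)) *\<^sub>R E (snd c p)
        + \<psi> (chart_inv c (snd c p)) *\<^sub>R D (snd c p)) (v c)\<bar> \<le> (\<bar>\<phi> p\<bar> * L + \<bar>\<psi> p\<bar> * K) * tnorm p v"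
      using A by (simp add: blinfun.add_left blinfun.scaleR_left algebra_simps)
  qed (use V W cont cont\<phi> in \<open>auto intro!: continuous_intros simp: o_def\<close>)
  then show "C1_bound (\<lambda>x. \<phi> x * \<psi> x) p (\<bar>\<phi> p\<bar> * L + \<bar>\<psi> p\<bar> * K)" using c C1_bound_def by blast
qed

lemma C1_bound_cmult:
  assumes "C1_bound \<phi> p K" shows "C1_bound (\<lambda>x. k * \<phi> x) p (\<bar>k\<bar> * K)"
  using C1_bound_mult[OF C1_bound_const[of k] assms] by simp

text \<open>The derivatives found near different points agree by uniqueness, so selecting at each
  point the one belonging to its own neighbourhood gives a continuous derivative on the whole chart
  image.\<close>

lemma C1_bound_global:
  assumes \<phi>: "\<And>p. p \<in> fst c \<Longrightarrow> C1_bound \<phi> p (K p)" and c: "c \<in> A"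
  obtains D where "\<And>x. x \<in> image_of c \<Longrightarrow> ((\<phi> \<circ> chart_inv c) has_derivative blinfun_apply (D x)) (at x)"
    "continuous_on (image_of c) D"
    "\<And>p v. p \<in> fst c \<Longrightarrow> v \<in> T p \<Longrightarrow> \<bar>D (snd c p) (v c)\<bar> \<le> K p * tnorm p v"
proof -
  have "\<exists>W D. open W \<and> snd c p \<in> W \<and> W \<subseteq> image_of c \<and>
     (\<forall>x\<in>W. ((\<phi> \<circ> chart_inv c) has_derivative blinfun_apply (D x)) (at x)) \<and>
     continuous_on W D \<and> (\<forall>v\<in>T p. \<bar>blinfun_apply (D (snd c p)) (v c)\<bar> \<le> K p * tnorm p v)"
    if p: "p \<in> fst c" for p
    using C1_in_chart_any[OF \<phi>[OF p], of c] p c unfolding C1_in_chart_def by (simp add: charts_iff)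
  then obtain W D where WD: "\<And>p. p \<in> fst c \<Longrightarrow> open (W p) \<and> snd c p \<in> W p \<and> W p \<subseteq> image_of c \<and>
     (\<forall>x\<in>W p. ((\<phi> \<circ> chart_inv c) has_derivative blinfun_apply (D p x)) (at x)) \<and>
     continuous_on (W p) (D p) \<and> (\<forall>v\<in>T p. \<bar>blinfun_apply (D p (snd c p)) (v c)\<bar> \<le> K p * tnorm p v)"
    by metis
  define E where "E x = D (chart_inv c x) x" for x
  have E: "((\<phi> \<circ> chart_inv c) has_derivative blinfun_apply (E x)) (at x)" if "x \<in> image_of c" for x
    using WD[OF chart_inv_in[OF c that]] chart_chart_inv[OF c that] unfolding E_def by metis
  show ?thesis
  proof (rule that[of E])
    show "continuous_on (image_of c) E"
    proof (rule continuous_at_imp_continuous_on, rule ballI)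
      fix x assume x: "x \<in> image_of c"
      define p where "p = chart_inv c x"
      have p: "p \<in> fst c" "snd c p = x" using chart_inv_in[OF c x] chart_chart_inv[OF c x] by (simp_all add: p_def)
      note W = WD[OF p(1)]
      have "E y = D p y" if "y \<in> W p" for y
      proof -
        have "y \<in> image_of c" using that W by blast
        then have "blinfun_apply (E y) = blinfun_apply (D p y)"
          using that W by (intro has_derivative_unique[OF E]) auto
        then show ?thesis by (simp add: blinfun_apply_inject)
      qed
      then have "continuous_on (W p) E" using W continuous_on_cong by (metis (no_types, lifting))
      then show "isCont E x" using W p continuous_on_eq_continuous_at by blast
    qed
    show "\<bar>E (snd c p) (v c)\<bar> \<le> K p * tnorm p v" if "p \<in> fst c" "v \<in> T p" for p v
      using WD[OF that(1)] that c by (simp add: E_def)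
  qed (rule E)
qed

lemma C1_bound_imp_C1_function: "(\<And>p. C1_bound \<phi> p (K p)) \<Longrightarrow> C1_function A \<phi>"
  unfolding C1_function_def
proof
  fix c assume *: "\<And>p. C1_bound \<phi> p (K p)" "c \<in> A"
  obtain D where "\<And>x. x \<in> image_of c \<Longrightarrow> ((\<phi> \<circ> chart_inv c) has_derivative blinfun_apply (D x)) (at x)"
    "continuous_on (image_of c) D"
    by (rule C1_bound_global[OF *]) blast
  then show "\<exists>D :: 'h \<Rightarrow> ('h \<Rightarrow>\<^sub>L real).
        (\<forall>x\<in>snd c ` fst c. ((\<phi> \<circ> chart_inv c) has_derivative blinfun_apply (D x)) (at x)) \<and>
        continuous_on (snd c ` fst c) D" by (intro exI[of _ D] conjI ballI)
qed

lemma C1_bound_imp_differential_sup_norm: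
  assumes "\<And>p. C1_bound \<phi> p K" "K \<ge> 0" shows "differential_sup_norm A g \<phi> \<le> ereal K"
  unfolding differential_sup_norm_def cotangent_norm_def
proof (intro SUP_least)
  fix p v assume v: "v \<in> {v \<in> T p. tnorm p v \<le> 1}"
  define c where "c = (SOME c. c \<in> charts p)"
  have c: "c \<in> charts p" unfolding c_def using ex_chart by (rule someI_ex)
  obtain D where D: "((\<phi> \<circ> chart_inv c) has_derivative blinfun_apply D) (at (snd c p))"
    and b: "\<bar>D (v c)\<bar> \<le> K * tnorm p v"
    using C1_in_chart_any[OF assms(1) c] v by (elim C1_in_chartE) blast
  have "frechet_derivative (\<phi> \<circ> chart_inv c) (at (snd c p)) = blinfun_apply D"
    by (rule frechet_derivative_at[symmetric, OF D])
  then have "\<bar>differential A \<phi> p v\<bar> \<le> K * tnorm p v"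
    using b by (simp add: differential_def c_def[symmetric] Let_def)
  also have "\<dots> \<le> K * 1" using v assms(2) by (intro mult_left_mono) auto
  finally show "ereal \<bar>differential A \<phi> p v\<bar> \<le> ereal K" by simp
qed

end

section \<open>A \<open>C\<^sup>1\<close> step function and two facts of topology\<close>

definition smooth_step :: "real \<Rightarrow> real" where
  "smooth_step t = 2 * ((max 0 t)\<^sup>2 - 2 * (max 0 (t - 1/2))\<^sup>2 + (max 0 (t - 1))\<^sup>2)"

text \<open>The tent of height 2 over the unit interval, of integral 1, written with positive parts
  so that it and its primitive are single formulas.\<close>

definition smooth_step' :: "real \<Rightarrow> real" where
  "smooth_step' t = 4 * (max 0 t - 2 * max 0 (t - 1/2) + max 0 (t - 1))"

lemma has_real_derivative_max_0_square:
  "((\<lambda>t::real. (max 0 t)\<^sup>2) has_real_derivative 2 * max 0 t) (at t)"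
proof -
  consider "t > 0" | "t < 0" | "t = 0" by linarith
  then show ?thesis
  proof cases
    case 1
    have "((\<lambda>t::real. t\<^sup>2) has_real_derivative 2 * max 0 t) (at t)"
      using 1 by (auto intro!: derivative_eq_intros)
    then show ?thesis
      by (rule has_field_derivative_transform_within_open[where S = "{0<..}"]) (use 1 in auto)
  next
    case 2
    have "((\<lambda>t::real. 0) has_real_derivative 2 * max 0 t) (at t)"
      using 2 by (auto intro!: derivative_eq_intros)
    then show ?thesis
      by (rule has_field_derivative_transform_within_open[where S = "{..<0}"]) (use 2 in auto)
  next
    case 3
    have "((\<lambda>h::real. (max 0 h)\<^sup>2 / h) \<longlongrightarrow> 0) (at 0)"
    proof (rule Lim_null_comparison)
      show "\<forall>\<^sub>F h::real in at 0. norm ((max 0 h)\<^sup>2 / h) \<le> \<bar>h\<bar>"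
        by (intro always_eventually allI) (auto simp: max_def power2_eq_square)
      show "((\<lambda>h::real. \<bar>h\<bar>) \<longlongrightarrow> 0) (at 0)" by (auto intro!: tendsto_eq_intros)
    qed
    then show ?thesis using 3 by (simp add: DERIV_def)
  qed
qed

lemma has_real_derivative_smooth_step: "(smooth_step has_real_derivative smooth_step' t) (at t)"
proof -
  have shift: "((\<lambda>t. (max 0 (t - c))\<^sup>2) has_real_derivative 2 * max 0 (t - c)) (at t)" for c :: real
  proof -
    have "((\<lambda>t. t - c) has_real_derivative 1) (at t)" by (auto intro!: derivative_eq_intros)
    from DERIV_chain2[OF has_real_derivative_max_0_square this] show ?thesis by simp
  qed
  show ?thesis
    unfolding smooth_step_def[abs_def] smooth_step'_def
    by (rule derivative_eq_intros shift has_real_derivative_max_0_square refl | simp add: algebra_simps)+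
qed

lemma continuous_on_smooth_step': "continuous_on UNIV smooth_step'"
  unfolding smooth_step'_def by (intro continuous_intros)

lemma abs_smooth_step'_le: "\<bar>smooth_step' t\<bar> \<le> 2"
  by (auto simp: smooth_step'_def max_def abs_le_iff)

lemma smooth_step_0: "t \<le> 0 \<Longrightarrow> smooth_step t = 0"
  by (simp add: smooth_step_def max_def)

lemma smooth_step_1: "1 \<le> t \<Longrightarrow> smooth_step t = 1"
  by (simp add: smooth_step_def max_def power2_eq_square algebra_simps)

lemma smooth_step_bounds: "0 \<le> smooth_step t" "smooth_step t \<le> 1"
proof -
  have "0 \<le> smooth_step t \<and> smooth_step t \<le> 1"
  proof (cases "t \<le> 0 \<or> 1 \<le> t")
    case True
    then show ?thesis using smooth_step_0 smooth_step_1 by fastforce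
  next
    case False
    show ?thesis
    proof (cases "t \<le> 1/2")
      case True
      then have "smooth_step t = 2 * t\<^sup>2" using False by (simp add: smooth_step_def max_def)
      moreover have "t\<^sup>2 \<le> (1/2)\<^sup>2" using True False by (intro power_mono) auto
      ultimately show ?thesis by (simp add: power2_eq_square)
    next
      case g: False
      then have "smooth_step t = 1 - 2 * (1 - t)\<^sup>2"
        using False by (simp add: smooth_step_def max_def power2_eq_square field_simps)
      moreover have "(1 - t)\<^sup>2 \<le> (1/2)\<^sup>2" using g False by (intro power_mono) auto
      ultimately show ?thesis by (simp add: power2_eq_square)
    qed
  qed
  then show "0 \<le> smooth_step t" "smooth_step t \<le> 1" by auto
qed

text \<open>By the Hausdorff property, \<open>U\<close> and the open sets whose closure misses
  \<open>p\<close> form a cover. In a locally finite refinement the members not inside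
  \<open>U\<close> have closures that miss \<open>p\<close>, and so does the closure of their union;
  its complement is the required neighbourhood.\<close>

lemma paracompact_imp_regular:
  fixes U :: "'a::t2_space set"
  assumes "paracompact_space (euclidean :: 'a topology)" "open U" "p \<in> U"
  obtains W where "open W" "p \<in> W" "closure W \<subseteq> U"
proof -
  define \<U> where "\<U> = insert U {V. open V \<and> p \<notin> closure V}"
  have "x \<in> \<Union>\<U>" for x
  proof (cases "x = p")
    case False
    then obtain V V' where "open V" "open V'" "p \<in> V" "x \<in> V'" "V \<inter> V' = {}"
      using hausdorff by metis
    then have "p \<notin> closure V'" using open_Int_closure_eq_empty[of V V'] by blast
    then show ?thesis using \<open>open V'\<close> \<open>x \<in> V'\<close> by (auto simp: \<U>_def)
  qed (use assms in \<open>auto simp: \<U>_def\<close>)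
  then have \<U>: "(\<forall>U\<in>\<U>. openin euclidean U) \<and> \<Union>\<U> = topspace euclidean"
    using assms(2) by (auto simp: \<U>_def)
  obtain \<V> where "(\<forall>V\<in>\<V>. openin euclidean V) \<and> \<Union>\<V> = topspace euclidean \<and>
      (\<forall>V\<in>\<V>. \<exists>U\<in>\<U>. V \<subseteq> U) \<and> locally_finite_in euclidean \<V>"
    using assms(1)[unfolded paracompact_space_def, THEN spec, THEN mp, OF \<U>] by (rule exE)
  then have \<V>: "\<forall>V\<in>\<V>. open V" "\<Union>\<V> = UNIV" "\<forall>V\<in>\<V>. \<exists>U\<in>\<U>. V \<subseteq> U"
    "locally_finite_in euclidean \<V>" by auto
  define \<C> where "\<C> = {V\<in>\<V>. \<not> V \<subseteq> U}"
  have "locally_finite_in euclidean \<C>"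
    by (rule locally_finite_in_subset[OF \<V>(4)]) (auto simp: \<C>_def)
  then have "closure (\<Union>\<C>) = \<Union>(closure ` \<C>)"
    using closure_of_locally_finite_Union[of euclidean \<C>] by simp
  moreover have "p \<notin> closure V" if "V \<in> \<C>" for V
  proof -
    have V: "V \<in> \<V>" "\<not> V \<subseteq> U" using that by (auto simp: \<C>_def)
    then obtain V' where "V' \<in> \<U>" "V \<subseteq> V'" using \<V>(3) by blast
    then show ?thesis using V closure_mono[of V V'] by (auto simp: \<U>_def \<C>_def)
  qed
  ultimately have p: "p \<notin> closure (\<Union>\<C>)" by auto
  have "closure (- closure (\<Union>\<C>)) \<subseteq> U"
  proof -
    have "open (\<Union>\<C>)" using \<V>(1) by (auto simp: \<C>_def)
    moreover have "- closure (\<Union>\<C>) \<subseteq> - \<Union>\<C>" using closure_subset[of "\<Union>\<C>"] by (simp only: Compl_subset_Compl_iff)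
    ultimately have "closure (- closure (\<Union>\<C>)) \<subseteq> - \<Union>\<C>" by (intro closure_minimal) auto
    also have "- \<Union>\<C> \<subseteq> U" using \<V>(2) by (auto simp: \<C>_def)
    finally show ?thesis .
  qed
  with p show ?thesis by (intro that[of "- closure (\<Union>\<C>)"]) auto
qed

lemma continuous_on_nearby:
  fixes \<gamma> :: "'a::metric_space \<Rightarrow> 'b::topological_space"
  assumes "continuous_on S \<gamma>" "t \<in> S" "open U" "\<gamma> t \<in> U"
  obtains d where "d > 0" "\<And>s. s \<in> S \<Longrightarrow> dist s t < d \<Longrightarrow> \<gamma> s \<in> U"
proof -
  have "\<forall>\<^sub>F s in at t within S. \<gamma> s \<in> U"
    using assms topological_tendstoD unfolding continuous_on_def by blast
  then obtain d where "d > 0" "\<forall>s\<in>S. s \<noteq> t \<and> dist s t < d \<longrightarrow> \<gamma> s \<in> U"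
    unfolding eventually_at by blast
  then show ?thesis using assms(4) by (intro that[of d]) auto
qed

section \<open>The Riemannian distance\<close>

context riemannian begin

text \<open>The derivatives are one-sided at the ends of the piece, so that the speed is continuous
  on each closed piece. For the whole path, \<open>velocity\<close> can differ from this only at
  break points.\<close>

definition velocity_on :: "real \<Rightarrow> real \<Rightarrow> (real \<Rightarrow> 'm) \<Rightarrow> real \<Rightarrow> ('m, 'h) tangent" where
  "velocity_on a b \<gamma> t =
     (\<lambda>c. if c \<in> charts (\<gamma> t) then vector_derivative (snd c \<circ> \<gamma>) (at t within {a..b}) else 0)"

definition speed :: "real \<Rightarrow> real \<Rightarrow> (real \<Rightarrow> 'm) \<Rightarrow> real \<Rightarrow> real" where
  "speed a b \<gamma> t = tnorm (\<gamma> t) (velocity_on a b \<gamma> t)"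

lemma path_len_eq: "path_len A g \<gamma> = integral {0..1} (speed 0 1 \<gamma>)"
  by (simp add: path_len_def speed_def[abs_def] velocity_on_def velocity_def)

lemma velocity_on_eq:
  assumes "a < b" "t \<in> {a..b}" "c \<in> charts (\<gamma> t)"
    and "((snd c \<circ> \<gamma>) has_vector_derivative v) (at t within {a..b})"
  shows "velocity_on a b \<gamma> t c = v"
  using assms vector_derivative_within_cbox[of a b t "snd c \<circ> \<gamma>" v] by (simp add: velocity_on_def)

lemma
  assumes \<gamma>: "C1_path_on A a b \<gamma>" and ab: "a < b"
  shows velocity_on_works: "\<And>t c. t \<in> {a..b} \<Longrightarrow> c \<in> charts (\<gamma> t) \<Longrightarrow>
      ((snd c \<circ> \<gamma>) has_vector_derivative velocity_on a b \<gamma> t c) (at t within {a..b})"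
    and continuous_on_velocity_on: "\<And>c. c \<in> A \<Longrightarrow>
      continuous_on ({a..b} \<inter> \<gamma> -` fst c) (\<lambda>t. velocity_on a b \<gamma> t c)"
proof -
  have *: "\<exists>D. (\<forall>t\<in>{a..b} \<inter> \<gamma> -` fst c. ((snd c \<circ> \<gamma>) has_vector_derivative D t) (at t within {a..b}) \<and>
      velocity_on a b \<gamma> t c = D t) \<and> continuous_on ({a..b} \<inter> \<gamma> -` fst c) D" if c: "c \<in> A" for c
  proof -
    obtain D where D: "\<forall>t\<in>{a..b} \<inter> \<gamma> -` fst c. ((snd c \<circ> \<gamma>) has_vector_derivative D t) (at t within {a..b})"
      "continuous_on ({a..b} \<inter> \<gamma> -` fst c) D"
      using \<gamma> c unfolding C1_path_on_def by meson
    then have "velocity_on a b \<gamma> t c = D t" if "t \<in> {a..b} \<inter> \<gamma> -` fst c" for t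
      using that c by (intro velocity_on_eq[OF ab]) (auto simp: charts_iff)
    with D show ?thesis by (intro exI[of _ D]) blast
  qed
  show "((snd c \<circ> \<gamma>) has_vector_derivative velocity_on a b \<gamma> t c) (at t within {a..b})"
    if "t \<in> {a..b}" "c \<in> charts (\<gamma> t)" for t c
    using *[of c] that by (auto simp: charts_iff)
  show "continuous_on ({a..b} \<inter> \<gamma> -` fst c) (\<lambda>t. velocity_on a b \<gamma> t c)" if "c \<in> A" for c
    using *[OF that] continuous_on_cong by (metis (no_types, lifting))
qed

lemma has_vector_derivative_through_chart:
  assumes \<gamma>: "C1_path_on A a b \<gamma>" and ab: "a < b" and t: "t \<in> {a..b}" and c: "c \<in> charts (\<gamma> t)"
    and F: "((F \<circ> chart_inv c) has_derivative F') (at (snd c (\<gamma> t)))"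
  shows "((F \<circ> \<gamma>) has_vector_derivative F' (velocity_on a b \<gamma> t c)) (at t within {a..b})"
proof -
  have cA: "c \<in> A" "\<gamma> t \<in> fst c" using c by (auto simp: charts_iff)
  have cont: "continuous_on {a..b} \<gamma>" using \<gamma> by (simp add: C1_path_on_def)
  obtain d where d: "d > 0" "\<And>s. s \<in> {a..b} \<Longrightarrow> dist s t < d \<Longrightarrow> \<gamma> s \<in> fst c"
    using continuous_on_nearby[OF cont t open_chart(1)[OF cA(1)] cA(2)] by blast
  have "((F \<circ> chart_inv c) \<circ> (snd c \<circ> \<gamma>) has_vector_derivative F' (velocity_on a b \<gamma> t c)) (at t within {a..b})"
    by (rule vector_derivative_diff_chain_within[OF velocity_on_works[OF \<gamma> ab t c]])
      (subst o_apply, rule has_derivative_at_withinI[OF F])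
  then show ?thesis
    by (rule has_vector_derivative_transform_within[OF _ d(1) t]) (use d cA in auto)
qed

lemma velocity_on_tangent:
  assumes \<gamma>: "C1_path_on A a b \<gamma>" and ab: "a < b" and t: "t \<in> {a..b}"
  shows "velocity_on a b \<gamma> t \<in> T (\<gamma> t)"
  unfolding tangent_space_def
proof (intro CollectI conjI ballI allI impI)
  fix c c' assume c: "c \<in> charts (\<gamma> t)" "c' \<in> charts (\<gamma> t)"
  show "velocity_on a b \<gamma> t c' = frechet_derivative (snd c' \<circ> chart_inv c) (at (snd c (\<gamma> t))) (velocity_on a b \<gamma> t c)"
    by (rule velocity_on_eq[where \<gamma> = \<gamma>, OF ab t c(2)]
        has_vector_derivative_through_chart[OF \<gamma> ab t c(1)] transition_has_derivative c)+
qed (simp add: velocity_on_def)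

lemma speed_eq:
  assumes "C1_path_on A a b \<gamma>" "a < b" "t \<in> {a..b}" "c \<in> charts (\<gamma> t)"
  shows "speed a b \<gamma> t = sqrt (metric_form c (snd c (\<gamma> t)) (velocity_on a b \<gamma> t c) (velocity_on a b \<gamma> t c))"
  unfolding speed_def by (rule tnorm_eq[OF assms(4) velocity_on_tangent[OF assms(1-3)]])

lemma speed_nonneg: "C1_path_on A a b \<gamma> \<Longrightarrow> a < b \<Longrightarrow> t \<in> {a..b} \<Longrightarrow> 0 \<le> speed a b \<gamma> t"
  unfolding speed_def by (intro tnorm_nonneg velocity_on_tangent)

lemma continuous_on_speed:
  assumes \<gamma>: "C1_path_on A a b \<gamma>" and ab: "a < b"
  shows "continuous_on {a..b} (speed a b \<gamma>)"
  unfolding continuous_on_def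
proof
  fix t assume t: "t \<in> {a..b}"
  obtain c where c: "c \<in> charts (\<gamma> t)" using ex_chart by blast
  have cA: "c \<in> A" "\<gamma> t \<in> fst c" using c by (auto simp: charts_iff)
  have cont: "continuous_on {a..b} \<gamma>" using \<gamma> by (simp add: C1_path_on_def)
  obtain d where d: "d > 0" "\<And>s. s \<in> {a..b} \<Longrightarrow> dist s t < d \<Longrightarrow> \<gamma> s \<in> fst c"
    using continuous_on_nearby[OF cont t open_chart(1)[OF cA(1)] cA(2)] by blast
  define S where "S = {a..b} \<inter> \<gamma> -` fst c"
  have "continuous_on S \<gamma>" using cont by (rule continuous_on_subset) (simp add: S_def)
  then have "continuous_on S (\<lambda>s. snd c (\<gamma> s))"
    using continuous_on_compose2[OF continuous_on_chart[OF cA(1)]] by (auto simp: S_def)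
  then have "continuous_on S (\<lambda>s. metric_form c (snd c (\<gamma> s)))"
    using continuous_on_compose2[OF continuous_on_metric_form[OF cA(1)]] by (auto simp: S_def)
  then have "continuous_on S (\<lambda>s. sqrt (metric_form c (snd c (\<gamma> s)) (velocity_on a b \<gamma> s c) (velocity_on a b \<gamma> s c)))"
    using continuous_on_velocity_on[OF \<gamma> ab cA(1)] unfolding S_def by (intro continuous_intros)
  then have "continuous_on S (speed a b \<gamma>)"
    by (rule continuous_on_eq) (use speed_eq[OF \<gamma> ab, where c = c] cA in \<open>auto simp: S_def charts_iff\<close>)
  then have "(speed a b \<gamma> \<longlongrightarrow> speed a b \<gamma> t) (at t within S)"
    using t cA by (simp add: continuous_on_def S_def)
  also have "at t within S = at t within {a..b}"
    by (rule at_within_nhd[of t "ball t d"]) (use d in \<open>auto simp: S_def dist_commute\<close>)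
  finally show "(speed a b \<gamma> \<longlongrightarrow> speed a b \<gamma> t) (at t within {a..b})" .
qed

lemma integrable_speed: "C1_path_on A a b \<gamma> \<Longrightarrow> a < b \<Longrightarrow> speed a b \<gamma> integrable_on {a..b}"
  by (intro integrable_continuous_real continuous_on_speed)

lemma
  assumes \<gamma>: "C1_path_on A a b \<gamma>" and ab: "a < b" "a' < b'" and \<alpha>: "\<alpha> \<noteq> 0"
    and img: "(\<lambda>t. \<alpha> * t + \<beta>) ` {a'..b'} = {a..b}"
    and eq: "\<And>t. t \<in> {a'..b'} \<Longrightarrow> \<gamma>' t = \<gamma> (\<alpha> * t + \<beta>)"
  shows C1_path_affine: "C1_path_on A a' b' \<gamma>'"
    and integral_speed_affine: "integral {a'..b'} (speed a' b' \<gamma>') = integral {a..b} (speed a b \<gamma>)"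
proof -
  have in_ab: "\<alpha> * t + \<beta> \<in> {a..b}" if "t \<in> {a'..b'}" for t using img that by blast
  have cont: "continuous_on {a..b} \<gamma>" using \<gamma> by (simp add: C1_path_on_def)
  have der: "((snd c \<circ> \<gamma>') has_vector_derivative \<alpha> *\<^sub>R velocity_on a b \<gamma> (\<alpha> * t + \<beta>) c) (at t within {a'..b'})"
    if t: "t \<in> {a'..b'}" and c: "c \<in> charts (\<gamma>' t)" for t c
  proof -
    have "((\<lambda>t. \<alpha> * t + \<beta>) has_vector_derivative \<alpha>) (at t within {a'..b'})"
      by (auto intro!: derivative_eq_intros simp: has_real_derivative_iff_has_vector_derivative[symmetric])
    moreover have "((snd c \<circ> \<gamma>) has_vector_derivative velocity_on a b \<gamma> (\<alpha> * t + \<beta>) c) (at (\<alpha> * t + \<beta>) within {a..b})"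
      using c eq[OF t] by (intro velocity_on_works[OF \<gamma> ab(1) in_ab[OF t]]) simp
    ultimately have "((snd c \<circ> \<gamma>) \<circ> (\<lambda>t. \<alpha> * t + \<beta>) has_vector_derivative \<alpha> *\<^sub>R velocity_on a b \<gamma> (\<alpha> * t + \<beta>) c) (at t within {a'..b'})"
      by (intro vector_diff_chain_within) (simp_all add: img)
    then show ?thesis
      by (rule has_vector_derivative_transform[OF t, rotated]) (simp add: eq)
  qed
  have contaff: "continuous_on X (\<lambda>t. \<alpha> * t + \<beta>)" for X by (intro continuous_intros)
  show \<gamma>': "C1_path_on A a' b' \<gamma>'"
    unfolding C1_path_on_def
  proof (intro conjI ballI)
    have "continuous_on {a'..b'} (\<lambda>t. \<gamma> (\<alpha> * t + \<beta>))"
      by (rule continuous_on_compose2[OF cont contaff]) (use in_ab in auto)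
    then show "continuous_on {a'..b'} \<gamma>'" by (rule continuous_on_eq) (simp add: eq)
    fix c assume c: "c \<in> A"
    show "\<exists>D. (\<forall>t\<in>{a'..b'} \<inter> \<gamma>' -` fst c. ((snd c \<circ> \<gamma>') has_vector_derivative D t) (at t within {a'..b'})) \<and>
        continuous_on ({a'..b'} \<inter> \<gamma>' -` fst c) D"
    proof (intro exI[of _ "\<lambda>t. \<alpha> *\<^sub>R velocity_on a b \<gamma> (\<alpha> * t + \<beta>) c"] conjI ballI)
      show "continuous_on ({a'..b'} \<inter> \<gamma>' -` fst c) (\<lambda>t. \<alpha> *\<^sub>R velocity_on a b \<gamma> (\<alpha> * t + \<beta>) c)"
        by (intro continuous_on_scaleR continuous_on_const
            continuous_on_compose2[OF continuous_on_velocity_on[OF \<gamma> ab(1) c] contaff])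
          (use in_ab eq in fastforce)
    qed (use der c in \<open>auto simp: charts_iff\<close>)
  qed
  have speed: "speed a' b' \<gamma>' t = \<bar>\<alpha>\<bar> * speed a b \<gamma> (\<alpha> * t + \<beta>)" if t: "t \<in> {a'..b'}" for t
  proof -
    obtain c where c: "c \<in> charts (\<gamma>' t)" using ex_chart by blast
    then have c': "c \<in> charts (\<gamma> (\<alpha> * t + \<beta>))" using eq[OF t] by simp
    have "velocity_on a' b' \<gamma>' t c = \<alpha> *\<^sub>R velocity_on a b \<gamma> (\<alpha> * t + \<beta>) c"
      by (rule velocity_on_eq[OF ab(2) t c der[OF t c]])
    then show ?thesis
      unfolding speed_eq[OF \<gamma>' ab(2) t c] speed_eq[OF \<gamma> ab(1) in_ab[OF t] c']
      by (simp add: eq[OF t] blinfun.scaleR_left blinfun.scaleR_right real_sqrt_mult mult.assoc[symmetric])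
  qed
  have pre: "(\<lambda>x. (1 / \<alpha>) *\<^sub>R x + - ((1 / \<alpha>) *\<^sub>R \<beta>)) ` cbox a b = {a'..b'}"
    unfolding interval_cbox[symmetric] img[symmetric] using \<alpha>
    by (force simp: image_image field_simps image_iff)
  have "((\<lambda>t. speed a b \<gamma> (\<alpha> * t + \<beta>)) has_integral (1 / \<bar>\<alpha>\<bar>) * integral {a..b} (speed a b \<gamma>)) {a'..b'}"
    using has_integral_affinity[OF _ \<alpha>, of "speed a b \<gamma>" "integral {a..b} (speed a b \<gamma>)" a b \<beta>]
      integrable_integral[OF integrable_speed[OF \<gamma> ab(1)]] unfolding pre by simp
  then have "((\<lambda>t. \<bar>\<alpha>\<bar> * speed a b \<gamma> (\<alpha> * t + \<beta>)) has_integral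
      \<bar>\<alpha>\<bar> * ((1 / \<bar>\<alpha>\<bar>) * integral {a..b} (speed a b \<gamma>))) {a'..b'}"
    by (rule has_integral_mult_right)
  then have "(speed a' b' \<gamma>' has_integral integral {a..b} (speed a b \<gamma>)) {a'..b'}"
    by (rule has_integral_eq_rhs[OF has_integral_eq[rotated]]) (use \<alpha> in \<open>simp_all add: speed\<close>)
  then show "integral {a'..b'} (speed a' b' \<gamma>') = integral {a..b} (speed a b \<gamma>)"
    by (rule integral_unique)
qed

text \<open>Inside a piece the derivatives relative to the piece and to the unit interval coincide;
  the ends of the piece are negligible for the integral.\<close>

lemma path_len_pieces:
  assumes ts: "ts 0 = 0" "ts n = 1"
    and pieces: "\<And>i. i < n \<Longrightarrow> ts i < ts (Suc i) \<and> C1_path_on A (ts i) (ts (Suc i)) \<gamma>"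
  shows "path_len A g \<gamma> = (\<Sum>i<n. integral {ts i..ts (Suc i)} (speed (ts i) (ts (Suc i)) \<gamma>))"
proof -
  have mono: "i \<le> j \<Longrightarrow> j \<le> n \<Longrightarrow> ts i \<le> ts j" for i j
  proof (induction j)
    case (Suc j)
    then show ?case using pieces[of j] by (cases "i = Suc j") (auto simp: le_Suc_eq)
  qed simp
  have piece: "(speed 0 1 \<gamma> has_integral integral {ts i..ts (Suc i)} (speed (ts i) (ts (Suc i)) \<gamma>)) {ts i..ts (Suc i)}"
    if i: "i < n" for i
  proof -
    have "(speed (ts i) (ts (Suc i)) \<gamma> has_integral integral {ts i..ts (Suc i)} (speed (ts i) (ts (Suc i)) \<gamma>)) (cbox (ts i) (ts (Suc i)))"
      using integrable_integral[OF integrable_speed] pieces[OF i] by simp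
    then have "(speed 0 1 \<gamma> has_integral integral {ts i..ts (Suc i)} (speed (ts i) (ts (Suc i)) \<gamma>)) (cbox (ts i) (ts (Suc i)))"
    proof (rule has_integral_spike_interior)
      fix t assume "t \<in> box (ts i) (ts (Suc i))"
      then have t: "ts i < t" "t < ts (Suc i)" by auto
      moreover have "0 \<le> ts i" "ts (Suc i) \<le> 1" using mono[of 0 i] mono[of "Suc i" n] ts i by auto
      ultimately have "at t within {0..1} = at t" "at t within {ts i..ts (Suc i)} = at t"
        by (auto intro!: at_within_interior)
      then show "speed 0 1 \<gamma> t = speed (ts i) (ts (Suc i)) \<gamma> t" unfolding speed_def velocity_on_def by metis
    qed
    then show ?thesis by simp
  qed
  have "(speed 0 1 \<gamma> has_integral (\<Sum>i<k. integral {ts i..ts (Suc i)} (speed (ts i) (ts (Suc i)) \<gamma>))) {0..ts k}"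
    if "k \<le> n" for k
    using that
  proof (induction k)
    case 0
    then show ?case using ts has_integral_refl(2)[of "speed 0 1 \<gamma>" 0] by simp
  next
    case (Suc k)
    then show ?case
      using has_integral_combine[OF _ _ Suc.IH piece[of k]] mono[of 0 k] mono[of k "Suc k"] ts by simp
  qed
  from this[of n] show ?thesis unfolding path_len_eq using ts by (simp add: integral_unique)
qed

text \<open>Every path runs over the unit interval, so that concatenation and reversal act on
  indices and lengths simply add up. Rescaling is needed only in the conversions from and to a
  single path.\<close>

definition chain :: "nat \<Rightarrow> (nat \<Rightarrow> real \<Rightarrow> 'm) \<Rightarrow> 'm \<Rightarrow> 'm \<Rightarrow> bool" where
  "chain n \<Gamma> p q \<longleftrightarrow> 0 < n \<and> (\<forall>i<n. C1_path_on A 0 1 (\<Gamma> i)) \<and> \<Gamma> 0 0 = p \<and> \<Gamma> (n - 1) 1 = q \<and>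
     (\<forall>i. Suc i < n \<longrightarrow> \<Gamma> i 1 = \<Gamma> (Suc i) 0)"

lemma riem_dist_le_chain:
  assumes "chain n \<Gamma> p q"
  shows "riem_dist A g p q \<le> ereal (\<Sum>i<n. path_len A g (\<Gamma> i))"
proof -
  have n: "0 < n" and C1: "\<And>i. i < n \<Longrightarrow> C1_path_on A 0 1 (\<Gamma> i)" and ends: "\<Gamma> 0 0 = p" "\<Gamma> (n - 1) 1 = q"
    and link: "\<And>i. Suc i < n \<Longrightarrow> \<Gamma> i 1 = \<Gamma> (Suc i) 0"
    using assms by (auto simp: chain_def)
  \<comment> \<open>At \<open>t = 1\<close> the floor would be \<open>n\<close>, one beyond the last
    path. At an inner break point it selects the start of the next path, which \<open>link\<close>
    identifies with the end of the previous one.\<close>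
  define \<gamma> where "\<gamma> t = (if t \<ge> 1 then \<Gamma> (n - 1) 1 else \<Gamma> (nat \<lfloor>real n * t\<rfloor>) (real n * t - \<lfloor>real n * t\<rfloor>))" for t
  define ts where "ts i = real i / real n" for i
  have ts: "ts 0 = 0" "ts n = 1" "\<And>i. ts i < ts (Suc i)" using n by (auto simp: ts_def divide_strict_right_mono)
  have \<gamma>: "\<gamma> t = \<Gamma> i (real n * t + - real i)" if i: "i < n" and t: "t \<in> {ts i..ts (Suc i)}" for i t
  proof (cases "t = ts (Suc i)")
    case True
    then have nt: "real n * t = real (Suc i)" using n by (simp add: ts_def)
    show ?thesis
    proof (cases "Suc i = n")
      case True
      then have "t = 1" using \<open>t = ts (Suc i)\<close> ts by simp
      then show ?thesis using True by (auto simp: \<gamma>_def)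
    next
      case False
      then have "Suc i < n" using i by simp
      then have "t < 1" using \<open>t = ts (Suc i)\<close> n by (simp add: ts_def)
      moreover have "\<lfloor>real n * t\<rfloor> = int (Suc i)" unfolding nt by (metis floor_of_nat)
      ultimately show ?thesis using link[OF \<open>Suc i < n\<close>] nt by (simp add: \<gamma>_def del: of_nat_Suc) simp
    qed
  next
    case False
    then have "real i \<le> real n * t" "real n * t < real (Suc i)"
      using t n by (auto simp: ts_def field_simps)
    moreover from this have "t < 1" using i n by (smt (verit) mult_le_cancel_left1 of_nat_0_less_iff of_nat_le_iff Suc_leI mult_left_mono mult.right_neutral)
    moreover have "\<lfloor>real n * t\<rfloor> = int i" using calculation by (intro floor_unique) auto
    ultimately show ?thesis by (simp add: \<gamma>_def)
  qed
  have img: "(\<lambda>t. real n * t + - real i) ` {ts i..ts (Suc i)} = {0..1}" for i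
  proof -
    have "(\<lambda>t. real n * t + - real i) ` {ts i..ts (Suc i)} = {real n * ts i + - real i..real n * ts (Suc i) + - real i}"
      using n ts(3)[of i] by (subst image_affinity_atLeastAtMost) auto
    then show ?thesis using n by (simp add: ts_def)
  qed
  have piece: "C1_path_on A (ts i) (ts (Suc i)) \<gamma>"
    "integral {ts i..ts (Suc i)} (speed (ts i) (ts (Suc i)) \<gamma>) = path_len A g (\<Gamma> i)" if "i < n" for i
    unfolding path_len_eq
    by (rule C1_path_affine[OF C1[OF that] _ ts(3) _ img \<gamma>[OF that]]
        integral_speed_affine[OF C1[OF that] _ ts(3) _ img \<gamma>[OF that]]; use n in simp)+
  have "piecewise_C1_path A \<gamma>"
    unfolding piecewise_C1_path_def using ts piece by blast
  moreover have "\<gamma> 0 = p" "\<gamma> 1 = q" using ends by (simp_all add: \<gamma>_def)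
  ultimately have "riem_dist A g p q \<le> ereal (path_len A g \<gamma>)"
    unfolding riem_dist_def by (intro Inf_lower) blast
  also have "path_len A g \<gamma> = (\<Sum>i<n. path_len A g (\<Gamma> i))"
    using path_len_pieces[OF ts(1,2)] ts(3) piece by simp
  finally show ?thesis .
qed

lemma piecewise_C1_path_imp_chain:
  assumes "piecewise_C1_path A \<gamma>"
  obtains n \<Gamma> where "chain n \<Gamma> (\<gamma> 0) (\<gamma> 1)" "path_len A g \<gamma> = (\<Sum>i<n. path_len A g (\<Gamma> i))"
proof -
  obtain n ts where ts: "ts 0 = 0" "ts n = 1"
    and pieces: "\<And>i. i < n \<Longrightarrow> ts i < ts (Suc i) \<and> C1_path_on A (ts i) (ts (Suc i)) \<gamma>"
    using assms unfolding piecewise_C1_path_def by blast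
  define \<Gamma> where "\<Gamma> i t = \<gamma> ((ts (Suc i) - ts i) * t + ts i)" for i t
  have n: "0 < n" using ts by (cases n) auto
  have img: "(\<lambda>t. (ts (Suc i) - ts i) * t + ts i) ` {0..1} = {ts i..ts (Suc i)}" if "i < n" for i
    using pieces[OF that] by (subst image_affinity_atLeastAtMost) auto
  have piece: "C1_path_on A 0 1 (\<Gamma> i)"
    "path_len A g (\<Gamma> i) = integral {ts i..ts (Suc i)} (speed (ts i) (ts (Suc i)) \<gamma>)" if "i < n" for i
    unfolding path_len_eq
    by (rule C1_path_affine[OF _ _ _ _ img[OF that]] integral_speed_affine[OF _ _ _ _ img[OF that]];
        use pieces[OF that] in \<open>simp add: \<Gamma>_def\<close>)+
  show ?thesis
  proof (rule that[of n \<Gamma>])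
    show "chain n \<Gamma> (\<gamma> 0) (\<gamma> 1)" unfolding chain_def using n piece ts by (simp add: \<Gamma>_def)
    show "path_len A g \<gamma> = (\<Sum>i<n. path_len A g (\<Gamma> i))"
      using path_len_pieces[OF ts pieces] piece by simp
  qed
qed

lemma riem_dist_less_chain:
  assumes "riem_dist A g p q < ereal L"
  obtains n \<Gamma> where "chain n \<Gamma> p q" "(\<Sum>i<n. path_len A g (\<Gamma> i)) < L"
proof -
  obtain \<gamma> where \<gamma>: "piecewise_C1_path A \<gamma>" "\<gamma> 0 = p" "\<gamma> 1 = q" "path_len A g \<gamma> < L"
    using assms unfolding riem_dist_def Inf_less_iff by auto
  show ?thesis
    using piecewise_C1_path_imp_chain[OF \<gamma>(1)] \<gamma> that by metis
qed

lemma path_len_nonneg: "C1_path_on A 0 1 \<gamma> \<Longrightarrow> 0 \<le> path_len A g \<gamma>"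
  unfolding path_len_eq by (intro integral_nonneg integrable_speed) (auto intro: speed_nonneg)

lemma riem_dist_nonneg: "0 \<le> riem_dist A g p q"
proof (rule ccontr)
  assume "\<not> 0 \<le> riem_dist A g p q"
  then have "riem_dist A g p q < ereal 0" by (simp add: zero_ereal_def)
  then obtain n \<Gamma> where "chain n \<Gamma> p q" "(\<Sum>i<n. path_len A g (\<Gamma> i)) < 0"
    by (rule riem_dist_less_chain)
  moreover from this have "0 \<le> (\<Sum>i<n. path_len A g (\<Gamma> i))"
    by (intro sum_nonneg path_len_nonneg) (simp add: chain_def)
  ultimately show False by simp
qed

lemma riem_dist_self: "riem_dist A g p p = 0"
proof -
  have der: "((snd c \<circ> (\<lambda>_. p)) has_vector_derivative 0) (at t within {0..1})" for c :: "('m, 'h) chart" and t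
    by (simp add: o_def)
  have C1: "C1_path_on A 0 1 (\<lambda>_. p)"
    unfolding C1_path_on_def using der by (auto intro!: exI[of _ "\<lambda>_. 0"] continuous_intros)
  have "speed 0 1 (\<lambda>_. p) t = 0" if "t \<in> {0..1}" for t
  proof -
    obtain c where c: "c \<in> charts p" using ex_chart by blast
    then have "velocity_on 0 1 (\<lambda>_. p) t c = 0"
      using that by (intro velocity_on_eq der) auto
    then show ?thesis using speed_eq[OF C1 zero_less_one that c] by simp
  qed
  then have "path_len A g (\<lambda>_. p) = integral {0..1::real} (\<lambda>_. 0)"
    unfolding path_len_eq by (intro integral_cong)
  moreover have "chain 1 (\<lambda>_ _. p) p p" using C1 by (simp add: chain_def)
  ultimately show ?thesis
    using riem_dist_le_chain[of 1 "\<lambda>_ _. p" p p] riem_dist_nonneg[of p p] by (simp add: zero_ereal_def)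
qed

lemma riem_dist_sym: "riem_dist A g p q = riem_dist A g q p"
proof -
  have *: "riem_dist A g q p \<le> riem_dist A g p q" for p q
  proof (rule ereal_le_real)
    fix L assume "riem_dist A g p q \<le> ereal L"
    show "riem_dist A g q p \<le> ereal L"
    proof (rule ereal_le_epsilon2)
        fix e :: real assume "e > 0"
        then have "riem_dist A g p q < ereal (L + e)"
          using \<open>riem_dist A g p q \<le> ereal L\<close> by (auto intro: le_less_trans)
        then obtain n \<Gamma> where \<Gamma>: "chain n \<Gamma> p q" "(\<Sum>i<n. path_len A g (\<Gamma> i)) < L + e"
          by (rule riem_dist_less_chain)
        define \<Delta> where "\<Delta> i t = \<Gamma> (n - 1 - i) (1 - t)" for i and t :: real
        have img: "(\<lambda>t::real. - 1 * t + 1) ` {0..1} = {0..1}"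
          by (subst image_affinity_atLeastAtMost) auto
        have \<Delta>: "C1_path_on A 0 1 (\<Delta> i)" "path_len A g (\<Delta> i) = path_len A g (\<Gamma> (n - 1 - i))" if "i < n" for i
        proof -
          have C: "C1_path_on A 0 1 (\<Gamma> (n - 1 - i))" using \<Gamma>(1) that by (simp add: chain_def)
          show "C1_path_on A 0 1 (\<Delta> i)" "path_len A g (\<Delta> i) = path_len A g (\<Gamma> (n - 1 - i))"
            unfolding path_len_eq
            by (rule C1_path_affine[OF C _ _ _ img] integral_speed_affine[OF C _ _ _ img]; simp add: \<Delta>_def)+
        qed
        have "chain n \<Delta> q p"
          unfolding chain_def
        proof (intro conjI allI impI)
          fix i assume i: "Suc i < n"
          then have "\<Gamma> (n - 1 - Suc i) 1 = \<Gamma> (Suc (n - 1 - Suc i)) 0" using \<Gamma>(1) by (simp add: chain_def)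
          moreover have "Suc (n - 1 - Suc i) = n - 1 - i" using i by simp
          ultimately show "\<Delta> i 1 = \<Delta> (Suc i) 0" by (simp add: \<Delta>_def)
        qed (use \<Gamma>(1) \<Delta> in \<open>auto simp: chain_def \<Delta>_def\<close>)
        then have "riem_dist A g q p \<le> ereal (\<Sum>i<n. path_len A g (\<Gamma> (n - 1 - i)))"
          using riem_dist_le_chain[of n \<Delta> q p] \<Delta>(2) by simp
        also have "(\<Sum>i<n. path_len A g (\<Gamma> (n - 1 - i))) = (\<Sum>i<n. path_len A g (\<Gamma> i))"
          using sum.nat_diff_reindex[of "\<lambda>i. path_len A g (\<Gamma> i)" n] by simp
        finally show "riem_dist A g q p \<le> ereal L + ereal e"
          by (rule order_trans) (use \<Gamma>(2) in simp)
    qed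
  qed
  show ?thesis by (intro antisym *)
qed

lemma riem_dist_triangle: "riem_dist A g p r \<le> riem_dist A g p q + riem_dist A g q r"
proof (cases "riem_dist A g p q = \<infinity> \<or> riem_dist A g q r = \<infinity>")
  case False
  obtain a b where ab: "riem_dist A g p q = ereal a" "riem_dist A g q r = ereal b"
    using False riem_dist_nonneg[of p q] riem_dist_nonneg[of q r]
    by (metis MInfty_neq_ereal(1) ereal_cases ereal_infty_less_eq2(2) zero_ereal_def)
  show ?thesis
  proof (rule ereal_le_epsilon2)
    fix e :: real assume e: "e > 0"
    obtain n \<Gamma> where \<Gamma>: "chain n \<Gamma> p q" "(\<Sum>i<n. path_len A g (\<Gamma> i)) < a + e / 2"
      by (rule riem_dist_less_chain[of p q "a + e / 2"]) (use ab e in auto)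
    obtain m \<Delta> where \<Delta>: "chain m \<Delta> q r" "(\<Sum>i<m. path_len A g (\<Delta> i)) < b + e / 2"
      by (rule riem_dist_less_chain[of q r "b + e / 2"]) (use ab e in auto)
    define \<Theta> where "\<Theta> i = (if i < n then \<Gamma> i else \<Delta> (i - n))" for i
    have "chain (n + m) \<Theta> p r"
      unfolding chain_def
    proof (intro conjI allI impI)
      fix i assume i: "Suc i < n + m"
      consider "Suc i < n" | "Suc i = n" | "n \<le> i" by linarith
      then show "\<Theta> i 1 = \<Theta> (Suc i) 0"
      proof cases
        case 2
        then show ?thesis using \<Gamma>(1) \<Delta>(1) by (auto simp: chain_def \<Theta>_def)
      next
        case 3
        then show ?thesis using i \<Delta>(1) by (auto simp: chain_def \<Theta>_def Suc_diff_le)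
      qed (use \<Gamma>(1) in \<open>auto simp: chain_def \<Theta>_def\<close>)
    qed (use \<Gamma>(1) \<Delta>(1) in \<open>auto simp: chain_def \<Theta>_def\<close>)
    then have "riem_dist A g p r \<le> ereal (\<Sum>i<n+m. path_len A g (\<Theta> i))"
      by (rule riem_dist_le_chain)
    also have "(\<Sum>i<n+m. path_len A g (\<Theta> i)) = (\<Sum>i<n. path_len A g (\<Gamma> i)) + (\<Sum>i<m. path_len A g (\<Delta> i))"
    proof (induction m)
      case (Suc k)
      then show ?case by (simp add: \<Theta>_def)
    qed (simp add: \<Theta>_def)
    finally show "riem_dist A g p r \<le> riem_dist A g p q + riem_dist A g q r + ereal e"
      by (rule order_trans) (use \<Gamma>(2) \<Delta>(2) ab in simp)
  qed
qed (use riem_dist_nonneg in auto)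

lemma C1_bound_path:
  assumes \<phi>: "\<And>p. C1_bound \<phi> p K" and K: "K \<ge> 0" and \<gamma>: "C1_path_on A 0 1 \<gamma>"
  shows "\<bar>\<phi> (\<gamma> 1) - \<phi> (\<gamma> 0)\<bar> \<le> K * path_len A g \<gamma>"
proof -
  have "\<exists>D. ((\<phi> \<circ> \<gamma>) has_vector_derivative D) (at t within {0..1}) \<and> \<bar>D\<bar> \<le> K * speed 0 1 \<gamma> t"
    if t: "t \<in> {0..1}" for t
  proof -
    obtain c where c: "c \<in> charts (\<gamma> t)" using ex_chart by blast
    obtain W D where "snd c (\<gamma> t) \<in> W" "\<And>x. x \<in> W \<Longrightarrow> ((\<phi> \<circ> chart_inv c) has_derivative blinfun_apply (D x)) (at x)"
      "\<And>v. v \<in> T (\<gamma> t) \<Longrightarrow> \<bar>blinfun_apply (D (snd c (\<gamma> t))) (v c)\<bar> \<le> K * tnorm (\<gamma> t) v"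
      using C1_in_chart_any[OF \<phi> c] by (rule C1_in_chartE) blast
    then show ?thesis
      using has_vector_derivative_through_chart[OF \<gamma> zero_less_one t c] velocity_on_tangent[OF \<gamma> zero_less_one t]
      unfolding speed_def by blast
  qed
  then obtain D where D: "\<And>t. t \<in> {0..1} \<Longrightarrow> ((\<phi> \<circ> \<gamma>) has_vector_derivative D t) (at t within {0..1})"
    "\<And>t. t \<in> {0..1} \<Longrightarrow> norm (D t) \<le> K * speed 0 1 \<gamma> t"
    by (metis real_norm_def)
  have "(D has_integral (\<phi> \<circ> \<gamma>) 1 - (\<phi> \<circ> \<gamma>) 0) {0..1}"
    by (rule fundamental_theorem_of_calculus[OF zero_le_one D(1)])
  moreover have int: "speed 0 1 \<gamma> integrable_on {0..1}" by (rule integrable_speed[OF \<gamma> zero_less_one])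
  have "norm (integral {0..1} D) \<le> integral {0..1} (\<lambda>t. K * speed 0 1 \<gamma> t)"
    using calculation integrable_on_mult_right[OF int] D(2)
    by (intro integral_norm_bound_integral) auto
  ultimately show ?thesis unfolding path_len_eq by (simp add: integral_unique)
qed

lemma C1_bound_lipschitz:
  assumes \<phi>: "\<And>p. C1_bound \<phi> p K" and K: "K \<ge> 0" and less: "riem_dist A g p q < ereal L"
  shows "\<bar>\<phi> p - \<phi> q\<bar> \<le> K * L"
proof -
  obtain n \<Gamma> where \<Gamma>: "chain n \<Gamma> p q" "(\<Sum>i<n. path_len A g (\<Gamma> i)) < L"
    using less by (rule riem_dist_less_chain)
  have "\<bar>\<phi> (\<Gamma> k 1) - \<phi> p\<bar> \<le> K * (\<Sum>i\<le>k. path_len A g (\<Gamma> i))" if "k < n" for k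
    using that
  proof (induction k)
    case 0
    then show ?case using C1_bound_path[OF \<phi> K, of "\<Gamma> 0"] \<Gamma>(1) by (simp add: chain_def)
  next
    case (Suc k)
    then have "C1_path_on A 0 1 (\<Gamma> (Suc k))" "\<Gamma> k 1 = \<Gamma> (Suc k) 0" using \<Gamma>(1) by (auto simp: chain_def)
    then show ?case using Suc C1_bound_path[OF \<phi> K, of "\<Gamma> (Suc k)"] by (simp add: distrib_left)
  qed
  from this[of "n - 1"] have "\<bar>\<phi> q - \<phi> p\<bar> \<le> K * (\<Sum>i<n. path_len A g (\<Gamma> i))"
    using \<Gamma>(1) lessThan_Suc_atMost[of "n - 1"] by (simp add: chain_def)
  also have "\<dots> \<le> K * L" using \<Gamma>(2) K by (intro mult_left_mono) auto
  finally show ?thesis by simp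
qed


section \<open>Almost flat charts and the topology induced by the distance\<close>

definition flat :: "('m, 'h) chart \<Rightarrow> 'm \<Rightarrow> real \<Rightarrow> bool" where
  "flat c p r \<longleftrightarrow> c \<in> charts p \<and> 0 < r \<and> ball (snd c p) r \<subseteq> image_of c \<and>
     (\<forall>y\<in>ball (snd c p) r. \<forall>h. metric_form c y h h \<le> 4 * metric_form c (snd c p) h h \<and>
        metric_form c (snd c p) h h \<le> 4 * metric_form c y h h)"

definition chart_ball :: "('m, 'h) chart \<Rightarrow> 'm \<Rightarrow> real \<Rightarrow> 'm set" where
  "chart_ball c p r = fst c \<inter> snd c -` ball (snd c p) r"

lemma ex_flat:
  assumes c: "c \<in> charts p"
  obtains r where "flat c p r"
proof -
  have cA: "c \<in> A" "p \<in> fst c" using c by (auto simp: charts_iff)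
  obtain a where a: "a > 0" "\<And>h. a * (norm h)\<^sup>2 \<le> metric_form c (snd c p) h h"
    by (rule metric_form_coercive[OF c]) blast
  have x: "snd c p \<in> image_of c" using cA by blast
  obtain r1 where r1: "r1 > 0" "ball (snd c p) r1 \<subseteq> image_of c"
    using open_chart(2)[OF cA(1)] x by (meson open_contains_ball)
  \<comment> \<open>By coercivity such a perturbation changes the form by at most 3/4 of itself.
    What remains is at least 1/4, which is the second inequality of \<open>flat\<close>.\<close>
  obtain r2 where r2: "r2 > 0" "\<And>y. y \<in> image_of c \<Longrightarrow> dist y (snd c p) < r2 \<Longrightarrow>
      dist (metric_form c y) (metric_form c (snd c p)) < 3 / 4 * a"
    using continuous_on_metric_form[OF cA(1)] x a(1) unfolding continuous_on_iff
    by (metis mult_pos_pos zero_less_divide_iff zero_less_numeral)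
  have "flat c p (min r1 r2)"
    unfolding flat_def
  proof (intro conjI ballI allI)
    fix y h assume y: "y \<in> ball (snd c p) (min r1 r2)"
    let ?B = "metric_form c (snd c p)"
    have "y \<in> image_of c" using y r1 by auto
    then have "norm (metric_form c y - ?B) < 3 / 4 * a"
      using r2(2)[of y] y by (simp add: dist_commute dist_norm)
    have "\<bar>metric_form c y h h - ?B h h\<bar> = \<bar>(metric_form c y - ?B) h h\<bar>" by (simp add: blinfun.diff_left)
    also have "\<dots> \<le> norm ((metric_form c y - ?B) h) * norm h" using norm_blinfun by (metis real_norm_def)
    also have "\<dots> \<le> (norm (metric_form c y - ?B) * norm h) * norm h" by (intro mult_right_mono norm_blinfun) simp
    also have "\<dots> \<le> (3 / 4 * a * norm h) * norm h"
      using \<open>norm _ < 3 / 4 * a\<close> by (intro mult_right_mono) auto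
    also have "\<dots> = 3 / 4 * (a * (norm h)\<^sup>2)" by (simp add: power2_eq_square)
    also have "\<dots> \<le> 3 / 4 * ?B h h" using a(2)[of h] by simp
    finally have "\<bar>metric_form c y h h - ?B h h\<bar> \<le> 3 / 4 * ?B h h" .
    moreover have "0 \<le> ?B h h" by (rule metric_form_nonneg[OF c])
    ultimately show "metric_form c y h h \<le> 4 * ?B h h" "?B h h \<le> 4 * metric_form c y h h" by linarith+
  qed (use c r1 r2 in auto)
  then show ?thesis by (rule that)
qed

lemma chart_ball_props:
  assumes "flat c p r"
  shows open_chart_ball: "open (chart_ball c p r)" and chart_ball_center: "p \<in> chart_ball c p r"
    and chart_ball_charts: "q \<in> chart_ball c p r \<Longrightarrow> c \<in> charts q"
  using assms open_chart_vimage[of c "ball (snd c p) r"]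
  by (auto simp: flat_def chart_ball_def charts_iff)

text \<open>The straight segment in the chart is a competitor. Convexity keeps it inside the ball,
  where the form is at most 4 times that at the centre; the square root gives the factor 2.\<close>

lemma flat_riem_dist:
  assumes flat: "flat c p r" and x: "x \<in> chart_ball c p r" and y: "y \<in> chart_ball c p r"
  shows "riem_dist A g x y \<le> ereal (2 * sqrt (metric_form c (snd c p) (snd c x - snd c y) (snd c x - snd c y)))"
proof -
  have cA: "c \<in> A" "p \<in> fst c" "ball (snd c p) r \<subseteq> image_of c" using flat by (auto simp: flat_def charts_iff)
  have xy: "x \<in> fst c" "y \<in> fst c" "snd c x \<in> ball (snd c p) r" "snd c y \<in> ball (snd c p) r"
    using x y by (auto simp: chart_ball_def)
  define w where "w = snd c y - snd c x"
  define seg where "seg t = snd c x + t *\<^sub>R w" for t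
  define \<gamma> where "\<gamma> t = chart_inv c (seg t)" for t
  have seg: "seg t \<in> ball (snd c p) r" if "t \<in> {0..1}" for t
    using convexD_alt[OF convex_ball xy(3,4), of t] that
    by (simp add: seg_def w_def algebra_simps)
  have segI: "seg t \<in> image_of c" if "t \<in> {0..1}" for t using seg[OF that] cA by blast
  have dseg: "(seg has_vector_derivative w) (at t within X)" for t X
    unfolding seg_def by (auto intro!: derivative_eq_intros)
  have contseg: "continuous_on X seg" for X unfolding seg_def by (intro continuous_intros)
  have C1: "C1_path_on A 0 1 \<gamma>"
    unfolding C1_path_on_def
  proof (intro conjI ballI)
    show "continuous_on {0..1} \<gamma>" unfolding \<gamma>_def
      by (rule continuous_on_compose2[OF continuous_on_chart_inv[OF cA(1)] contseg]) (use segI in auto)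
    fix c' assume c': "c' \<in> A"
    define V where "V = snd c ` (fst c \<inter> fst c')"
    obtain E where E: "\<And>x. x \<in> V \<Longrightarrow> ((snd c' \<circ> chart_inv c) has_derivative blinfun_apply (E x)) (at x)"
      and contE: "continuous_on V E"
      by (rule transition_C1[OF cA(1) c', folded V_def]) blast
    have V: "seg t \<in> V" if "t \<in> {0..1} \<inter> \<gamma> -` fst c'" for t
    proof -
      have "chart_inv c (seg t) \<in> fst c \<inter> fst c'" using that chart_inv_in[OF cA(1) segI] by (auto simp: \<gamma>_def)
      then show ?thesis unfolding V_def using chart_chart_inv[OF cA(1) segI, of t] that
        by (intro image_eqI[of _ _ "chart_inv c (seg t)"]) auto
    qed
    show "\<exists>D. (\<forall>t\<in>{0..1} \<inter> \<gamma> -` fst c'. ((snd c' \<circ> \<gamma>) has_vector_derivative D t) (at t within {0..1})) \<and>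
        continuous_on ({0..1} \<inter> \<gamma> -` fst c') D"
    proof (intro exI[of _ "\<lambda>t. E (seg t) w"] conjI ballI)
      fix t assume t: "t \<in> {0..1} \<inter> \<gamma> -` fst c'"
      have "(((snd c' \<circ> chart_inv c) \<circ> seg) has_vector_derivative E (seg t) w) (at t within {0..1})"
        by (rule vector_derivative_diff_chain_within[OF dseg has_derivative_at_withinI[OF E[OF V[OF t]]]])
      then show "((snd c' \<circ> \<gamma>) has_vector_derivative E (seg t) w) (at t within {0..1})"
        by (simp add: \<gamma>_def[abs_def] o_def)
    next
      show "continuous_on ({0..1} \<inter> \<gamma> -` fst c') (\<lambda>t. E (seg t) w)"
        by (intro continuous_intros continuous_on_compose2[OF contE contseg]) (use V in auto)
    qed
  qed
  let ?N = "2 * sqrt (metric_form c (snd c p) w w)"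
  have "speed 0 1 \<gamma> t \<le> ?N" if t: "t \<in> {0..1}" for t
  proof -
    have c: "c \<in> charts (\<gamma> t)" using cA chart_inv_in[OF cA(1) segI[OF t]] by (simp add: charts_iff \<gamma>_def)
    have "((snd c \<circ> \<gamma>) has_vector_derivative w) (at t within {0..1})"
      by (rule has_vector_derivative_transform[OF t _ dseg]) (use segI cA in \<open>simp add: \<gamma>_def\<close>)
    then have "velocity_on 0 1 \<gamma> t c = w" by (intro velocity_on_eq[where \<gamma> = \<gamma>] t c) auto
    moreover have "snd c (\<gamma> t) = seg t" using segI[OF t] cA by (simp add: \<gamma>_def)
    ultimately have "speed 0 1 \<gamma> t = sqrt (metric_form c (seg t) w w)"
      using speed_eq[OF C1 zero_less_one t c] by simp
    also have "\<dots> \<le> sqrt (4 * metric_form c (snd c p) w w)"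
      using flat seg[OF t] by (simp add: flat_def)
    finally show ?thesis by (simp add: real_sqrt_mult)
  qed
  then have "integral {0..1} (speed 0 1 \<gamma>) \<le> integral {0..1::real} (\<lambda>_. ?N)"
    by (intro integral_le integrable_speed[OF C1]) auto
  then have "path_len A g \<gamma> \<le> ?N" unfolding path_len_eq by simp
  moreover have "metric_form c (snd c p) w w = metric_form c (snd c p) (snd c x - snd c y) (snd c x - snd c y)"
    by (simp add: w_def blinfun.diff_left blinfun.diff_right)
  moreover have "chain 1 (\<lambda>_. \<gamma>) x y"
    using C1 cA xy by (simp add: chain_def \<gamma>_def seg_def w_def)
  ultimately show ?thesis using riem_dist_le_chain[of 1 "\<lambda>_. \<gamma>" x y] by (simp add: order_trans)
qed

text \<open>
  This is the only use of paracompactness: in infinite dimension a closed ball of a chart need not be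
  closed in the manifold, so that without regularity a bump function of the chart could not be
  extended by \<open>0\<close>.
\<close>

lemma riem_ball_subset:
  assumes "open U" "p \<in> U"
  obtains s where "s > 0" "\<And>x. riem_dist A g p x < ereal s \<Longrightarrow> x \<in> U"
proof -
  obtain c where c: "c \<in> charts p" using ex_chart by blast
  have cA: "c \<in> A" "p \<in> fst c" using c by (auto simp: charts_iff)
  obtain r where flat: "flat c p r" by (rule ex_flat[OF c])
  obtain W where W: "open W" "p \<in> W" "closure W \<subseteq> U \<inter> fst c"
    using paracompact_imp_regular[of "U \<inter> fst c" p] manifold assms cA open_chart(1)[OF cA(1)]
    unfolding riemannian_manifold_def by (metis IntI open_Int)
  have WU: "W \<subseteq> U \<inter> fst c" using W(3) closure_subset by fastforce
  have "open (snd c ` W)" using cA W WU by (intro open_chart_image) auto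
  moreover have "snd c p \<in> snd c ` W" using W by blast
  ultimately obtain r' where r': "r' > 0" "cball (snd c p) r' \<subseteq> snd c ` W"
    by (meson open_contains_cball)
  define \<rho> where "\<rho> = min r' (r / 2)"
  have \<rho>: "\<rho> > 0" "\<rho> < r" "\<rho> \<le> r'" using r' flat by (auto simp: \<rho>_def flat_def)
  define S where "S = {q \<in> fst c. dist (snd c q) (snd c p) \<le> \<rho>}"
  have SW: "S \<subseteq> W"
  proof
    fix q assume q: "q \<in> S"
    then have "snd c q \<in> snd c ` W" using r' \<rho> by (auto simp: S_def dist_commute)
    then obtain q' where "q' \<in> W" "snd c q = snd c q'" by blast
    then show "q \<in> W" using q WU chart_inv_chart[OF cA(1)] by (metis (no_types, lifting) Int_iff S_def mem_Collect_eq subsetD)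
  qed
  \<comment> \<open>This is closedness in the manifold, not just in the chart: a limit of points of
    \<open>S\<close> lies in \<open>closure W\<close>, hence in the domain of the chart, where the
    defining inequality is closed.\<close>
  have "closed S"
  proof -
    have o: "open (fst c \<inter> snd c -` (- cball (snd c p) \<rho>))" using cA by (intro open_chart_vimage) auto
    have S: "S = closure W \<inter> - (fst c \<inter> snd c -` (- cball (snd c p) \<rho>))"
      using SW W closure_subset[of W] by (auto simp: S_def dist_commute)
    show ?thesis unfolding S by (rule closed_Int[OF closed_closure closed_Compl[OF o]])
  qed
  obtain a where a: "a > 0" "\<And>h. a * (norm h)\<^sup>2 \<le> metric_form c (snd c p) h h"
    by (rule metric_form_coercive[OF c]) blast
  define u where "u x = (x - snd c p) \<bullet> (x - snd c p)" for x
  \<comment> \<open>The argument \<open>2 - k * u\<close> of the step is 2 at the centre and 0 at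
    radius \<open>\<rho>\<close>: the cutoff is 1 at \<open>p\<close> and fits together with 0
    outside \<open>S\<close>.\<close>
  define k where "k = 2 / \<rho>\<^sup>2"
  have k: "k > 0" using \<rho> by (simp add: k_def)
  define \<phi> where "\<phi> q = (if q \<in> S then smooth_step (2 - k * u (snd c q)) else 0)" for q
  \<comment> \<open>The slope 2 of the step, the factor \<open>k\<close>, and the differential of
    the squared radius: \<open>2 * \<rho>\<close> in the Hilbert norm, with
    \<open>2 / sqrt a\<close> for passing to the metric by coercivity at \<open>p\<close> and
    flatness.\<close>
  define K where "K = 2 * k * (4 * \<rho> / sqrt a)"
  have K: "0 \<le> K" using k \<rho> a by (simp add: K_def)
  have der: "((\<lambda>t. smooth_step (2 - k * t)) has_real_derivative - k * smooth_step' (2 - k * t)) (at t)" for t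
  proof -
    have "((\<lambda>t. 2 - k * t) has_real_derivative - k) (at t)" by (auto intro!: derivative_eq_intros)
    from DERIV_chain2[OF has_real_derivative_smooth_step this] show ?thesis by (simp add: mult.commute)
  qed
  have cont: "continuous_on UNIV (\<lambda>t. - k * smooth_step' (2 - k * t))"
    by (intro continuous_intros continuous_on_compose2[OF continuous_on_smooth_step']) auto
  have "C1_bound \<phi> q K" for q
  proof (cases "q \<in> S")
    case True
    then have q: "c \<in> charts q" "q \<in> fst c" "norm (snd c q - snd c p) \<le> \<rho>"
      using cA by (auto simp: S_def charts_iff dist_norm)
    have "C1_bound (\<lambda>q. u (snd c q)) q (4 * \<rho> / sqrt a)"
    proof (rule C1_boundI_chart[OF q(1) open_UNIV, of u "\<lambda>x. 2 *\<^sub>R blinfun_inner_right (x - snd c p)"])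
      show "(u has_derivative blinfun_apply (2 *\<^sub>R blinfun_inner_right (x - snd c p))) (at x)" for x
        unfolding u_def
        by (auto intro!: derivative_eq_intros simp: scaleR_blinfun.rep_eq inner_commute)
      show "continuous_on UNIV (\<lambda>x. 2 *\<^sub>R blinfun_inner_right (x - snd c p))"
        by (intro continuous_intros bounded_linear.continuous_on[OF bounded_linear_blinfun_inner_right])
      fix h
      have "\<bar>(snd c q - snd c p) \<bullet> h\<bar> \<le> norm (snd c q - snd c p) * norm h" by (rule Cauchy_Schwarz_ineq2)
      also have "\<dots> \<le> \<rho> * norm h" using q by (intro mult_right_mono) auto
      finally have 1: "\<bar>2 *\<^sub>R blinfun_inner_right (snd c q - snd c p) h\<bar> \<le> 2 * \<rho> * norm h" by (simp add: abs_mult)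
      have "snd c q \<in> ball (snd c p) r" using q \<rho> by (simp add: dist_norm norm_minus_commute)
      then have "a * (norm h)\<^sup>2 \<le> 4 * metric_form c (snd c q) h h"
        using flat a(2)[of h] unfolding flat_def by (meson order_trans)
      then have "sqrt (a * (norm h)\<^sup>2) \<le> sqrt (4 * metric_form c (snd c q) h h)" by (rule real_sqrt_le_mono)
      then have "sqrt a * norm h \<le> 2 * sqrt (metric_form c (snd c q) h h)" by (simp add: real_sqrt_mult)
      then have "2 * \<rho> / sqrt a * (sqrt a * norm h) \<le> 2 * \<rho> / sqrt a * (2 * sqrt (metric_form c (snd c q) h h))"
        using \<rho> a by (intro mult_left_mono) auto
      then show "\<bar>(2 *\<^sub>R blinfun_inner_right (snd c q - snd c p)) h\<bar> \<le> 4 * \<rho> / sqrt a * sqrt (metric_form c (snd c q) h h)"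
        using 1 a by (simp add: blinfun.scaleR_left)
    qed auto
    from C1_bound_compose[OF this der cont, of "2 * k"]
    have "C1_bound (\<lambda>q. smooth_step (2 - k * u (snd c q))) q K"
      using abs_smooth_step'_le k by (simp add: abs_mult K_def)
    then show ?thesis
    proof (rule C1_bound_cong[OF _ open_chart(1)[OF cA(1)] q(2)])
      fix x assume x: "x \<in> fst c"
      show "\<phi> x = smooth_step (2 - k * u (snd c x))"
      proof (cases "x \<in> S")
        case False
        then have "\<rho> < norm (snd c x - snd c p)" using x by (simp add: S_def dist_norm)
        then have "\<rho>\<^sup>2 \<le> u (snd c x)" using \<rho> by (simp add: u_def dot_square_norm power_mono)
        then have "k * \<rho>\<^sup>2 \<le> k * u (snd c x)" using k by simp
        then have "2 - k * u (snd c x) \<le> 0" using \<rho> by (simp add: k_def)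
        then show ?thesis using False by (simp add: \<phi>_def smooth_step_0)
      qed (simp add: \<phi>_def)
    qed
  next
    case False
    show ?thesis
      by (rule C1_bound_cong[OF C1_bound_mono[OF C1_bound_const[of 0] K], of "- S"])
        (use \<open>closed S\<close> False in \<open>auto simp: \<phi>_def\<close>)
  qed
  note lip = C1_bound_lipschitz[OF this K]
  \<comment> \<open>Within distance \<open>1 / (K + 1)\<close> the cutoff drops by less than 1 from
    its value 1 at \<open>p\<close>, so it is nonzero and the point lies in
    \<open>S\<close>.\<close>
  show ?thesis
  proof (rule that[of "1 / (K + 1)"])
    show "1 / (K + 1) > 0" using K by simp
    fix x assume "riem_dist A g p x < ereal (1 / (K + 1))"
    then have "\<bar>\<phi> p - \<phi> x\<bar> \<le> K * (1 / (K + 1))" by (rule lip)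
    also have "\<dots> < 1" using K by (simp add: field_simps)
    finally have "\<bar>\<phi> p - \<phi> x\<bar> < 1" .
    moreover have "\<phi> p = 1" using \<rho> cA by (simp add: \<phi>_def S_def u_def smooth_step_1)
    ultimately have "\<phi> x \<noteq> 0" by auto
    then have "x \<in> S" by (auto simp: \<phi>_def split: if_splits)
    then show "x \<in> U" using SW WU by blast
  qed
qed

text \<open>The real \<open>r\<close> confines the condition to points at finite distance, so
  nothing is said across components; by symmetry of the distance, the one-sided inequality
  suffices.\<close>

definition nonexpansive :: "('m \<Rightarrow> real) \<Rightarrow> bool" where
  "nonexpansive F \<longleftrightarrow> (\<forall>x y r. riem_dist A g x y = ereal r \<longrightarrow> F x \<le> F y + r)"

lemma nonexpansiveD: "nonexpansive F \<Longrightarrow> riem_dist A g x y = ereal r \<Longrightarrow> F x \<le> F y + r"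
  by (simp add: nonexpansive_def)

lemma nonexpansive_const: "nonexpansive (\<lambda>_. k)"
  unfolding nonexpansive_def by (metis add_increasing2 ereal_less_eq(5) order_refl riem_dist_nonneg)

lemma nonexpansive_max: "nonexpansive F \<Longrightarrow> nonexpansive G \<Longrightarrow> nonexpansive (\<lambda>x. max (F x) (G x))"
  unfolding nonexpansive_def by (simp add: max_def) (smt (verit))

lemma nonexpansive_min: "nonexpansive F \<Longrightarrow> nonexpansive G \<Longrightarrow> nonexpansive (\<lambda>x. min (F x) (G x))"
  unfolding nonexpansive_def by (simp add: min_def) (smt (verit))

lemma nonexpansive_diff_const: "nonexpansive F \<Longrightarrow> nonexpansive (\<lambda>x. F x - k)"
  unfolding nonexpansive_def by simp

lemma nonexpansive_const_diff: "nonexpansive F \<Longrightarrow> nonexpansive (\<lambda>x. k - F x)"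
  unfolding nonexpansive_def using riem_dist_sym by fastforce

lemma nonexpansive_SUP:
  assumes F: "\<And>i. i \<in> I \<Longrightarrow> nonexpansive (F i)" and I: "I \<noteq> {}" and M: "\<And>i x. i \<in> I \<Longrightarrow> F i x \<le> M"
  shows "nonexpansive (\<lambda>x. SUP i\<in>I. F i x)"
  unfolding nonexpansive_def
proof (intro allI impI)
  fix x y r assume r: "riem_dist A g x y = ereal r"
  show "(SUP i\<in>I. F i x) \<le> (SUP i\<in>I. F i y) + r"
  proof (rule cSUP_least[OF I])
    fix i assume i: "i \<in> I"
    have "F i y \<le> (SUP i\<in>I. F i y)" using M i by (intro cSUP_upper bdd_aboveI2)
    then show "F i x \<le> (SUP i\<in>I. F i y) + r" using nonexpansiveD[OF F[OF i] r] by simp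
  qed
qed

text \<open>Truncation yields a bounded real function even where the distance is infinite, and keeps
  all information below \<open>\<delta>\<close>.\<close>

definition truncated_dist :: "real \<Rightarrow> 'm \<Rightarrow> 'm \<Rightarrow> real" where
  "truncated_dist \<delta> p x = real_of_ereal (min (ereal \<delta>) (riem_dist A g p x))"

lemma truncated_dist:
  assumes "\<delta> > 0"
  shows "nonexpansive (truncated_dist \<delta> p)" "0 \<le> truncated_dist \<delta> p x" "truncated_dist \<delta> p x \<le> \<delta>"
    "truncated_dist \<delta> p p = 0" "truncated_dist \<delta> p x < \<delta> \<Longrightarrow> riem_dist A g p x = ereal (truncated_dist \<delta> p x)"
proof -
  have cases: "(\<exists>d\<ge>0. riem_dist A g p x = ereal d \<and> truncated_dist \<delta> p x = min \<delta> d) \<or>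
      (riem_dist A g p x = \<infinity> \<and> truncated_dist \<delta> p x = \<delta>)" for x
    using riem_dist_nonneg[of p x] by (cases "riem_dist A g p x") (auto simp: truncated_dist_def min_def)
  show "0 \<le> truncated_dist \<delta> p x" "truncated_dist \<delta> p x \<le> \<delta>"
    "truncated_dist \<delta> p x < \<delta> \<Longrightarrow> riem_dist A g p x = ereal (truncated_dist \<delta> p x)"
    using cases[of x] assms by auto
  show "truncated_dist \<delta> p p = 0"
    using assms by (simp add: truncated_dist_def riem_dist_self min_def)
  show "nonexpansive (truncated_dist \<delta> p)"
    unfolding nonexpansive_def
  proof (intro allI impI)
    fix x y r assume r: "riem_dist A g x y = ereal r"
    have "0 \<le> r" using riem_dist_nonneg[of x y] r by simp
    moreover have "riem_dist A g p x \<le> riem_dist A g p y + ereal r"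
      using riem_dist_triangle[of p x y] riem_dist_sym[of x y] r by simp
    ultimately show "truncated_dist \<delta> p x \<le> truncated_dist \<delta> p y + r"
      using cases[of x] cases[of y] by auto
  qed
qed

lemma nonexpansive_flat:
  assumes F: "nonexpansive F" and flat: "flat c p r" and xy: "x \<in> chart_ball c p r" "y \<in> chart_ball c p r"
  shows "F x - F y \<le> 2 * sqrt (metric_form c (snd c p) (snd c x - snd c y) (snd c x - snd c y))"
proof -
  have *: "riem_dist A g x y \<le> ereal (2 * sqrt (metric_form c (snd c p) (snd c x - snd c y) (snd c x - snd c y)))"
    by (rule flat_riem_dist[OF flat xy])
  then obtain d where "riem_dist A g x y = ereal d"
    using riem_dist_nonneg[of x y] by (cases "riem_dist A g x y") auto
  then show ?thesis using nonexpansiveD[OF F] * by fastforce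
qed

text \<open>Continuity here refers to the manifold topology; near each point the distance is
  dominated by a norm in coordinates.\<close>

lemma nonexpansive_continuous:
  assumes F: "nonexpansive F" shows "continuous_on UNIV F"
proof (rule continuous_at_imp_continuous_on, rule ballI)
  fix p
  obtain c where c: "c \<in> charts p" using ex_chart by blast
  have cA: "c \<in> A" "p \<in> fst c" using c by (auto simp: charts_iff)
  obtain r where flat: "flat c p r" by (rule ex_flat[OF c])
  define b where "b x = 2 * sqrt (metric_form c (snd c p) (snd c x - snd c p) (snd c x - snd c p))" for x
  have "isCont (snd c) p"
    using continuous_on_chart[OF cA(1)] open_chart(1)[OF cA(1)] cA(2) continuous_on_eq_continuous_at by blast
  then have "isCont b p" unfolding b_def by (intro continuous_intros)
  then have "(b \<longlongrightarrow> 0) (at p)" by (simp add: continuous_at b_def)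
  moreover have "\<forall>\<^sub>F x in at p. norm (F x - F p) \<le> b x"
    unfolding eventually_at_topological
  proof (intro exI[of _ "chart_ball c p r"] conjI ballI impI)
    fix x assume x: "x \<in> chart_ball c p r"
    have "metric_form c (snd c p) (snd c p - snd c x) (snd c p - snd c x)
        = metric_form c (snd c p) (snd c x - snd c p) (snd c x - snd c p)"
      by (simp add: blinfun.diff_left blinfun.diff_right)
    then show "norm (F x - F p) \<le> b x"
      using nonexpansive_flat[OF F flat x chart_ball_center[OF flat]]
        nonexpansive_flat[OF F flat chart_ball_center[OF flat] x] by (simp add: b_def abs_le_iff)
  qed (use chart_ball_props[OF flat] in auto)
  ultimately have "((\<lambda>x. F x - F p) \<longlongrightarrow> 0) (at p)" by (rule Lim_null_comparison[rotated])
  then show "isCont F p" unfolding isCont_def by (simp add: LIM_zero_iff)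
qed

lemma nonexpansive_open:
  assumes "nonexpansive F" shows "open {x. k < F x}" "open {x. F x < k}"
  using nonexpansive_continuous[OF assms] by (auto intro!: open_Collect_less continuous_intros)

text \<open>Where 8 comes from: in the chart \<open>F\<close> has Lipschitz constant 2 for the form
  at the centre, the regularization doubles it, and returning to the form at \<open>x\<close> costs
  another 2.\<close>

lemma local_C1_approximation:
  assumes F: "nonexpansive F" and M: "\<And>x. \<bar>F x\<bar> \<le> M" and flat: "flat c p r" and e: "e > 0"
  obtains \<Phi> where "\<And>x. x \<in> chart_ball c p r \<Longrightarrow> C1_bound \<Phi> x 8 \<and> \<bar>\<Phi> x - F x\<bar> \<le> e"
proof -
  have c: "c \<in> charts p" and cA: "c \<in> A" "p \<in> fst c" and sub: "ball (snd c p) r \<subseteq> image_of c"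
    using flat by (auto simp: flat_def charts_iff)
  let ?B = "metric_form c (snd c p)" and ?S = "ball (snd c p) r"
  obtain a where a: "a > 0" "\<And>h. a * (norm h)\<^sup>2 \<le> ?B h h"
    by (rule metric_form_coercive[OF c]) blast
  have inv: "chart_inv c y \<in> chart_ball c p r" "snd c (chart_inv c y) = y" if "y \<in> ?S" for y
  proof -
    have "y \<in> image_of c" using that sub by blast
    then show "chart_inv c y \<in> chart_ball c p r" "snd c (chart_inv c y) = y"
      using that chart_inv_in[OF cA(1)] chart_chart_inv[OF cA(1)] by (auto simp: chart_ball_def)
  qed
  have "\<exists>u D. (\<forall>x. (u has_derivative blinfun_apply (D x)) (at x)) \<and> continuous_on UNIV D \<and>
      (\<forall>x\<in>?S. \<bar>u x - (F \<circ> chart_inv c) x\<bar> \<le> e \<and> (\<forall>h. \<bar>blinfun_apply (D x) h\<bar> \<le> 2 * 2 * sqrt (?B h h)))"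
  proof (rule lipschitz_C1_approximation[OF metric_form_sym[OF c] a])
    show "bdd_below ((F \<circ> chart_inv c) ` ?S)"
      using M by (intro bdd_belowI2[of _ "- M"]) (simp add: abs_le_iff minus_le_iff)
    show "(F \<circ> chart_inv c) x - (F \<circ> chart_inv c) z \<le> 2 * sqrt (?B (x - z) (x - z))"
      if "x \<in> ?S" "z \<in> ?S" for x z
      using nonexpansive_flat[OF F flat inv(1)[OF that(1)] inv(1)[OF that(2)]] inv(2) that by simp
  qed (use e in auto)
  then obtain u D where *: "\<forall>x. (u has_derivative blinfun_apply (D x)) (at x)" "continuous_on UNIV D"
    "\<forall>x\<in>?S. \<bar>u x - (F \<circ> chart_inv c) x\<bar> \<le> e \<and> (\<forall>h. \<bar>blinfun_apply (D x) h\<bar> \<le> 2 * 2 * sqrt (?B h h))"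
    by blast
  have u: "\<And>x. (u has_derivative blinfun_apply (D x)) (at x)" "continuous_on UNIV D"
    "\<And>x. x \<in> ?S \<Longrightarrow> \<bar>u x - F (chart_inv c x)\<bar> \<le> e"
    "\<And>x h. x \<in> ?S \<Longrightarrow> \<bar>blinfun_apply (D x) h\<bar> \<le> 4 * sqrt (?B h h)"
    using * by auto
  show ?thesis
  proof (rule that[of "\<lambda>q. u (snd c q)"], rule conjI)
    fix x assume x: "x \<in> chart_ball c p r"
    then have xS: "snd c x \<in> ?S" "x \<in> fst c" by (auto simp: chart_ball_def)
    show "\<bar>u (snd c x) - F x\<bar> \<le> e" using u(3)[OF xS(1)] cA xS by simp
    show "C1_bound (\<lambda>q. u (snd c q)) x 8"
    proof (rule C1_boundI_chart[OF chart_ball_charts[OF flat x] open_UNIV _ u(1)])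
      fix h
      have "\<bar>D (snd c x) h\<bar> \<le> 4 * sqrt (?B h h)" by (rule u(4)[OF xS(1)])
      also have "\<dots> \<le> 4 * sqrt (4 * metric_form c (snd c x) h h)"
        using flat xS unfolding flat_def by (intro mult_left_mono real_sqrt_le_mono) auto
      finally show "\<bar>D (snd c x) h\<bar> \<le> 8 * sqrt (metric_form c (snd c x) h h)" by (simp add: real_sqrt_mult)
    qed (use u(2) in auto)
  qed
qed

end

section \<open>Global smoothing of nonexpansive functions\<close>

lemma ex_wellorder_relation:
  obtains less :: "'a \<Rightarrow> 'a \<Rightarrow> bool" where "\<And>a b. a \<noteq> b \<Longrightarrow> less a b \<or> less b a"
    "\<And>P x. P x \<Longrightarrow> \<exists>m. P m \<and> (\<forall>y. less y m \<longrightarrow> \<not> P y)"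
proof -
  obtain r :: "'a rel" where r: "Well_order r" "Field r = UNIV"
    using well_ordering[where 'a = 'a] by (elim exE conjE)
  then have wo: "wf (r - Id)" "total_on UNIV r" by (simp_all add: order_on_defs)
  show ?thesis
  proof (rule that[of "\<lambda>a b. (a, b) \<in> r - Id"])
    show "(a, b) \<in> r - Id \<or> (b, a) \<in> r - Id" if "a \<noteq> b" for a b
      using wo(2) that by (auto simp: total_on_def)
    show "\<exists>m. P m \<and> (\<forall>y. (y, m) \<in> r - Id \<longrightarrow> \<not> P y)" if "P x" for P x
      using wo(1) that unfolding wf_eq_minimal by (metis mem_Collect_eq)
  qed
qed

context riemannian begin

text \<open>
  Stone's construction of a \<open>\<sigma>\<close>-discrete refinement, which works without separability: the set
  \<open>{x. - \<sigma> n < s n x}\<close> is a disjoint union of open sets, each contained in one of the almost flat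
  chart balls.
\<close>

lemma sigma_discrete_levels:
  obtains s :: "nat \<Rightarrow> 'm \<Rightarrow> real" and \<sigma> :: "nat \<Rightarrow> real"
  where "\<And>n. 0 < \<sigma> n" "\<And>n. nonexpansive (s n)" "\<And>n x. \<bar>s n x\<bar> \<le> 1" "\<And>x. \<exists>n. \<sigma> n \<le> s n x"
    "\<And>n F M e. nonexpansive F \<Longrightarrow> (\<And>x. \<bar>F x\<bar> \<le> M) \<Longrightarrow> e > 0 \<Longrightarrow>
       \<exists>\<Phi>. \<forall>x. - \<sigma> n < s n x \<longrightarrow> C1_bound \<Phi> x 8 \<and> \<bar>\<Phi> x - F x\<bar> \<le> e"
proof -
  have "\<exists>c r t. flat c p r \<and> 0 < t \<and> t \<le> 1 \<and> (\<forall>x. riem_dist A g p x < ereal t \<longrightarrow> x \<in> chart_ball c p r)" for p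
  proof -
    obtain c where c: "c \<in> charts p" using ex_chart by blast
    obtain r where flat: "flat c p r" by (rule ex_flat[OF c])
    obtain t where t: "t > 0" "\<And>x. riem_dist A g p x < ereal t \<Longrightarrow> x \<in> chart_ball c p r"
      by (rule riem_ball_subset[OF open_chart_ball[OF flat] chart_ball_center[OF flat]]) blast
    have "x \<in> chart_ball c p r" if "riem_dist A g p x < ereal (min t 1)" for x
      by (rule t(2), rule less_le_trans[OF that]) simp
    then show ?thesis using flat t(1) by (intro exI[of _ c] exI[of _ r] exI[of _ "min t 1"]) auto
  qed
  then obtain c r t where flat: "\<And>p. flat (c p) p (r p)" and t: "\<And>p. 0 < t p" "\<And>p. t p \<le> 1"
    and ball: "\<And>p x. riem_dist A g p x < ereal (t p) \<Longrightarrow> x \<in> chart_ball (c p) p (r p)"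
    by metis
  obtain less :: "'m \<Rightarrow> 'm \<Rightarrow> bool" where total: "\<And>a b. a \<noteq> b \<Longrightarrow> less a b \<or> less b a"
    and least: "\<And>P x. P x \<Longrightarrow> \<exists>m. P m \<and> (\<forall>y. less y m \<longrightarrow> \<not> P y)"
    by (rule ex_wellorder_relation) blast
  \<comment> \<open>Positive exactly within distance \<open>t p\<close> of \<open>p\<close>; since
    \<open>t p \<le> 1\<close>, truncating the distance at 1 changes nothing there.\<close>
  define e where "e p x = max 0 (t p - truncated_dist 1 p x)" for p x
  have e: "nonexpansive (e p)" "0 \<le> e p x" "e p x \<le> 1" "0 < e p p" for p x
  proof -
    have "0 \<le> truncated_dist 1 p x" "truncated_dist 1 p p = 0" "nonexpansive (truncated_dist 1 p)"
      by (simp_all add: truncated_dist)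
    then show "nonexpansive (e p)" "0 \<le> e p x" "e p x \<le> 1" "0 < e p p"
      using t[of p] unfolding e_def
      by (auto intro!: nonexpansive_max nonexpansive_const nonexpansive_const_diff)
  qed
  have e_ball: "x \<in> chart_ball (c p) p (r p)" if "0 < e p x" for p x
  proof (rule ball)
    have "truncated_dist 1 p x < t p" using that by (auto simp: e_def)
    then show "riem_dist A g p x < ereal (t p)" using truncated_dist(5)[of 1 p x] t(2)[of p] by simp
  qed
  \<comment> \<open>Measures how strongly the indices before \<open>p\<close> claim
    \<open>x\<close>. The default 0 keeps the supremum over a nonempty set even if \<open>p\<close>
    has no predecessor.\<close>
  define m where "m p x = (SUP q. if less q p then e q x else 0)" for p x
  have m: "nonexpansive (m p)" "0 \<le> m p x" "m p x \<le> 1" for p x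
  proof -
    have b: "bdd_above (range (\<lambda>q. if less q p then e q x else 0))"
      using e by (intro bdd_aboveI2[of _ _ 1]) auto
    show "0 \<le> m p x" unfolding m_def
      by (rule cSUP_upper2[OF b UNIV_I]) (use e in auto)
    show "m p x \<le> 1" unfolding m_def by (rule cSUP_least) (use e in auto)
    have "nonexpansive (\<lambda>x. if less q p then e q x else 0)" for q
      using e(1) nonexpansive_const by (cases "less q p") auto
    then show "nonexpansive (m p)" unfolding m_def
      by (rule nonexpansive_SUP[where M = 1]) (use e in auto)
  qed
  have m_ge: "e q x \<le> m p x" if "less q p" for q p x
  proof -
    have "(if less q p then e q x else 0) \<le> m p x" unfolding m_def
      using e by (intro cSUP_upper bdd_aboveI2[of _ _ 1]) auto
    then show ?thesis using that by simp
  qed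
  define \<sigma> :: "nat \<Rightarrow> real" where "\<sigma> n = (1/2) ^ n / 4" for n
  have \<sigma>: "0 < \<sigma> n" "\<sigma> n \<le> 1" for n
    using power_le_one[of "1/2 :: real" n] by (simp_all add: \<sigma>_def)
  \<comment> \<open>Being above the floor \<open>- \<sigma> n\<close> forces
    \<open>e p x > 2 * \<sigma> n\<close> and \<open>m p x < 2 * \<sigma> n\<close>. Two such
    indices are incompatible, since the earlier one raises \<open>m\<close> of the later. If
    \<open>e p x \<ge> 4 * \<sigma> n\<close> and \<open>m p x = 0\<close>, the ceiling
    \<open>\<sigma> n\<close> is attained.\<close>
  define sp where "sp n p x = max (- \<sigma> n) (min (e p x - 3 * \<sigma> n) (\<sigma> n - m p x))" for n p x
  have sp: "nonexpansive (sp n p)" "- \<sigma> n \<le> sp n p x" "sp n p x \<le> \<sigma> n" for n p x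
  proof -
    show "nonexpansive (sp n p)" unfolding sp_def[abs_def]
      by (intro nonexpansive_max nonexpansive_min nonexpansive_const nonexpansive_const_diff
        nonexpansive_diff_const e m)
    show "- \<sigma> n \<le> sp n p x" "sp n p x \<le> \<sigma> n"
      unfolding sp_def using \<sigma>[of n] m(2)[of p x] by auto
  qed
  have sp_less: "2 * \<sigma> n < e p x" "m p x < 2 * \<sigma> n" if "- \<sigma> n < sp n p x" for n p x
    using that by (auto simp: sp_def)
  have unique: "p = q" if "- \<sigma> n < sp n p x" "- \<sigma> n < sp n q x" for n p q x
    using sp_less[OF that(1)] sp_less[OF that(2)] total[of p q] m_ge[of p q x] m_ge[of q p x] by fastforce
  define s where "s n x = (SUP p. sp n p x)" for n x
  have bdd: "bdd_above (range (\<lambda>p. sp n p x))" for n x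
    using sp by (intro bdd_aboveI2[of _ _ "\<sigma> n"]) auto
  have s_less: "\<exists>p. - \<sigma> n < sp n p x" if "- \<sigma> n < s n x" for n x
    using that unfolding s_def by (simp add: less_cSUP_iff[OF _ bdd])
  show ?thesis
  proof (rule that[of \<sigma> s])
    show "0 < \<sigma> n" for n by (rule \<sigma>)
    show "nonexpansive (s n)" for n
      unfolding s_def by (rule nonexpansive_SUP[where M = "\<sigma> n"]) (use sp in auto)
    show "\<bar>s n x\<bar> \<le> 1" for n x
    proof -
      have "s n x \<le> \<sigma> n" unfolding s_def by (rule cSUP_least) (use sp in auto)
      moreover have "- \<sigma> n \<le> s n x" unfolding s_def by (rule cSUP_upper2[OF bdd UNIV_I sp(2)])
      ultimately show ?thesis using \<sigma>(2)[of n] by linarith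
    qed
    show "\<exists>n. \<sigma> n \<le> s n x" for x
    proof -
      \<comment> \<open>The first index with a positive cutoff at \<open>x\<close> meets no earlier
        claim, so it suffices to take \<open>n\<close> large for this one \<open>p\<close>.\<close>
      obtain p where p: "0 < e p x" "\<And>q. less q p \<Longrightarrow> \<not> 0 < e q x"
        using least[of "\<lambda>p. 0 < e p x" x] e(4) by blast
      have "(if less q p then e q x else 0) = 0" for q using p(2)[of q] e(2)[of q x] by auto
      then have m0: "m p x = 0" by (simp add: m_def)
      obtain n where "(1/2) ^ n < e p x" using real_arch_pow_inv[of "e p x" "1/2"] p(1) by auto
      then have "4 * \<sigma> n \<le> e p x" by (simp add: \<sigma>_def)
      then have "\<sigma> n \<le> sp n p x" using m0 by (simp add: sp_def)
      also have "\<dots> \<le> s n x" unfolding s_def by (rule cSUP_upper[OF UNIV_I bdd])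
      finally show ?thesis ..
    qed
    fix n F M and \<delta> :: real
    assume F: "nonexpansive F" "\<And>x. \<bar>F x\<bar> \<le> M" and \<delta>: "\<delta> > 0"
    have "\<exists>\<Phi>. \<forall>x\<in>chart_ball (c p) p (r p). C1_bound \<Phi> x 8 \<and> \<bar>\<Phi> x - F x\<bar> \<le> \<delta>" for p
      by (rule local_C1_approximation[OF F flat \<delta>]) blast
    then obtain G where G: "\<And>p x. x \<in> chart_ball (c p) p (r p) \<Longrightarrow> C1_bound (G p) x 8 \<and> \<bar>G p x - F x\<bar> \<le> \<delta>"
      by metis
    \<comment> \<open>The description picks the one active index. It is the same throughout the open
      set \<open>{y. - \<sigma> n < sp n p y}\<close>, so that \<open>\<Phi>\<close> is locally a
      single \<open>G p\<close>.\<close>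
    define \<Phi> where "\<Phi> x = G (THE p. - \<sigma> n < sp n p x) x" for x
    have \<Phi>: "\<Phi> x = G p x" if "- \<sigma> n < sp n p x" for p x
      unfolding \<Phi>_def using that unique by (metis (mono_tags, lifting) the_equality)
    show "\<exists>\<Phi>. \<forall>x. - \<sigma> n < s n x \<longrightarrow> C1_bound \<Phi> x 8 \<and> \<bar>\<Phi> x - F x\<bar> \<le> \<delta>"
    proof (intro exI[of _ \<Phi>] allI impI)
      fix x assume "- \<sigma> n < s n x"
      then obtain p where p: "- \<sigma> n < sp n p x" using s_less by blast
      then have "0 < e p x" using sp_less(1)[OF p] \<sigma>(1)[of n] by linarith
      note G = G[OF e_ball[OF this]]
      have "C1_bound \<Phi> x 8"
        by (rule C1_bound_cong[OF conjunct1[OF G] nonexpansive_open(1)[OF sp(1)]]) (use p \<Phi> in auto)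
      then show "C1_bound \<Phi> x 8 \<and> \<bar>\<Phi> x - F x\<bar> \<le> \<delta>" using G \<Phi>[OF p] by simp
    qed
  qed
qed

lemma C1_bound_sum:
  assumes "finite I" "\<And>i. i \<in> I \<Longrightarrow> C1_bound (\<phi> i) p (K i)"
  shows "C1_bound (\<lambda>x. \<Sum>i\<in>I. \<phi> i x) p (\<Sum>i\<in>I. K i)"
  using assms
proof (induction I rule: finite_induct)
  case empty
  then show ?case using C1_bound_const[of 0] by simp
next
  case (insert i I)
  then show ?case using C1_bound_add[of "\<phi> i" p "K i"] by simp
qed

lemma C1_bound_smooth_step:
  assumes "C1_bound \<phi> p K" "\<sigma> > 0" "K \<ge> 0"
  shows "C1_bound (\<lambda>x. smooth_step ((\<phi> x - k) / \<sigma>)) p (2 / \<sigma> * K)"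
proof (rule C1_bound_compose[OF assms(1), of "\<lambda>t. smooth_step ((t - k) / \<sigma>)" "\<lambda>t. smooth_step' ((t - k) / \<sigma>) / \<sigma>"])
  fix t
  have "((\<lambda>t. (t - k) / \<sigma>) has_real_derivative 1 / \<sigma>) (at t)"
    using assms(2) by (auto intro!: derivative_eq_intros)
  from DERIV_chain2[OF has_real_derivative_smooth_step this]
  show "((\<lambda>t. smooth_step ((t - k) / \<sigma>)) has_real_derivative smooth_step' ((t - k) / \<sigma>) / \<sigma>) (at t)" by simp
next
  show "continuous_on UNIV (\<lambda>t. smooth_step' ((t - k) / \<sigma>) / \<sigma>)"
    using assms(2) by (intro continuous_intros continuous_on_compose2[OF continuous_on_smooth_step']) auto
  show "\<bar>smooth_step' ((\<phi> p - k) / \<sigma>) / \<sigma>\<bar> \<le> 2 / \<sigma>"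
    using abs_smooth_step'_le assms(2) by (simp add: divide_right_mono)
qed

text \<open>The weights are \<open>h n\<close> times the product of \<open>1 - h j\<close> over
  \<open>j < n\<close>. Their sums telescope, and all later weights vanish where some
  \<open>h n\<close> is 1. The levels are returned too, because the local approximations are
  controlled only where \<open>- \<sigma> n < s n x\<close>, and a weight must vanish near every
  other point.\<close>

lemma partition_of_unity:
  obtains s :: "nat \<Rightarrow> 'm \<Rightarrow> real" and \<sigma> :: "nat \<Rightarrow> real" and \<omega> :: "nat \<Rightarrow> 'm \<Rightarrow> real" and K :: "nat \<Rightarrow> real"
  where "\<And>n. 0 \<le> K n" "\<And>n x. C1_bound (\<omega> n) x (K n)" "\<And>n x. 0 \<le> \<omega> n x"
    "\<And>n x. s n x \<le> - \<sigma> n \<Longrightarrow> \<exists>W. open W \<and> x \<in> W \<and> (\<forall>y\<in>W. \<omega> n y = 0)"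
    "\<And>x. \<exists>N W. open W \<and> x \<in> W \<and> (\<forall>y\<in>W. (\<Sum>n<N. \<omega> n y) = 1 \<and> (\<forall>n\<ge>N. \<omega> n y = 0))"
    "\<And>n F M e. nonexpansive F \<Longrightarrow> (\<And>x. \<bar>F x\<bar> \<le> M) \<Longrightarrow> e > 0 \<Longrightarrow>
       \<exists>\<Phi>. \<forall>x. - \<sigma> n < s n x \<longrightarrow> C1_bound \<Phi> x 8 \<and> \<bar>\<Phi> x - F x\<bar> \<le> e"
proof -
  obtain s :: "nat \<Rightarrow> 'm \<Rightarrow> real" and \<sigma> :: "nat \<Rightarrow> real"
    where \<sigma>: "\<And>n. 0 < \<sigma> n" and s: "\<And>n. nonexpansive (s n)" "\<And>n x. \<bar>s n x\<bar> \<le> 1" "\<And>x. \<exists>n. \<sigma> n \<le> s n x"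
    and approx: "\<And>n F M e. nonexpansive F \<Longrightarrow> (\<And>x. \<bar>F x\<bar> \<le> M) \<Longrightarrow> e > 0 \<Longrightarrow>
       \<exists>\<Phi>. \<forall>x. - \<sigma> n < s n x \<longrightarrow> C1_bound \<Phi> x 8 \<and> \<bar>\<Phi> x - F x\<bar> \<le> e"
    by (rule sigma_discrete_levels) blast
  \<comment> \<open>The level functions are merely nonexpansive; they are smoothed by the very local
    approximations that they index.\<close>
  have "\<exists>\<Phi>. \<forall>x. - \<sigma> n < s n x \<longrightarrow> C1_bound \<Phi> x 8 \<and> \<bar>\<Phi> x - s n x\<bar> \<le> \<sigma> n / 4" for n
    by (rule approx[OF s(1) s(2)]) (use \<sigma>[of n] in simp)
  then obtain \<Phi> where \<Phi>: "\<And>n x. - \<sigma> n < s n x \<Longrightarrow> C1_bound (\<Phi> n) x 8"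
    "\<And>n x. - \<sigma> n < s n x \<Longrightarrow> \<bar>\<Phi> n x - s n x\<bar> \<le> \<sigma> n / 4"
    by metis
  \<comment> \<open>The step rises while \<open>\<Phi> n\<close> passes from
    \<open>- \<sigma> n / 2\<close> to \<open>\<sigma> n / 2\<close>. With the error
    \<open>\<sigma> n / 4\<close>, it is 0 where \<open>s n\<close> is below
    \<open>- (3/4) * \<sigma> n\<close>, so extension by 0 is smooth, and 1 where \<open>s n\<close>
    exceeds \<open>3/4 * \<sigma> n\<close>.\<close>
  define h where "h n x = (if - \<sigma> n < s n x then smooth_step ((\<Phi> n x - - \<sigma> n / 2) / \<sigma> n) else 0)" for n x
  have h: "0 \<le> h n x" "h n x \<le> 1" for n x by (auto simp: h_def smooth_step_bounds)
  have h0: "h n y = 0" if "s n y < - (3/4) * \<sigma> n" for n y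
  proof (cases "- \<sigma> n < s n y")
    case True
    then have "\<Phi> n y - - \<sigma> n / 2 \<le> 0" using \<Phi>(2)[OF True] that by linarith
    then have "(\<Phi> n y - - \<sigma> n / 2) / \<sigma> n \<le> 0" using \<sigma>[of n] by (simp add: divide_nonpos_pos)
    then show ?thesis by (simp add: h_def smooth_step_0)
  qed (simp add: h_def)
  have h1: "h n y = 1" if "3/4 * \<sigma> n < s n y" for n y
  proof -
    have s': "- \<sigma> n < s n y" using that \<sigma>[of n] by linarith
    then have "\<sigma> n \<le> \<Phi> n y - - \<sigma> n / 2" using \<Phi>(2)[OF s'] that by linarith
    then have "1 \<le> (\<Phi> n y - - \<sigma> n / 2) / \<sigma> n" using \<sigma>[of n] by simp
    then show ?thesis using s' by (simp add: h_def smooth_step_1)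
  qed
  define C where "C n = 2 / \<sigma> n * 8" for n
  have C: "0 \<le> C n" for n using \<sigma>[of n] by (simp add: C_def)
  have zero_near: "\<exists>W. open W \<and> x \<in> W \<and> (\<forall>y\<in>W. h n y = 0)" if "s n x \<le> - \<sigma> n" for n x
    using nonexpansive_open(2)[OF s(1), of n "- (3/4) * \<sigma> n"] that h0 \<sigma>[of n]
    by (intro exI[of _ "{y. s n y < - (3/4) * \<sigma> n}"]) auto
  have h_C1: "C1_bound (h n) x (C n)" for n x
  proof (cases "- \<sigma> n < s n x")
    case True
    have "C1_bound (\<lambda>x. smooth_step ((\<Phi> n x - - \<sigma> n / 2) / \<sigma> n)) x (C n)"
      unfolding C_def by (rule C1_bound_smooth_step[OF \<Phi>(1)[OF True] \<sigma>]) simp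
    then show ?thesis
      by (rule C1_bound_cong[OF _ nonexpansive_open(1)[OF s(1)]]) (use True in \<open>auto simp: h_def\<close>)
  next
    case False
    then obtain W where "open W" "x \<in> W" "\<forall>y\<in>W. h n y = 0" using zero_near[of n x] by auto
    then show ?thesis
      using C1_bound_cong[OF C1_bound_mono[OF C1_bound_const[of 0] C], of W x "h n" n] by auto
  qed
  define P where "P n x = (\<Prod>j<n. 1 - h j x)" for n x
  have P: "0 \<le> P n x" "P n x \<le> 1" for n x
    unfolding P_def using h by (auto intro!: prod_nonneg prod_le_1)
  have P_Suc: "P (Suc n) x = P n x * (1 - h n x)" for n x by (simp add: P_def)
  have P_C1: "C1_bound (P n) x (\<Sum>j<n. C j)" for n x
  proof (induction n)
    case 0
    then show ?case using C1_bound_const[of 1 x] by (simp add: P_def[abs_def])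
  next
    case (Suc n)
    have "C1_bound (\<lambda>x. 1 + (- 1) * h n x) x (0 + \<bar>- 1\<bar> * C n)"
      by (intro C1_bound_add C1_bound_cmult C1_bound_const h_C1)
    then have "C1_bound (\<lambda>x. 1 - h n x) x (C n)" by simp
    from C1_bound_mult[OF Suc this]
    have "C1_bound (P (Suc n)) x (\<bar>P n x\<bar> * C n + \<bar>1 - h n x\<bar> * (\<Sum>j<n. C j))"
      by (simp add: P_Suc[abs_def])
    moreover have "\<bar>P n x\<bar> * C n + \<bar>1 - h n x\<bar> * (\<Sum>j<n. C j) \<le> 1 * C n + 1 * (\<Sum>j<n. C j)"
      using P[of n x] h[of n x] C by (intro add_mono mult_right_mono sum_nonneg) auto
    ultimately show ?case by (auto elim: C1_bound_mono)
  qed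
  define \<omega> where "\<omega> n x = P n x * h n x" for n x
  define K where "K n = C n + (\<Sum>j<n. C j)" for n
  show ?thesis
  proof (rule that[of K \<omega> s \<sigma>])
    show "0 \<le> K n" for n using C by (simp add: K_def sum_nonneg)
    show "C1_bound (\<omega> n) x (K n)" for n x
    proof -
      have "\<bar>P n x\<bar> * C n + \<bar>h n x\<bar> * (\<Sum>j<n. C j) \<le> 1 * C n + 1 * (\<Sum>j<n. C j)"
        using P[of n x] h[of n x] C by (intro add_mono mult_right_mono sum_nonneg) auto
      then show ?thesis unfolding \<omega>_def[abs_def] K_def
        by (intro C1_bound_mono[OF C1_bound_mult[OF P_C1 h_C1]]) simp
    qed
    show "0 \<le> \<omega> n x" for n x using P h by (simp add: \<omega>_def)
    show "\<exists>W. open W \<and> x \<in> W \<and> (\<forall>y\<in>W. \<omega> n y = 0)" if "s n x \<le> - \<sigma> n" for n x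
      using zero_near[OF that] by (auto simp: \<omega>_def)
    show "\<exists>N W. open W \<and> x \<in> W \<and> (\<forall>y\<in>W. (\<Sum>n<N. \<omega> n y) = 1 \<and> (\<forall>n\<ge>N. \<omega> n y = 0))" for x
    proof -
      obtain n where n: "\<sigma> n \<le> s n x" using s(3) by blast
      have P0: "P m y = 0" if "3/4 * \<sigma> n < s n y" "Suc n \<le> m" for m y
        unfolding P_def using h1[OF that(1)] that(2) by (intro prod_zero) auto
      have sum: "(\<Sum>n<N. \<omega> n y) = 1 - P N y" for N y
        by (induction N) (simp_all add: P_Suc \<omega>_def algebra_simps, simp add: P_def)
      show ?thesis
      proof (intro exI[of _ "Suc n"] exI[of _ "{y. 3/4 * \<sigma> n < s n y}"] conjI ballI allI impI)
        show "open {y. 3/4 * \<sigma> n < s n y}" by (rule nonexpansive_open(1)[OF s(1)])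
        show "x \<in> {y. 3/4 * \<sigma> n < s n y}" using n \<sigma>[of n] by simp
        fix y assume y: "y \<in> {y. 3/4 * \<sigma> n < s n y}"
        show "(\<Sum>n<Suc n. \<omega> n y) = 1" unfolding sum using P0[of y "Suc n"] y by simp
        show "\<omega> m y = 0" if "Suc n \<le> m" for m using P0[of y m] y that by (simp add: \<omega>_def)
      qed
    qed
  qed (rule approx)
qed

lemma C1_approximation:
  assumes F: "nonexpansive F" "\<And>x. \<bar>F x\<bar> \<le> M" and e: "e > 0"
  obtains \<psi> where "\<And>x. C1_bound \<psi> x 9" "\<And>x. \<bar>\<psi> x - F x\<bar> \<le> e"
proof -
  obtain s :: "nat \<Rightarrow> 'm \<Rightarrow> real" and \<sigma> :: "nat \<Rightarrow> real" and \<omega> :: "nat \<Rightarrow> 'm \<Rightarrow> real" and K :: "nat \<Rightarrow> real"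
    where K: "\<And>n. 0 \<le> K n" and \<omega>: "\<And>n x. C1_bound (\<omega> n) x (K n)" "\<And>n x. 0 \<le> \<omega> n x"
      "\<And>n x. s n x \<le> - \<sigma> n \<Longrightarrow> \<exists>W. open W \<and> x \<in> W \<and> (\<forall>y\<in>W. \<omega> n y = 0)"
    and unity: "\<And>x. \<exists>N W. open W \<and> x \<in> W \<and> (\<forall>y\<in>W. (\<Sum>n<N. \<omega> n y) = 1 \<and> (\<forall>n\<ge>N. \<omega> n y = 0))"
    and approx: "\<And>n F M e. nonexpansive F \<Longrightarrow> (\<And>x. \<bar>F x\<bar> \<le> M) \<Longrightarrow> e > 0 \<Longrightarrow>
       \<exists>\<Phi>. \<forall>x. - \<sigma> n < s n x \<longrightarrow> C1_bound \<Phi> x 8 \<and> \<bar>\<Phi> x - F x\<bar> \<le> e"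
    by (rule partition_of_unity) blast
  \<comment> \<open>The differential of the \<open>n\<close>-th weight then contributes at most
    \<open>(1/2) ^ Suc n\<close>. These contributions sum to less than 1, and with the average of
    local differentials bounded by 8 this gives 9. The \<open>+ 1\<close> avoids a zero
    denominator.\<close>
  define d where "d n = min e ((1/2) ^ Suc n / (K n + 1))" for n
  have d: "0 < d n" "d n \<le> e" "d n * K n \<le> (1/2) ^ Suc n" for n
  proof -
    show "0 < d n" "d n \<le> e" using e K[of n] by (auto simp: d_def)
    have "d n * K n \<le> ((1/2) ^ Suc n / (K n + 1)) * (K n + 1)"
      using \<open>0 < d n\<close> K[of n] by (intro mult_mono) (auto simp: d_def)
    also have "\<dots> = (1/2) ^ Suc n" using K[of n] by (intro times_divide_eq_left[THEN trans] nonzero_mult_div_cancel_right) auto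
    finally show "d n * K n \<le> (1/2) ^ Suc n" .
  qed
  have "\<exists>\<Phi>. \<forall>x. - \<sigma> n < s n x \<longrightarrow> C1_bound \<Phi> x 8 \<and> \<bar>\<Phi> x - F x\<bar> \<le> d n" for n
    by (rule approx[OF F d(1)])
  then obtain \<Phi> where \<Phi>: "\<And>n x. - \<sigma> n < s n x \<Longrightarrow> C1_bound (\<Phi> n) x 8"
    "\<And>n x. - \<sigma> n < s n x \<Longrightarrow> \<bar>\<Phi> n x - F x\<bar> \<le> d n"
    by metis
  define \<psi> where "\<psi> x = (\<Sum>n. \<omega> n x * \<Phi> n x)" for x
  \<comment> \<open>With \<open>k = F x\<close> frozen, the derivatives of the weights at \<open>x\<close> only meet the small factors \<open>\<Phi> n x - F x\<close>.\<close>
  have \<psi>: "\<psi> y = k + (\<Sum>n<N. \<omega> n y * (\<Phi> n y - k))"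
    if "(\<Sum>n<N. \<omega> n y) = 1" "\<forall>n\<ge>N. \<omega> n y = 0" for y N k
  proof -
    have "\<psi> y = (\<Sum>n<N. \<omega> n y * \<Phi> n y)"
      unfolding \<psi>_def by (rule suminf_finite) (use that in auto)
    also have "\<dots> = (\<Sum>n<N. \<omega> n y) * k + (\<Sum>n<N. \<omega> n y * (\<Phi> n y - k))"
      by (simp add: right_diff_distrib sum_subtractf sum_distrib_right)
    finally show ?thesis using that by simp
  qed
  show ?thesis
  proof (rule that[of \<psi>])
    fix x
    obtain N W where W: "open W" "x \<in> W" "\<And>y. y \<in> W \<Longrightarrow> (\<Sum>n<N. \<omega> n y) = 1 \<and> (\<forall>n\<ge>N. \<omega> n y = 0)"
      using unity[of x] by blast
    have summand: "C1_bound (\<lambda>y. \<omega> n y * (\<Phi> n y - F x)) x (\<omega> n x * 8 + (1/2) ^ Suc n)" for n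
    proof (cases "- \<sigma> n < s n x")
      case True
      have "C1_bound (\<lambda>y. \<Phi> n y - F x) x 8"
        using C1_bound_add[OF \<Phi>(1)[OF True] C1_bound_const[of "- F x"]] by simp
      then have "C1_bound (\<lambda>y. \<omega> n y * (\<Phi> n y - F x)) x (\<bar>\<omega> n x\<bar> * 8 + \<bar>\<Phi> n x - F x\<bar> * K n)"
        by (rule C1_bound_mult[OF \<omega>(1)])
      moreover have "\<bar>\<Phi> n x - F x\<bar> * K n \<le> d n * K n"
        using \<Phi>(2)[OF True] K by (intro mult_right_mono) auto
      ultimately show ?thesis using d(3)[of n] \<omega>(2)[of n x] by (elim C1_bound_mono) simp
    next
      \<comment> \<open>Here \<open>\<Phi> n\<close> is uncontrolled, but the weight vanishes on a
        whole neighbourhood, so the product is locally 0.\<close>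
      case False
      then obtain V where V: "open V" "x \<in> V" "\<forall>y\<in>V. \<omega> n y = 0" using \<omega>(3)[of n x] by auto
      have "C1_bound (\<lambda>_. 0) x (\<omega> n x * 8 + (1/2) ^ Suc n)"
        by (rule C1_bound_mono[OF C1_bound_const]) (use \<omega>(2)[of n x] in simp)
      then show ?thesis by (rule C1_bound_cong[OF _ V(1,2)]) (use V in simp)
    qed
    have "C1_bound (\<lambda>y. F x + (\<Sum>n<N. \<omega> n y * (\<Phi> n y - F x))) x (0 + (\<Sum>n<N. \<omega> n x * 8 + (1/2) ^ Suc n))"
      by (intro C1_bound_add C1_bound_const C1_bound_sum summand) auto
    moreover have "(\<Sum>n<N. \<omega> n x * 8 + (1/2) ^ Suc n) \<le> 9"
    proof -
      have "(\<Sum>n<N. (1/2 :: real) ^ Suc n) = 1 - (1/2) ^ N" by (induction N) (simp_all add: field_simps)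
      then show ?thesis using W(3)[OF W(2)] by (simp add: sum.distrib sum_distrib_right[symmetric])
    qed
    ultimately have "C1_bound (\<lambda>y. F x + (\<Sum>n<N. \<omega> n y * (\<Phi> n y - F x))) x 9"
      by (auto elim: C1_bound_mono)
    then show "C1_bound \<psi> x 9"
      by (rule C1_bound_cong[OF _ W(1,2)]) (use W(3) \<psi> in blast)
    have "\<bar>\<omega> n x * (\<Phi> n x - F x)\<bar> \<le> \<omega> n x * e" for n
    proof (cases "- \<sigma> n < s n x")
      case True
      then show ?thesis using \<Phi>(2)[OF True] d(2)[of n] \<omega>(2)[of n x] by (simp add: abs_mult mult_left_mono)
    next
      case False
      then show ?thesis using \<omega>(3)[of n x] by auto
    qed
    then have "\<bar>\<Sum>n<N. \<omega> n x * (\<Phi> n x - F x)\<bar> \<le> (\<Sum>n<N. \<omega> n x * e)"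
      by (rule sum_abs[THEN order_trans, OF sum_mono])
    then show "\<bar>\<psi> x - F x\<bar> \<le> e"
      using \<psi>[where N = N and y = x and k = "F x"] W(3)[OF W(2)] by (simp add: sum_distrib_right[symmetric])
  qed
qed

text \<open>The step falls while the smoothed distance goes from \<open>\<delta> / 4\<close> to
  \<open>3 / 4 * \<delta>\<close>, which leaves room for its error \<open>\<delta> / 4\<close> at
  \<open>p\<close> and beyond distance \<open>\<delta>\<close>. The slope is 2 for the step, divided
  by the width \<open>\<delta> / 2\<close>, times 9.\<close>

lemma uniform_bumps:
  assumes "\<delta> > 0" "\<eta> > 0"
  obtains b where "\<And>x. C1_bound b x (\<eta> * (36 / \<delta>))" "\<And>x. 0 \<le> b x" "\<And>x. b x \<le> \<eta>"
    "b p = \<eta>" "\<And>x. ereal \<delta> \<le> riem_dist A g p x \<Longrightarrow> b x = 0"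
proof -
  have "\<bar>truncated_dist \<delta> p x\<bar> \<le> \<delta>" for x using truncated_dist(2,3)[OF assms(1), of p x] by simp
  then obtain \<psi> where \<psi>: "\<And>x. C1_bound \<psi> x 9" "\<And>x. \<bar>\<psi> x - truncated_dist \<delta> p x\<bar> \<le> \<delta> / 4"
    using C1_approximation[OF truncated_dist(1)[OF assms(1)], of p \<delta> "\<delta> / 4"] assms(1) by auto
  define b where "b x = \<eta> * smooth_step ((- \<psi> x - - (3 / 4 * \<delta>)) / (\<delta> / 2))" for x
  show ?thesis
  proof (rule that[of b])
    show "C1_bound b x (\<eta> * (36 / \<delta>))" for x
    proof -
      have "C1_bound (\<lambda>x. - \<psi> x) x 9" using C1_bound_cmult[OF \<psi>(1), of "- 1"] by simp
      from C1_bound_cmult[OF C1_bound_smooth_step[OF this, of "\<delta> / 2" "- (3 / 4 * \<delta>)"], of \<eta>]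
      show ?thesis using assms by (simp add: b_def[abs_def])
    qed
    show "0 \<le> b x" "b x \<le> \<eta>" for x
      using assms smooth_step_bounds by (simp_all add: b_def)
    have "\<psi> p \<le> \<delta> / 4" using \<psi>(2)[of p] truncated_dist(4)[OF assms(1)] by simp
    then have "1 \<le> (- \<psi> p - - (3 / 4 * \<delta>)) / (\<delta> / 2)" using assms by (simp add: field_simps)
    then show "b p = \<eta>" by (simp add: b_def smooth_step_1)
    show "b x = 0" if "ereal \<delta> \<le> riem_dist A g p x" for x
    proof -
      have "truncated_dist \<delta> p x = \<delta>" using that by (simp add: truncated_dist_def min_def)
      then have "\<bar>\<psi> x - \<delta>\<bar> \<le> \<delta> / 4" using \<psi>(2)[of x] by simp
      then have "3 / 4 * \<delta> \<le> \<psi> x" by linarith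
      then have "(- \<psi> x - - (3 / 4 * \<delta>)) / (\<delta> / 2) \<le> 0" using assms by (simp add: field_simps)
      then show ?thesis by (simp add: b_def smooth_step_0)
    qed
  qed
qed


section \<open>Series of \<open>C\<^sup>1\<close> functions, Lipschitz bounds and convergence in the
  distance\<close>

lemma C1_bound_suminf:
  assumes b: "\<And>n p. C1_bound (b n) p (E n)" and E: "summable E" "\<And>n. 0 \<le> E n"
    and H: "\<And>p. summable (\<lambda>n. b n p)"
  shows "C1_bound (\<lambda>x. \<Sum>n. b n x) p (\<Sum>n. E n)"
proof -
  obtain c where c: "c \<in> charts p" using ex_chart by blast
  have cA: "c \<in> A" "p \<in> fst c" using c by (auto simp: charts_iff)
  obtain r where flat: "flat c p r" by (rule ex_flat[OF c])
  have sub: "ball (snd c p) r \<subseteq> image_of c" and r: "0 < r" using flat by (auto simp: flat_def)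
  let ?B = "metric_form c (snd c p)" and ?S = "ball (snd c p) r"
  have "\<exists>D. (\<forall>x\<in>image_of c. ((b n \<circ> chart_inv c) has_derivative blinfun_apply (D x)) (at x)) \<and>
      continuous_on (image_of c) D \<and>
      (\<forall>p\<in>fst c. \<forall>v\<in>T p. \<bar>blinfun_apply (D (snd c p)) (v c)\<bar> \<le> E n * tnorm p v)" for n
    by (rule C1_bound_global[OF b cA(1)]) blast
  then obtain D where D: "\<And>n x. x \<in> image_of c \<Longrightarrow> ((b n \<circ> chart_inv c) has_derivative blinfun_apply (D n x)) (at x)"
    "\<And>n. continuous_on (image_of c) (D n)"
    "\<And>n p v. p \<in> fst c \<Longrightarrow> v \<in> T p \<Longrightarrow> \<bar>blinfun_apply (D n (snd c p)) (v c)\<bar> \<le> E n * tnorm p v"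
    by metis
  have D_le: "\<bar>D n x h\<bar> \<le> E n * sqrt (metric_form c x h h)" if x: "x \<in> image_of c" for n x h
  proof -
    define q where "q = chart_inv c x"
    have q: "q \<in> fst c" "snd c q = x" "c \<in> charts q"
      using x cA chart_inv_in[OF cA(1) x] chart_chart_inv[OF cA(1) x] by (simp_all add: q_def charts_iff)
    obtain v where "v \<in> T q" "v c = h" by (rule ex_tangent[OF q(3)])
    then show ?thesis using D(3)[OF q(1), of v n] tnorm_eq[OF q(3), of v] q by simp
  qed
  \<comment> \<open>In the flat ball the metric norm is at most \<open>k\<close> times the Hilbert
    norm, which turns the intrinsic bounds \<open>E n\<close> into operator bounds for the
    Weierstrass test. This \<open>k\<close> serves convergence only; the final bound at
    \<open>p\<close> is summed in the metric itself.\<close>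
  define k where "k = 2 * sqrt (norm ?B)"
  have normD: "norm (D n x) \<le> E n * k" if x: "x \<in> ?S" for n x
  proof (rule norm_blinfun_bound)
    show "0 \<le> E n * k" using E by (simp add: k_def)
    fix h
    have "?B h h \<le> norm (?B h) * norm h" using norm_blinfun[of "?B h" h] by simp
    also have "\<dots> \<le> (norm ?B * norm h) * norm h" by (intro mult_right_mono norm_blinfun) simp
    finally have "4 * ?B h h \<le> 4 * (norm ?B * (norm h)\<^sup>2)" by (simp add: power2_eq_square)
    then have "metric_form c x h h \<le> 4 * (norm ?B * (norm h)\<^sup>2)"
      using flat x unfolding flat_def by (meson order_trans)
    then have "sqrt (metric_form c x h h) \<le> sqrt (4 * (norm ?B * (norm h)\<^sup>2))" by (rule real_sqrt_le_mono)
    then have "sqrt (metric_form c x h h) \<le> k * norm h" by (simp add: k_def real_sqrt_mult)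
    then have "E n * sqrt (metric_form c x h h) \<le> E n * (k * norm h)" using E by (intro mult_left_mono) auto
    then show "norm (D n x h) \<le> E n * k * norm h" using D_le[of x n h] x sub by force
  qed
  define G where "G x = (\<Sum>n. D n x)" for x
  have sumk: "summable (\<lambda>n. E n * k)" using E(1) by (rule summable_mult2)
  have unif: "uniform_limit ?S (\<lambda>n x. \<Sum>i<n. D i x) G sequentially"
    unfolding G_def[abs_def] by (rule Weierstrass_m_test[OF normD sumk])
  have contG: "continuous_on ?S G"
  proof (rule uniform_limit_theorem[OF _ unif])
    show "\<forall>\<^sub>F n in sequentially. continuous_on ?S (\<lambda>x. \<Sum>i<n. D i x)"
      using D(2) sub by (intro always_eventually allI continuous_on_sum) (blast intro: continuous_on_subset)
  qed simp
  have "\<exists>G'. \<forall>x\<in>?S. (\<lambda>n. (b n \<circ> chart_inv c) x) sums (G' x) \<and> (G' has_derivative blinfun_apply (G x)) (at x within ?S)"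
  proof (rule has_derivative_series)
    show "((b n \<circ> chart_inv c) has_derivative blinfun_apply (D n x)) (at x within ?S)" if "x \<in> ?S" for n x
      using D(1) that sub by (blast intro: has_derivative_at_withinI)
    show "\<forall>\<^sub>F n in sequentially. \<forall>x\<in>?S. \<forall>h. norm ((\<Sum>i<n. D i x h) - G x h) \<le> e * norm h" if "0 < e" for e
      using uniform_limitD[OF unif that]
    proof eventually_elim
      case (elim n)
      show ?case
      proof (intro ballI allI)
        fix x h assume "x \<in> ?S"
        then have "norm ((\<Sum>i<n. D i x) - G x) \<le> e" using elim by (auto simp: dist_norm less_imp_le)
        then have "norm (((\<Sum>i<n. D i x) - G x) h) \<le> e * norm h"
          by (meson norm_blinfun order_trans mult_right_mono norm_ge_zero)
        then show "norm ((\<Sum>i<n. D i x h) - G x h) \<le> e * norm h"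
          by (simp add: blinfun.diff_left blinfun.sum_left)
      qed
    qed
    show "snd c p \<in> ?S" using r by simp
    show "(\<lambda>n. (b n \<circ> chart_inv c) (snd c p)) sums (\<Sum>n. (b n \<circ> chart_inv c) (snd c p))"
      using H by (intro summable_sums) simp
  qed simp
  then obtain G' where *: "\<forall>x\<in>?S. (\<lambda>n. (b n \<circ> chart_inv c) x) sums (G' x) \<and>
      (G' has_derivative blinfun_apply (G x)) (at x within ?S)" by (rule exE)
  have G': "(\<lambda>n. b n (chart_inv c x)) sums (G' x)" "(G' has_derivative blinfun_apply (G x)) (at x)"
    if "x \<in> ?S" for x
    using bspec[OF * that] unfolding at_within_open[OF that open_ball] by auto
  show ?thesis
  proof (rule C1_boundI_chart[OF c open_ball _ G'(2) contG])
    show "(\<Sum>n. b n q) = G' (snd c q)" if "q \<in> fst c" "snd c q \<in> ?S" for q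
      using G'(1)[OF that(2)] that cA by (simp add: sums_iff)
    fix h
    have x: "snd c p \<in> ?S" using r by simp
    have "summable (\<lambda>n. D n (snd c p))" by (rule summable_comparison_test[OF _ sumk]) (use normD[OF x] in blast)
    then have "G (snd c p) h = (\<Sum>n. D n (snd c p) h)"
      unfolding G_def by (rule bounded_linear.suminf[OF blinfun.bounded_linear_left])
    moreover have "norm (\<Sum>n. D n (snd c p) h) \<le> (\<Sum>n. E n * sqrt (?B h h))"
      using D_le[of "snd c p"] cA E(1) by (intro norm_suminf_le summable_mult2) auto
    ultimately show "\<bar>G (snd c p) h\<bar> \<le> (\<Sum>n. E n) * sqrt (?B h h)"
      using suminf_mult2[OF E(1), of "sqrt (?B h h)"] by simp
  qed (use r in auto)
qed

lemma C1_bound_imp_riem_lipschitz: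
  assumes \<phi>: "\<And>p. C1_bound \<phi> p K" and K: "K > 0" shows "riem_lipschitz A g \<phi>"
  unfolding riem_lipschitz_def
proof (intro exI[of _ K] conjI allI K)
  fix p q
  show "ereal \<bar>\<phi> p - \<phi> q\<bar> \<le> ereal K * riem_dist A g p q"
  proof (cases "riem_dist A g p q")
    case (real d)
    have "\<bar>\<phi> p - \<phi> q\<bar> \<le> K * d"
    proof (rule field_le_epsilon)
      fix e :: real assume "e > 0"
      then have "riem_dist A g p q < ereal (d + e / K)" using real K by simp
      from C1_bound_lipschitz[OF \<phi> less_imp_le[OF K] this]
      show "\<bar>\<phi> p - \<phi> q\<bar> \<le> K * d + e" using K by (simp add: distrib_left)
    qed
    then show ?thesis using real by simp
  next
    case MInf
    then show ?thesis using riem_dist_nonneg[of p q] by simp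
  qed (use K in simp)
qed

lemma riem_dist_tendsto_0I:
  assumes "\<And>e. e > 0 \<Longrightarrow> \<forall>\<^sub>F k in F. riem_dist A g (s k) x < ereal e"
  shows "((\<lambda>k. riem_dist A g (s k) x) \<longlongrightarrow> 0) F"
proof (rule order_tendstoI)
  fix a :: ereal assume "0 < a"
  then obtain e where e: "0 < ereal e" "ereal e < a" using ereal_dense2 by blast
  then show "\<forall>\<^sub>F k in F. riem_dist A g (s k) x < a"
    using assms[of e] by (auto elim!: eventually_mono)
qed (intro always_eventually allI, rule less_le_trans[OF _ riem_dist_nonneg])

text \<open>Connects completeness, which concerns the distance, with lower semicontinuity, which
  concerns the manifold topology.\<close>

lemma riem_dist_tendsto_imp_tendsto:
  assumes "((\<lambda>k. riem_dist A g (s k) x) \<longlongrightarrow> 0) F" shows "(s \<longlongrightarrow> x) F"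
proof (rule topological_tendstoI)
  fix U assume "open U" "x \<in> U"
  then obtain e where e: "e > 0" "\<And>y. riem_dist A g x y < ereal e \<Longrightarrow> y \<in> U"
    by (rule riem_ball_subset) blast
  have "\<forall>\<^sub>F k in F. riem_dist A g (s k) x < ereal e"
    using order_tendstoD(2)[OF assms, of "ereal e"] e(1) by simp
  then show "\<forall>\<^sub>F k in F. s k \<in> U"
    by eventually_elim (use e(2) riem_dist_sym in auto)
qed

lemma C1_bound_continuous:
  assumes \<phi>: "\<And>p. C1_bound \<phi> p K" and lim: "((\<lambda>k. riem_dist A g (s k) x) \<longlongrightarrow> 0) F"
  shows "((\<lambda>k. \<phi> (s k)) \<longlongrightarrow> \<phi> x) F"
proof (rule tendstoI)
  fix e :: real assume e: "e > 0"
  have "C1_bound \<phi> p (\<bar>K\<bar> + 1)" for p by (rule C1_bound_mono[OF \<phi>]) simp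
  note lip = C1_bound_lipschitz[OF this]
  have "\<forall>\<^sub>F k in F. riem_dist A g (s k) x < ereal (e / (\<bar>K\<bar> + 2))"
    using order_tendstoD(2)[OF lim, of "ereal (e / (\<bar>K\<bar> + 2))"] e by simp
  then show "\<forall>\<^sub>F k in F. dist (\<phi> (s k)) (\<phi> x) < e"
  proof eventually_elim
    case (elim k)
    have "\<bar>\<phi> (s k) - \<phi> x\<bar> \<le> (\<bar>K\<bar> + 1) * (e / (\<bar>K\<bar> + 2))" by (rule lip[OF _ elim]) simp
    also have "\<dots> < e" using e by (simp add: field_simps)
    finally show ?case by (simp add: dist_real_def)
  qed
qed

end

section \<open>The variational principle\<close>

text \<open>The infimum of \<open>f - S\<close> is taken as the supremum of the reals
  \<open>I\<close> with \<open>I + S \<le> f\<close>; this avoids subtraction of extended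
  reals.\<close>

lemma ex_almost_minimizer:
  fixes f :: "'a \<Rightarrow> ereal" and S :: "'a \<Rightarrow> real"
  assumes m: "\<And>p. ereal m \<le> f p" and p0: "f p0 \<noteq> \<infinity>" and M: "\<And>x. S x \<le> M" and \<eta>: "\<eta> > 0"
  obtains I p where "\<And>y. ereal (I + S y) \<le> f y" "f p < ereal (I + S p + \<eta>)"
proof -
  define X where "X = {I. \<forall>y. ereal (I + S y) \<le> f y}"
  have fin: "f y = \<infinity> \<or> (\<exists>r. f y = ereal r)" for y using m[of y] by (cases "f y") auto
  have "m - M \<in> X"
    unfolding X_def
  proof (intro CollectI allI)
    fix y
    have "ereal (m - M + S y) \<le> ereal m" using M[of y] by simp
    then show "ereal (m - M + S y) \<le> f y" using m[of y] by (rule order_trans)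
  qed
  moreover obtain r0 where r0: "f p0 = ereal r0" using fin[of p0] p0 by blast
  have bdd: "bdd_above X"
  proof (rule bdd_aboveI)
    fix I assume "I \<in> X"
    then have "ereal (I + S p0) \<le> f p0" by (simp add: X_def)
    then show "I \<le> r0 - S p0" using r0 by simp
  qed
  define I where "I = Sup X"
  have "ereal (I + S y) \<le> f y" for y
  proof (cases "f y = \<infinity>")
    case False
    then obtain r where r: "f y = ereal r" using fin by blast
    have "I \<le> r - S y" unfolding I_def
    proof (rule cSup_least)
      fix J assume "J \<in> X"
      then have "ereal (J + S y) \<le> f y" by (simp add: X_def)
      then show "J \<le> r - S y" using r by simp
    qed (use \<open>m - M \<in> X\<close> in auto)
    then show ?thesis using r by simp
  qed simp
  moreover have "I + \<eta> / 2 \<notin> X"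
    using cSup_upper[OF _ bdd, of "I + \<eta> / 2"] \<eta> by (auto simp: I_def)
  then obtain p where "f p < ereal (I + \<eta> / 2 + S p)" unfolding X_def by (auto simp: not_le)
  moreover from this have "f p < ereal (I + S p + \<eta>)" by (rule less_trans) (use \<eta> in simp)
  ultimately show ?thesis by (intro that)
qed

theorem corollary4p6:
  fixes A :: "('m::t2_space, 'h::{real_inner, complete_space}) chart set"
    and g :: "('m, 'h) metric"
    and f :: "'m \<Rightarrow> ereal"
    and \<epsilon> :: real
  assumes "riemannian_manifold A g"
    and "riem_complete A g"
    and "\<forall>p. f p \<noteq> -\<infinity>"
    and "lower_semicontinuous f"
    and "\<exists>m::real. \<forall>p. ereal m \<le> f p"
    and "\<exists>p. f p \<noteq> \<infinity>"
    and "\<epsilon> > 0"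
  shows "\<exists>\<phi> :: 'm \<Rightarrow> real.
           bounded (range \<phi>) \<and> C1_function A \<phi> \<and> riem_lipschitz A g \<phi> \<and>
           (\<exists>x. attains_strong_minimum_at A g (\<lambda>p. f p - ereal (\<phi> p)) x) \<and>
           sup_norm \<phi> < ereal \<epsilon> \<and> differential_sup_norm A g \<phi> < ereal \<epsilon>"
proof -
  interpret riemannian A g using assms(1) by unfold_locales
  obtain m where m: "\<And>p. ereal m \<le> f p" using assms(5) by blast
  obtain p0 where p0: "f p0 \<noteq> \<infinity>" using assms(6) by blast
  \<comment> \<open>The differentials
    \<open>\<eta> n * (36 / \<delta> n) = \<epsilon> / 4 * (1/16) ^ n\<close> have sum below
    \<open>\<epsilon> / 2\<close>; the 144 is 4 times 36. The ratio 1/32 makes the heights after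
    stage \<open>n\<close> add up to at most
    \<open>2 * \<eta> (Suc n) = \<eta> n / 16\<close>.\<close>
  define \<delta> :: "nat \<Rightarrow> real" where "\<delta> n = (1/2) ^ n" for n
  define \<eta> :: "nat \<Rightarrow> real" where "\<eta> n = \<epsilon> / 144 * (1/32) ^ n" for n
  have \<delta>: "0 < \<delta> n" for n by (simp add: \<delta>_def)
  have \<eta>: "0 < \<eta> n" "\<eta> (Suc n) = \<eta> n / 32" for n using assms(7) by (simp_all add: \<eta>_def)
  have "\<exists>b. (\<forall>x. C1_bound b x (\<eta> n * (36 / \<delta> n))) \<and> (\<forall>x. 0 \<le> b x) \<and> (\<forall>x. b x \<le> \<eta> n) \<and>
      b p = \<eta> n \<and> (\<forall>x. ereal (\<delta> n) \<le> riem_dist A g p x \<longrightarrow> b x = 0)" for n p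
    by (rule uniform_bumps[OF \<delta> \<eta>(1), where p = p]) blast
  then obtain b where b: "\<And>n p x. C1_bound (b n p) x (\<eta> n * (36 / \<delta> n))" "\<And>n p x. 0 \<le> b n p x"
    "\<And>n p x. b n p x \<le> \<eta> n" "\<And>n p. b n p p = \<eta> n"
    "\<And>n p x. ereal (\<delta> n) \<le> riem_dist A g p x \<Longrightarrow> b n p x = 0"
    by metis
  define near where "near n S I p \<longleftrightarrow> (\<forall>y. ereal (I + S y) \<le> f y) \<and> f p < ereal (I + S p + \<eta> n / 2)"
    for n and S :: "'m \<Rightarrow> real" and I p
  \<comment> \<open>The centre is a function of the partial sum alone, so that the recursion only
    has to carry \<open>S n\<close>.\<close>
  define X where "X n S = (SOME p. \<exists>I. near n S I p)" for n and S :: "'m \<Rightarrow> real"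
  define S where "S = rec_nat (\<lambda>_. 0) (\<lambda>n Sn x. Sn x + b n (X n Sn) x)"
  define x where "x n = X n (S n)" for n
  define B where "B n = b n (x n)" for n
  have S: "S n y = (\<Sum>k<n. B k y)" for n y
    by (induction n) (simp_all add: S_def B_def x_def)
  have "\<exists>p I. near n (S n) I p" for n
  proof -
    have "S n y \<le> (\<Sum>k<n. \<eta> k)" for y unfolding S B_def by (intro sum_mono b(3))
    then obtain I p where "\<And>y. ereal (I + S n y) \<le> f y" "f p < ereal (I + S n p + \<eta> n / 2)"
      using \<eta>(1)[of n] by (rule ex_almost_minimizer[where f = f and S = "S n", OF m p0 _ half_gt_zero]) blast
    then show ?thesis unfolding near_def by blast
  qed
  then have "\<exists>I. near n (S n) I (x n)" for n
    unfolding x_def X_def by (rule someI_ex)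
  then obtain I where I: "\<And>n y. ereal (I n + S n y) \<le> f y" "\<And>n. f (x n) < ereal (I n + S n (x n) + \<eta> n / 2)"
    unfolding near_def by metis
  have sum\<eta>: "summable (\<lambda>k. \<eta> (k + n))" "(\<Sum>k. \<eta> (k + n)) \<le> 2 * \<eta> n" for n
  proof -
    have eq: "\<eta> (k + n) = \<eta> n * (1/32) ^ k" for k by (simp add: \<eta>_def power_add)
    have "(\<lambda>k. \<eta> (k + n)) sums (\<eta> n * (1 / (1 - 1/32)))"
      unfolding eq by (intro sums_mult geometric_sums) simp
    then show "summable (\<lambda>k. \<eta> (k + n))" "(\<Sum>k. \<eta> (k + n)) \<le> 2 * \<eta> n"
      using \<eta>(1)[of n] by (simp_all add: sums_iff)
  qed
  have sumB: "summable (\<lambda>k. B k y)" for y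
  proof (rule summable_comparison_test')
    show "summable \<eta>" using sum\<eta>(1)[of 0] by simp
    show "norm (B k y) \<le> \<eta> k" for k using b(2)[of k "x k" y] b(3)[of k "x k" y] by (simp add: B_def)
  qed
  define \<phi> where "\<phi> y = (\<Sum>k. B k y)" for y
  have \<phi>: "S n y \<le> \<phi> y" "\<phi> y \<le> S n y + 2 * \<eta> n" for n y
  proof -
    have split: "\<phi> y = (\<Sum>k. B (k + n) y) + S n y"
      unfolding \<phi>_def S by (rule suminf_split_initial_segment[OF sumB])
    have sumB': "summable (\<lambda>k. B (k + n) y)" by (rule summable_ignore_initial_segment[OF sumB])
    have "0 \<le> (\<Sum>k. B (k + n) y)" using sumB' b(2) by (intro suminf_nonneg) (auto simp: B_def)
    moreover have "(\<Sum>k. B (k + n) y) \<le> (\<Sum>k. \<eta> (k + n))"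
      using sumB' sum\<eta>(1) b(3) by (intro suminf_le) (auto simp: B_def)
    ultimately show "S n y \<le> \<phi> y" "\<phi> y \<le> S n y + 2 * \<eta> n" using split sum\<eta>(2)[of n] by auto
  qed
  have \<phi>0: "0 \<le> \<phi> y" "\<phi> y \<le> \<epsilon> / 2" for y
    using \<phi>[where n = 0 and y = y] assms(7) by (simp_all add: S \<eta>_def)
  have \<phi>_C1: "C1_bound \<phi> y (\<epsilon> / 2)" for y
  proof -
    have eq: "\<eta> n * (36 / \<delta> n) = \<epsilon> / 4 * (1/16) ^ n" for n
    proof -
      have "(1/32 :: real) ^ n = (1/16) ^ n * (1/2) ^ n" by (simp add: power_mult_distrib[symmetric])
      then show ?thesis by (simp add: \<eta>_def \<delta>_def)
    qed
    have sums: "(\<lambda>n. \<eta> n * (36 / \<delta> n)) sums (\<epsilon> / 4 * (1 / (1 - 1/16)))"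
      unfolding eq by (intro sums_mult geometric_sums) simp
    have "C1_bound \<phi> y (\<Sum>n. \<eta> n * (36 / \<delta> n))"
      unfolding \<phi>_def[abs_def]
    proof (rule C1_bound_suminf)
      show "C1_bound (B n) p (\<eta> n * (36 / \<delta> n))" for n p unfolding B_def by (rule b(1))
      show "summable (\<lambda>n. \<eta> n * (36 / \<delta> n))" using sums by (simp add: sums_iff)
      show "0 \<le> \<eta> n * (36 / \<delta> n)" for n using \<eta>(1)[of n] \<delta>[of n] by simp
    qed (rule sumB)
    then show ?thesis
      by (rule C1_bound_mono) (use sums assms(7) in \<open>simp add: sums_iff\<close>)
  qed
  \<comment> \<open>At \<open>x n\<close> the new bump has its full height \<open>\<eta> n\<close>,
    while the old difference was within \<open>\<eta> n / 2\<close> of its lower bound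
    \<open>I n\<close>.\<close>
  have I_Suc: "I (Suc n) \<le> I n - \<eta> n / 2" for n
  proof -
    have "ereal (I (Suc n) + S (Suc n) (x n)) < ereal (I n + S n (x n) + \<eta> n / 2)"
      by (rule le_less_trans[OF I])
    moreover have "S (Suc n) (x n) = S n (x n) + \<eta> n" by (simp add: S B_def b(4))
    ultimately show ?thesis by simp
  qed
  have I_less: "I k \<le> I n - \<eta> n / 2" if "n < k" for n k
    using that
  proof (induction k)
    case (Suc k)
    then show ?case using I_Suc[of k] \<eta>(1)[of k] by (cases "n = k") auto
  qed simp
  have \<eta>_less: "\<eta> k \<le> \<eta> n / 32" if "n < k" for n k
    using that
  proof (induction k)
    case (Suc k)
    then show ?case using \<eta>[of k] by (cases "n = k") auto
  qed simp
  \<comment> \<open>Beyond \<open>\<delta> n\<close> the \<open>n\<close>-th bump vanishes, so only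
    the tail of at most \<open>\<eta> n / 16\<close> separates \<open>\<phi>\<close> from
    \<open>S n\<close>, and \<open>f - \<phi>\<close> cannot fall below
    \<open>I n - \<eta> n / 8\<close>.\<close>
  have close: "riem_dist A g (x n) y < ereal (\<delta> n)" if "f y < ereal (I n - \<eta> n / 8 + \<phi> y)" for n y
  proof (rule ccontr)
    assume "\<not> riem_dist A g (x n) y < ereal (\<delta> n)"
    then have "S (Suc n) y = S n y" using b(5)[of n "x n" y] by (simp add: S B_def)
    then have "\<phi> y \<le> S n y + \<eta> n / 8" using \<phi>(2)[of y "Suc n"] \<eta>[of n] by simp
    then have "ereal (I n - \<eta> n / 8 + \<phi> y) \<le> ereal (I n + S n y)" by simp
    also have "\<dots> \<le> f y" by (rule I)
    finally show False using that by simp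
  qed
  \<comment> \<open>By \<open>I_less\<close> and \<open>\<eta>_less\<close>,
    \<open>f - \<phi>\<close> at a later centre is below
    \<open>I n - \<eta> n / 2 + \<eta> n / 64\<close>, so \<open>close\<close> applies to all later
    centres.\<close>
  have f_x: "f (x k) < ereal (I n - \<eta> n / 8 + \<phi> (x k))" if "n < k" for n k
  proof (rule less_le_trans[OF I(2)])
    show "ereal (I k + S k (x k) + \<eta> k / 2) \<le> ereal (I n - \<eta> n / 8 + \<phi> (x k))"
      using I_less[OF that] \<eta>_less[OF that] \<phi>(1)[of k "x k"] \<eta>(1)[of n] by simp
  qed
  have \<delta>_small: "\<exists>n. 2 * \<delta> n < e" if e: "e > 0" for e
  proof -
    obtain n where "(1/2) ^ n < e / 2" using real_arch_pow_inv[of "e / 2" "1/2"] e by auto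
    then show ?thesis by (intro exI[of _ n]) (simp add: \<delta>_def)
  qed
  have near_x: "riem_dist A g y z < ereal (2 * \<delta> n)"
    if "riem_dist A g (x n) y < ereal (\<delta> n)" "riem_dist A g (x n) z < ereal (\<delta> n)" for n y z
  proof -
    have "riem_dist A g y z \<le> riem_dist A g (x n) y + riem_dist A g (x n) z"
      using riem_dist_triangle[of y z "x n"] riem_dist_sym[of y "x n"] by simp
    also have "\<dots> < ereal (\<delta> n) + ereal (\<delta> n)" using that by (rule ereal_add_strict_mono2)
    finally show ?thesis by simp
  qed
  have "\<exists>N. \<forall>i\<ge>N. \<forall>j\<ge>N. riem_dist A g (x i) (x j) < ereal e" if e: "e > 0" for e
  proof -
    obtain n where n: "2 * \<delta> n < e" using \<delta>_small[OF e] by blast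
    show ?thesis
    proof (intro exI[of _ "Suc n"] allI impI)
      fix i j assume "Suc n \<le> i" "Suc n \<le> j"
      then have "riem_dist A g (x i) (x j) < ereal (2 * \<delta> n)"
        by (intro near_x close f_x) auto
      then show "riem_dist A g (x i) (x j) < ereal e" by (rule less_trans) (use n in simp)
    qed
  qed
  then obtain z where z: "(\<lambda>n. riem_dist A g (x n) z) \<longlonglongrightarrow> 0"
    using assms(2) unfolding riem_complete_def by blast
  have \<phi>z: "(\<lambda>n. \<phi> (x n)) \<longlonglongrightarrow> \<phi> z" by (rule C1_bound_continuous[OF \<phi>_C1 z])
  have \<eta>0: "\<eta> \<longlonglongrightarrow> 0" using sum\<eta>(1)[of 0] by (simp add: summable_LIMSEQ_zero)
  \<comment> \<open>Each \<open>x n\<close> minimizes \<open>f - \<phi>\<close> up to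
    \<open>3 * \<eta> n\<close>: \<open>\<eta> n / 2\<close> comes from the choice of
    \<open>x n\<close>, and \<open>2 * \<eta> n\<close> from the tail of \<open>\<phi>\<close> at
    \<open>y\<close>. Lower semicontinuity carries this to the limit \<open>z\<close>.\<close>
  have min_real: "f z \<le> ereal (r - \<phi> y + \<phi> z)" if r: "f y = ereal r" for y r
  proof (rule ccontr)
    assume "\<not> ?thesis"
    then have "ereal (r - \<phi> y + \<phi> z) < f z" by (simp only: not_le)
    from ereal_dense2[OF this] obtain a where a: "r - \<phi> y + \<phi> z < a" "ereal a < f z" by auto
    have "\<forall>\<^sub>F n in sequentially. ereal a < f (x n)"
      using assms(4) a(2) riem_dist_tendsto_imp_tendsto[OF z]
      unfolding lower_semicontinuous_def filterlim_iff by blast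
    moreover have "(\<lambda>n. r - \<phi> y + \<phi> (x n) + 3 * \<eta> n) \<longlonglongrightarrow> r - \<phi> y + \<phi> z + 3 * 0"
      by (intro tendsto_intros \<phi>z \<eta>0)
    then have "\<forall>\<^sub>F n in sequentially. r - \<phi> y + \<phi> (x n) + 3 * \<eta> n < a"
      using a(1) by (intro order_tendstoD(2)) auto
    ultimately have "\<forall>\<^sub>F n in sequentially. False"
    proof eventually_elim
      case (elim n)
      have "I n + S n y \<le> r" using I(1)[of n y] r by simp
      then have "I n + S n (x n) + \<eta> n / 2 \<le> r - \<phi> y + \<phi> (x n) + 3 * \<eta> n"
        using \<phi>[where n = n and y = y] \<phi>[where n = n and y = "x n"] \<eta>(1)[of n] by linarith
      then have "ereal (I n + S n (x n) + \<eta> n / 2) < ereal a" using elim by simp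
      then show False using I(2)[of n] elim(1) by (meson less_asym less_trans)
    qed
    then show False by simp
  qed
  have fin: "f y = \<infinity> \<or> (\<exists>r. f y = ereal r)" for y using m[of y] by (cases "f y") auto
  define h where "h p = f p - ereal (\<phi> p)" for p
  have h_less: "h y < ereal k \<longleftrightarrow> f y < ereal (k + \<phi> y)" for y k
    using fin[of y] by (auto simp: h_def)
  have h_min: "h z \<le> h y" for y
  proof (cases "f y = \<infinity>")
    case False
    then obtain r where r: "f y = ereal r" using fin by blast
    obtain r' where r': "f z = ereal r'" using fin[of z] min_real[OF r] by auto
    show ?thesis using min_real[OF r] r r' by (simp add: h_def)
  qed (simp add: h_def)
  \<comment> \<open>The inequality is strict for every \<open>n\<close>, since already
    \<open>x (Suc n)\<close> lies below this level. Hence the values of a minimizing sequence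
    eventually fall below it too, and \<open>close\<close> puts its points into the
    \<open>n\<close>-th ball.\<close>
  have hz: "h z < ereal (I n - \<eta> n / 8)" for n
  proof (rule le_less_trans[OF h_min])
    show "h (x (Suc n)) < ereal (I n - \<eta> n / 8)" unfolding h_less by (rule f_x) simp
  qed
  have "attains_strong_minimum_at A g h z"
    unfolding attains_strong_minimum_at_def
  proof (intro conjI allI impI)
    show "h z = (INF y. h y)" by (intro antisym INF_greatest INF_lower h_min) simp
    fix s :: "nat \<Rightarrow> 'm" assume lim: "(\<lambda>n. h (s n)) \<longlonglongrightarrow> h z"
    show "(\<lambda>n. riem_dist A g (s n) z) \<longlonglongrightarrow> 0"
    proof (rule riem_dist_tendsto_0I)
      fix e :: real assume "e > 0"
      then obtain n where n: "2 * \<delta> n < e" using \<delta>_small by blast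
      have "\<forall>\<^sub>F k in sequentially. h (s k) < ereal (I n - \<eta> n / 8)"
        using lim hz by (rule order_tendstoD(2))
      then show "\<forall>\<^sub>F k in sequentially. riem_dist A g (s k) z < ereal e"
      proof eventually_elim
        case (elim k)
        have "riem_dist A g (s k) z < ereal (2 * \<delta> n)"
          using elim hz[of n] by (intro near_x close) (simp_all add: h_less)
        then show ?case by (rule less_trans) (use n in simp)
      qed
    qed
  qed
  then have "\<exists>x. attains_strong_minimum_at A g (\<lambda>p. f p - ereal (\<phi> p)) x"
    unfolding h_def[abs_def] by blast
  moreover have "bounded (range \<phi>)"
    using \<phi>0 by (intro boundedI[of _ "\<epsilon> / 2"]) auto
  moreover have "C1_function A \<phi>" by (rule C1_bound_imp_C1_function[OF \<phi>_C1])
  moreover have "riem_lipschitz A g \<phi>"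
    by (rule C1_bound_imp_riem_lipschitz[OF \<phi>_C1]) (use assms(7) in simp)
  moreover have "sup_norm \<phi> \<le> ereal (\<epsilon> / 2)"
    unfolding sup_norm_def using \<phi>0 by (intro SUP_least) simp
  then have "sup_norm \<phi> < ereal \<epsilon>" by (rule le_less_trans) (use assms(7) in simp)
  moreover have "differential_sup_norm A g \<phi> \<le> ereal (\<epsilon> / 2)"
    by (rule C1_bound_imp_differential_sup_norm[OF \<phi>_C1]) (use assms(7) in simp)
  then have "differential_sup_norm A g \<phi> < ereal \<epsilon>" by (rule le_less_trans) (use assms(7) in simp)
  ultimately show ?thesis by blast
qed

end
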